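(* Let $d\ge1$ be an integer, $T>0$, and let $p,q\in[1,\infty]$ satisfy $\frac1p+\frac1q\le\frac12$. Let $b\in L^2([0,T];L^p(\mathbb{T}^d))$ be a divergence-free vector field and let $u_0\in L^q(\mathbb{T}^d)$. Then there exists at most one distributional solution $u\in L^\infty([0,T];L^q(\mathbb{T}^d))$ to the Cauchy problem $\partial_t u+\operatorname{div}(bu)=\Delta u$ in $(0,T)\times\mathbb{T}^d$, $u|_{t=0}=u_0$.
   Context: $\mathbb{T}^d=\mathbb{R}^d/\mathbb{Z}^d$ is the flat torus. A vector field $b:[0,T]\times\mathbb{T}^d\to\mathbb{R}^d$ is divergence-free if $\operatorname{div}_x b=0$ in the sense of distributions. Distributional solution: a function $u\in L^\infty([0,T];L^q(\mathbb{T}^d))$ is a distributional solution to the Cauchy problem if for every $\varphi\in C_c^\infty([0,T)\times\mathbb{T}^d)$ $$\int_0^T\int_{\mathbb{T}^d}u(\partial_t\varphi+b\cdot\nabla\varphi+\Delta\varphi)\,dx\,dt+\int_{\mathbb{T}^d}u_0\,\varphi(0,\cdot)\,dx=0.$$ Functions are identified when equal almost everywhere. *)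

theory Defs
  imports "HOL-Probability.Essential_Supremum"
begin

text \<open>
  Functions on the flat torus are represented by functions on \<open>real ^ 'n\<close> that are
  invariant under the integer lattice, which is generated by the unit vectors. Integrals over the
  torus are integrals over the closed unit cube, a fundamental domain up to a null set; accordingly,
  almost everywhere equality on the torus is almost everywhere equality on the cube.
\<close>

definition torus_periodic :: "(real ^ 'n \<Rightarrow> 'b) \<Rightarrow> bool" where
  "torus_periodic f \<longleftrightarrow> (\<forall>x i. f (x + axis i 1) = f x)"

abbreviation unit_cube :: "(real ^ 'n) set" where
  "unit_cube \<equiv> cbox 0 1"

definition torus_measure :: "(real ^ 'n) measure" where
  "torus_measure = lebesgue_on unit_cube"


text \<open>Powers with a positive real exponent.\<close>

definition ennreal_powr :: "ennreal \<Rightarrow> real \<Rightarrow> ennreal" where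
  "ennreal_powr x a = (if x = top then top else ennreal (enn2real x powr a))"

text \<open>
  The integrand takes values in \<^typ>\<open>ennreal\<close> so that the norm can be iterated for the
  mixed norms below, where the inner norm may be infinite.
\<close>

definition Lp_norm :: "'a measure \<Rightarrow> ennreal \<Rightarrow> ('a \<Rightarrow> ennreal) \<Rightarrow> ennreal" where
  "Lp_norm M p g =
     (if p = \<infinity> then esssup M g
      else ennreal_powr (\<integral>\<^sup>+ x. ennreal_powr (g x) (enn2real p) \<partial>M) (1 / enn2real p))"

definition Lp_torus :: "ennreal \<Rightarrow> (real ^ 'n \<Rightarrow> 'b::euclidean_space) set" where
  "Lp_torus p = {f. torus_periodic f \<and> f \<in> borel_measurable torus_measure \<and>
     Lp_norm torus_measure p (\<lambda>x. ennreal (norm (f x))) < \<infinity>}"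

text \<open>
  The space \<open>L\<^sup>r([0,T]; L\<^sup>p)\<close> over the torus, as jointly Lebesgue measurable functions of time and
  space with finite mixed norm. For infinite \<open>p\<close> this is larger than the space of strongly
  measurable functions into \<open>L\<^sup>\<infinity>\<close>; for infinite \<open>r\<close> and \<open>p\<close> it is \<open>L\<^sup>\<infinity>\<close> of the space-time cylinder.
\<close>

definition Lr_Lp :: "real \<Rightarrow> ennreal \<Rightarrow> ennreal \<Rightarrow> (real \<Rightarrow> real ^ 'n \<Rightarrow> 'b::euclidean_space) set" where
  "Lr_Lp T r p = {f. (\<forall>t\<in>{0..T}. torus_periodic (f t)) \<and>
     (\<lambda>(t, x). f t x) \<in> borel_measurable (lebesgue_on ({0..T} \<times> unit_cube)) \<and>
     Lp_norm (lebesgue_on {0..T}) r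
       (\<lambda>t. Lp_norm torus_measure p (\<lambda>x. ennreal (norm (f t x)))) < \<infinity>}"


primrec Ck :: "nat \<Rightarrow> ('a::euclidean_space \<Rightarrow> real) \<Rightarrow> bool" where
  "Ck 0 f \<longleftrightarrow> continuous_on UNIV f"
| "Ck (Suc k) f \<longleftrightarrow> (\<forall>x. f differentiable (at x)) \<and>
     (\<forall>e\<in>Basis. Ck k (\<lambda>x. frechet_derivative f (at x) e))"

definition smooth :: "('a::euclidean_space \<Rightarrow> real) \<Rightarrow> bool" where
  "smooth f \<longleftrightarrow> (\<forall>k. Ck k f)"

definition grad :: "(real ^ 'n \<Rightarrow> real) \<Rightarrow> real ^ 'n \<Rightarrow> real ^ 'n" where
  "grad f x = (\<chi> i. frechet_derivative f (at x) (axis i 1))"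

definition laplacian :: "(real ^ 'n \<Rightarrow> real) \<Rightarrow> real ^ 'n \<Rightarrow> real" where
  "laplacian f x = (\<Sum>i\<in>UNIV. frechet_derivative (\<lambda>y. grad f y $ i) (at x) (axis i 1))"

text \<open>
  Test functions on \<open>[0,T)\<close> times the torus: smoothness up to the boundary \<open>t = 0\<close> means being the
  restriction of a smooth function defined for all times. Only the values at times in \<open>[0,T]\<close> are
  ever used, so nothing is required of the support at negative times. As the torus is compact,
  compactness of the support is a condition on the time variable alone.
\<close>

definition test_function :: "real \<Rightarrow> (real \<Rightarrow> real ^ 'n \<Rightarrow> real) \<Rightarrow> bool" where
  "test_function T \<phi> \<longleftrightarrow> smooth (\<lambda>(t, x). \<phi> t x) \<and> (\<forall>t. torus_periodic (\<phi> t)) \<and>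
     (\<exists>c<T. \<forall>t x. t > c \<longrightarrow> \<phi> t x = 0)"

text \<open>Test functions on \<open>(0,T)\<close> times the torus.\<close>

definition interior_test_function :: "real \<Rightarrow> (real \<Rightarrow> real ^ 'n \<Rightarrow> real) \<Rightarrow> bool" where
  "interior_test_function T \<phi> \<longleftrightarrow> smooth (\<lambda>(t, x). \<phi> t x) \<and> (\<forall>t. torus_periodic (\<phi> t)) \<and>
     (\<exists>a c. 0 < a \<and> c < T \<and> (\<forall>t x. t \<notin> {a..c} \<longrightarrow> \<phi> t x = 0))"

definition divergence_free :: "real \<Rightarrow> (real \<Rightarrow> real ^ 'n \<Rightarrow> real ^ 'n) \<Rightarrow> bool" where
  "divergence_free T b \<longleftrightarrow> (\<forall>\<phi>. interior_test_function T \<phi> \<longrightarrow>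
     (LINT t|lebesgue_on {0..T}. LINT x|torus_measure. b t x \<bullet> grad (\<phi> t) x) = 0)"

text \<open>
  The Cauchy problem \<open>\<partial>\<^sub>t u + div (b u) = \<Delta> u\<close> with initial datum \<open>u0\<close>.
\<close>

definition distributional_solution ::
  "real \<Rightarrow> ennreal \<Rightarrow> (real \<Rightarrow> real ^ 'n \<Rightarrow> real ^ 'n) \<Rightarrow> (real ^ 'n \<Rightarrow> real) \<Rightarrow>
   (real \<Rightarrow> real ^ 'n \<Rightarrow> real) \<Rightarrow> bool" where
  "distributional_solution T q b u0 u \<longleftrightarrow> u \<in> Lr_Lp T \<infinity> q \<and>
     (\<forall>\<phi>. test_function T \<phi> \<longrightarrow>
       (LINT t|lebesgue_on {0..T}. LINT x|torus_measure.
          u t x * (deriv (\<lambda>s. \<phi> s x) t + b t x \<bullet> grad (\<phi> t) x + laplacian (\<phi> t) x))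
       + (LINT x|torus_measure. u0 x * \<phi> 0 x) = 0)"

end

theory Submission
  imports Defs "HOL-Probability.Probability_Measure"
begin

text \<open>
  The difference \<open>w\<close> of two solutions solves the equation with zero initial datum. Formally, testing
  with \<open>w\<close> itself proves \<open>w = 0\<close>: the Laplacian gives the square integral of the gradient with a good
  sign, and \<open>\<integral> w (b \<bullet> \<nabla>w) = \<integral> b \<bullet> \<nabla>(w\<^sup>2/2)\<close> vanishes since \<open>b\<close> is divergence free. But \<open>w\<close> is
  not an admissible test function. The hypothesis \<open>1/p + 1/q \<le> 1/2\<close> says that \<open>b w\<close> is square
  integrable in space and time, and this is enough to test with a smoothing of \<open>w\<close> and to pass to the
  limit.

  The smoothing \<open>S\<close> is the convolution in space with a probability density \<open>k\<^sub>N\<close> that is a trigonometric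
  polynomial with Fourier coefficients \<open>a k\<close> between 0 and 1 and that concentrates at the origin
  (\<open>kernel_trig_poly\<close>, \<open>kernel_concentrates\<close>). Let \<open>f k\<close> be the Fourier coefficients of \<open>w\<close>. Testing
  the equation with a bump in time and a plane wave in space shows that \<open>f k\<close> is the primitive of an
  integrable function (\<open>weak_derivative_AE_primitive\<close>), so \<open>|f k|\<^sup>2\<close> may be differentiated. Summation
  gives
  \<open>d/dt (\<Sum>k. a k * |f k|\<^sup>2) / 2 = \<integral> w (b \<bullet> \<nabla>S) - (\<Sum>k. a k * |2 \<pi> k|\<^sup>2 * |f k|\<^sup>2)\<close>.
  For the smooth function \<open>S\<close> the identity \<open>\<integral> S (b \<bullet> \<nabla>S) = 0\<close> is available
  (\<open>transport_energy_vanishes\<close>), so \<open>w\<close> may be replaced by \<open>w - S\<close> in the first term. By Young's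
  inequality this term is at most half of \<open>\<integral> |b|\<^sup>2 |w - S|\<^sup>2\<close> plus half of \<open>\<integral> |\<nabla>S|\<^sup>2\<close>, and the second
  half is absorbed by the dissipation, because \<open>a\<^sup>2 \<le> a\<close> (\<open>spatial_energy_estimate\<close>). Hence
  \<open>(\<Sum>k. a k * |f k|\<^sup>2) \<le> \<integral>\<integral> |b|\<^sup>2 |w - S|\<^sup>2\<close> at almost every time. In particular no bound on the
  gradient of \<open>w\<close> has to be established.

  The right-hand side tends to zero with \<open>N\<close> (\<open>smoothing_error_tendsto_0\<close>). By Jensen's inequality it is
  at most the average with respect to \<open>k\<^sub>N\<close> of \<open>\<integral>\<integral> |b|\<^sup>2 |w - w(\<cdot> - y)|\<^sup>2\<close> over \<open>y\<close>, and this quantity is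
  bounded and tends to zero with \<open>y\<close>: the contribution of the large values of \<open>b\<close> is small uniformly in
  \<open>y\<close> by Hoelder's inequality (\<open>Hoelder_square\<close>), and for bounded \<open>b\<close> it suffices that translations are
  continuous in square mean (\<open>L2_translation_continuity\<close>). The left-hand side dominates \<open>\<integral> S\<^sup>2\<close>, so \<open>S\<close>
  tends to zero in square mean; but \<open>S\<close> tends to \<open>w\<close>, whence \<open>w = 0\<close> (\<open>solution_vanishes\<close>).

  These arguments are carried out for Borel functions that are periodic under the lattice. The Lebesgue
  measurable functions of the statement are first replaced by such representatives
  (\<open>borel_periodic_representative\<close>), and the closed unit cube by the half-open one, which is a fundamental
  domain in the strict sense, so that integrals of periodic functions are invariant under translation
  (\<open>nn_integral_fundamental_domains_eq\<close>).
\<close>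

section \<open>Bump functions in time and plane waves in space\<close>

lemma Ck_continuous: "Ck k f \<Longrightarrow> continuous_on UNIV f"
proof (cases k)
  case (Suc m)
  assume "Ck k f"
  then have "isCont f x" for x
    using Suc differentiable_imp_continuous_within[of f x UNIV] by simp
  then show ?thesis by (simp add: continuous_at_imp_continuous_on)
qed simp

lemma Ck_lower: "Ck (Suc k) f \<Longrightarrow> Ck k f"
proof (induction k arbitrary: f)
  case 0 then show ?case using Ck_continuous[OF 0] by simp
next
  case (Suc k)
  have "Ck (Suc k) (\<lambda>x. frechet_derivative f (at x) e)" if "e \<in> Basis" for e
    using Suc.prems that by (subst (asm) Ck.simps(2)) blast
  then show ?case using Suc.prems Suc.IH by (subst Ck.simps(2)) auto
qed

lemma Ck_SucI:
  assumes "\<And>x. (f has_derivative D x) (at x)" "\<And>e. e \<in> Basis \<Longrightarrow> Ck k (\<lambda>x. D x e)"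
  shows "Ck (Suc k) f"
  using assms(2) frechet_derivative_at[OF assms(1), symmetric] assms(1)
  by (auto simp: differentiable_def)

lemma Ck_Suc_has_derivative:
  "Ck (Suc k) f \<Longrightarrow> (f has_derivative frechet_derivative f (at x)) (at x)"
  by (simp add: frechet_derivative_works)

lemma Ck_const: "Ck k (\<lambda>x. c)"
proof (induction k arbitrary: c)
  case (Suc k)
  show ?case by (rule Ck_SucI[where D="\<lambda>x e. 0"]) (auto intro: Suc)
qed auto

lemma Ck_add: "Ck k f \<Longrightarrow> Ck k g \<Longrightarrow> Ck k (\<lambda>x. f x + g x)"
proof (induction k arbitrary: f g)
  case 0 then show ?case by (auto intro: continuous_intros)
next
  case (Suc k)
  show ?case
    by (rule Ck_SucI, rule has_derivative_add[OF Ck_Suc_has_derivative[OF Suc.prems(1)]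
          Ck_Suc_has_derivative[OF Suc.prems(2)]]) (use Suc in auto)
qed

lemma Ck_mult: "Ck k f \<Longrightarrow> Ck k g \<Longrightarrow> Ck k (\<lambda>x. f x * g x)"
proof (induction k arbitrary: f g)
  case 0 then show ?case by (auto intro: continuous_intros)
next
  case (Suc k)
  show ?case
    by (rule Ck_SucI, rule has_derivative_mult[OF Ck_Suc_has_derivative[OF Suc.prems(1)]
          Ck_Suc_has_derivative[OF Suc.prems(2)]])
      (intro Ck_add Suc.IH Ck_lower[OF Suc.prems(1)] Ck_lower[OF Suc.prems(2)],
       use Suc.prems in auto)
qed

text \<open>
  By the chain rule, a directional derivative of \<open>h\<close> composed with an affine form is a constant times
  \<open>h'\<close> composed with the same form, so the induction on the order of differentiability closes.
  Smoothness of functions on space-time is reduced by this to smoothness of functions of one variable.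
\<close>

lemma Ck_compose_affine:
  fixes h :: "real \<Rightarrow> real" and l :: "'a::euclidean_space \<Rightarrow> real"
  assumes "bounded_linear l" "Ck k h"
  shows "Ck k (\<lambda>z. h (l z + c))"
  using assms(2)
proof (induction k arbitrary: h)
  case 0
  then have "continuous_on UNIV h" by simp
  then show ?case
    using linear_continuous_on[OF assms(1)]
    by (auto intro!: continuous_on_compose2[of UNIV h] continuous_intros)
next
  case (Suc k)
  let ?d = "\<lambda>s. frechet_derivative h (at s) 1"
  have "Ck k ?d" using Suc.prems by auto
  have hd: "(h has_field_derivative ?d s) (at s)" for s
  proof (rule has_derivative_imp_has_field_derivative[OF Ck_Suc_has_derivative[OF Suc.prems]])
    interpret bounded_linear "frechet_derivative h (at s)"
      using Ck_Suc_has_derivative[OF Suc.prems] by (rule has_derivative_bounded_linear)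
    show "x * ?d s = frechet_derivative h (at s) x" for x
      using scaleR[of x 1] by simp
  qed
  have "((\<lambda>z. l z + c) has_derivative l) (at z)" for z
    using bounded_linear_imp_has_derivative[OF assms(1), of "at z"] has_derivative_add_const by blast
  from has_derivative_compose[OF this hd[THEN has_field_derivative_imp_has_derivative]]
  have "((\<lambda>z. h (l z + c)) has_derivative (\<lambda>e. ?d (l z + c) * l e)) (at z)" for z .
  then show ?case
    by (rule Ck_SucI) (intro Ck_mult Suc.IH Ck_const \<open>Ck k ?d\<close>)
qed

lemma Ck_real_SucI:
  assumes "\<And>x. (f has_real_derivative f' x) (at x)" "Ck k f'"
  shows "Ck (Suc k) f"
  by (rule Ck_SucI, rule has_field_derivative_imp_has_derivative[OF assms(1)]) (use assms(2) in auto)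

lemma Ck_cos: "Ck k (\<lambda>x. a * cos (x + c))"
proof (induction k arbitrary: a c)
  case (Suc k)
  have "((\<lambda>x. a * cos (x + c)) has_real_derivative (a * cos (x + (c + pi/2)))) (at x)" for x
    by (auto intro!: derivative_eq_intros simp: cos_add sin_add algebra_simps)
  then show ?case by (rule Ck_real_SucI) (rule Suc)
qed (auto intro!: continuous_intros)

text \<open>
  The smooth functions that vanish on the negative half-line come from \<open>exp (- 1/t)\<close>. Its derivatives
  are polynomials in \<open>1/t\<close> times the function itself; admitting the polynomial \<open>P\<close> as a parameter
  makes the family closed under differentiation.
\<close>

definition flat :: "real poly \<Rightarrow> real \<Rightarrow> real" where
  "flat P t = (if t \<le> 0 then 0 else poly P (1 / t) * exp (- (1 / t)))"

lemma poly_exp_tendsto_0: "((\<lambda>s. poly P s * exp (- s)) \<longlongrightarrow> (0::real)) at_top"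
proof (induction P)
  case 0 then show ?case by simp
next
  case (pCons a P)
  have "((\<lambda>s. s * (poly P s * exp (- s))) \<longlongrightarrow> (0::real)) at_top"
  proof -
    have "((\<lambda>s. \<Sum>i\<le>degree P. coeff P i * (s ^ Suc i / exp s)) \<longlongrightarrow> (\<Sum>i\<le>degree P. coeff P i * 0)) at_top"
      by (intro tendsto_intros tendsto_power_div_exp_0)
    then show ?thesis
      by (simp add: poly_altdef sum_distrib_left sum_distrib_right exp_minus field_simps)
  qed
  moreover have "((\<lambda>s::real. a * (s ^ 0 / exp s)) \<longlongrightarrow> a * 0) at_top"
    by (intro tendsto_intros tendsto_power_div_exp_0)
  ultimately have "((\<lambda>s. a * (s ^ 0 / exp s) + s * (poly P s * exp (- s))) \<longlongrightarrow> a * 0 + 0) at_top"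
    by (intro tendsto_add)
  then show ?case by (simp add: algebra_simps exp_minus field_simps)
qed

lemma flat_quotient_tendsto_0: "((\<lambda>t. flat P t / t) \<longlongrightarrow> 0) (at 0)"
proof -
  have "((\<lambda>s. poly (pCons 0 P) s * exp (- s)) \<longlongrightarrow> 0) (filtermap inverse (at_right 0))"
    using poly_exp_tendsto_0[of "pCons 0 P"] by (simp add: at_top_to_right)
  then have "((\<lambda>t. poly (pCons 0 P) (inverse t) * exp (- inverse t)) \<longlongrightarrow> 0) (at_right 0)"
    by (simp add: filterlim_filtermap)
  then have "((\<lambda>t. flat P t / t) \<longlongrightarrow> 0) (at_right 0)"
    by (rule Lim_transform_eventually)
      (auto simp: flat_def eventually_at_right_field field_simps intro: exI[of _ 1])
  moreover have "((\<lambda>t. flat P t / t) \<longlongrightarrow> 0) (at_left 0)"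
    by (rule tendsto_eventually) (auto simp: flat_def eventually_at_left_field intro: exI[of _ "-1"])
  ultimately show ?thesis by (simp add: filterlim_at_split)
qed

lemma flat_has_derivative:
  "(flat P has_real_derivative flat ([:0,0,1:] * (P - pderiv P)) t) (at t)"
proof -
  consider "t < 0" | "t = 0" | "t > 0" by linarith
  then show ?thesis
  proof cases
    case 1
    have "((\<lambda>t. 0) has_real_derivative 0) (at t)" by simp
    then have "(flat P has_real_derivative 0) (at t)"
      by (rule has_field_derivative_transform_within_open[of _ _ _ "{..<0}"])
        (use 1 in \<open>auto simp: flat_def\<close>)
    then show ?thesis using 1 by (simp add: flat_def)
  next
    case 2
    have "((\<lambda>y. (flat P y - flat P 0) / (y - 0)) \<longlongrightarrow> 0) (at 0)"
      using flat_quotient_tendsto_0[of P] by (simp add: flat_def[of P 0])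
    then show ?thesis using 2 by (simp add: has_field_derivative_iff flat_def)
  next
    case 3
    have "((\<lambda>t. poly P (1 / t) * exp (- (1 / t))) has_real_derivative
        flat ([:0,0,1:] * (P - pderiv P)) t) (at t)"
      using 3 by (auto intro!: derivative_eq_intros simp: flat_def field_simps power2_eq_square)
    then show ?thesis
      by (rule has_field_derivative_transform_within_open[of _ _ _ "{0<..}"])
        (use 3 in \<open>auto simp: flat_def\<close>)
  qed
qed

lemma Ck_flat: "Ck k (flat P)"
proof (induction k arbitrary: P)
  case 0
  show ?case using DERIV_isCont[OF flat_has_derivative] by (auto simp: continuous_at_imp_continuous_on)
next
  case (Suc k)
  show ?case by (rule Ck_real_SucI[OF flat_has_derivative Suc])
qed

text \<open>
  As \<open>n\<close> grows, the exponents tend to zero inside the interval, so that these smooth functions increase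
  to the indicator function of the open interval from \<open>a\<close> to \<open>c\<close>.
\<close>

definition bump :: "real \<Rightarrow> real \<Rightarrow> nat \<Rightarrow> real \<Rightarrow> real" where
  "bump a c n t = flat 1 ((n + 1) * t + (- ((n + 1) * a))) * flat 1 (- (n + 1) * t + (n + 1) * c)"

lemma bump_eq: "bump a c n t = flat 1 (real (Suc n) * (t - a)) * flat 1 (real (Suc n) * (c - t))"
  by (simp add: bump_def algebra_simps)

lemma Ck_bump: "Ck k (bump a c n)"
  unfolding bump_def[abs_def]
  by (rule Ck_mult; rule Ck_compose_affine[OF bounded_linear_mult_right Ck_flat])

lemma bump_range: "0 \<le> bump a c n t" "bump a c n t \<le> 1"
  unfolding bump_eq by (auto simp: flat_def simp del: of_nat_Suc intro!: mult_le_one)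

lemma bump_outside: "t \<notin> {a<..<c} \<Longrightarrow> bump a c n t = 0"
  by (auto simp: bump_eq flat_def mult_le_0_iff not_less)

lemma bump_tendsto: "(\<lambda>n. bump a c n t) \<longlonglongrightarrow> indicat_real {a<..<c} t"
proof (cases "t \<in> {a<..<c}")
  case False then show ?thesis by (simp add: bump_outside)
next
  case True
  have *: "(\<lambda>n. flat 1 (real (Suc n) * s)) \<longlonglongrightarrow> 1" if "s > 0" for s
  proof -
    have "(\<lambda>n. exp (- (inverse (real (Suc n)) * inverse s))) \<longlonglongrightarrow> exp (- (0 * inverse s))"
      by (intro tendsto_intros LIMSEQ_inverse_real_of_nat)
    then show ?thesis using that
      by (auto simp: flat_def mult_le_0_iff divide_simps simp del: of_nat_Suc intro: Lim_transform_eventually)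
  qed
  have "(\<lambda>n. bump a c n t) \<longlonglongrightarrow> 1 * 1"
    unfolding bump_eq using True by (intro tendsto_mult *) auto
  then show ?thesis using True by simp
qed


text \<open>
  Normalising the antiderivative to vanish at \<open>c\<close> makes it a test function in time that need not vanish at
  time zero, while its derivative is supported in the given interval.
\<close>

lemma bump_antiderivative:
  obtains \<eta> where "\<And>t. (\<eta> has_real_derivative bump a c n t) (at t)" "\<And>t. t \<ge> c \<Longrightarrow> \<eta> t = 0" "\<And>k. Ck k \<eta>"
proof -
  have "isCont (bump a c n) t" for t
    using Ck_bump[of 0 a c n] by (auto simp: continuous_on_eq_continuous_at)
  then obtain F where F: "(F has_real_derivative bump a c n t) (at t)" for t
    using einterval_antiderivative[of "-\<infinity>" \<infinity> "bump a c n"]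
    by (auto simp: has_real_derivative_iff_has_vector_derivative)
  define \<eta> where "\<eta> t = F t - F c" for t
  have d: "(\<eta> has_real_derivative bump a c n t) (at t)" for t
    unfolding \<eta>_def[abs_def] by (auto intro!: derivative_eq_intros F)
  have z: "\<eta> t = 0" if "t \<ge> c" for t
  proof (cases "t = c")
    case False
    with that have "c < t" by simp
    then have "\<eta> t = \<eta> c"
    proof (rule DERIV_isconst_end)
      show "continuous_on {c..t} \<eta>"
        using DERIV_isCont[OF d] by (simp add: continuous_at_imp_continuous_on)
      show "DERIV \<eta> x :> 0" if "c < x" "x < t" for x
        using d[of x] that by (simp add: bump_outside)
    qed
    then show ?thesis by (simp add: \<eta>_def)
  qed (simp add: \<eta>_def)
  have k: "Ck k \<eta>" for k
  proof (cases k)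
    case 0
    then show ?thesis using DERIV_isCont[OF d] by (simp add: continuous_at_imp_continuous_on)
  qed (use Ck_real_SucI[OF d Ck_bump] in simp)
  show thesis
    by (rule that[of \<eta>, OF d z k])
qed

text \<open>
  The frequency vectors of the characters of the torus.
\<close>

definition wavevec :: "int ^ 'n \<Rightarrow> real ^ 'n" where
  "wavevec k = (\<chi> i. 2 * pi * of_int (k $ i))"

lemma wavevec_add: "wavevec (k + l) = wavevec k + wavevec l"
  by (simp add: wavevec_def vec_eq_iff algebra_simps)

lemma wavevec_minus: "wavevec (- k) = - wavevec k"
  by (simp add: wavevec_def vec_eq_iff)

lemma wavevec_0 [simp]: "wavevec 0 = 0"
  by (simp add: wavevec_def vec_eq_iff)

lemma periodic_cos_wave: "torus_periodic (\<lambda>x. c * cos (wavevec k \<bullet> x + \<alpha>))"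
  unfolding torus_periodic_def
proof (intro allI)
  fix x i
  have "wavevec k \<bullet> (x + axis i 1) + \<alpha> = (wavevec k \<bullet> x + \<alpha>) + 2 * pi * of_int (k $ i)"
    by (simp add: inner_add_right wavevec_def inner_axis)
  then show "c * cos (wavevec k \<bullet> (x + axis i 1) + \<alpha>) = c * cos (wavevec k \<bullet> x + \<alpha>)"
    by (simp only: cos_add[of _ "2 * pi * of_int (k $ i)"] cos_int_2pin sin_int_2pin mult_1_right mult_zero_right diff_zero)
qed

lemma smooth_separated_wave:
  fixes \<eta> :: "real \<Rightarrow> real" and \<theta> :: "real ^ 'n"
  assumes "\<And>k. Ck k \<eta>"
  shows "smooth (\<lambda>(t, x). \<eta> t * cos (\<theta> \<bullet> x + \<alpha>))"
proof -
  have "Ck k (\<lambda>z::real \<times> (real ^ 'n). \<eta> (fst z + 0) * (1 * cos ((\<theta> \<bullet> snd z + \<alpha>) + 0)))" for k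
  proof (rule Ck_mult)
    show "Ck k (\<lambda>z::real \<times> (real ^ 'n). \<eta> (fst z + 0))"
      by (rule Ck_compose_affine[OF bounded_linear_fst assms])
    have "bounded_linear (\<lambda>z::real \<times> (real ^ 'n). \<theta> \<bullet> snd z)"
      by (rule bounded_linear_compose[OF bounded_linear_inner_right bounded_linear_snd])
    from Ck_compose_affine[OF this Ck_cos]
    show "Ck k (\<lambda>z::real \<times> (real ^ 'n). 1 * cos ((\<theta> \<bullet> snd z + \<alpha>) + 0))" .
  qed
  then show ?thesis by (simp add: smooth_def case_prod_beta')
qed

lemma grad_eqI:
  assumes "(f has_derivative (\<lambda>e. v \<bullet> e)) (at x)"
  shows "grad f x = v"
  using frechet_derivative_at[OF assms, symmetric] by (simp add: grad_def vec_eq_iff inner_axis)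

lemma grad_cos_wave: "grad (\<lambda>x. c * cos (\<theta> \<bullet> x + \<alpha>)) x = (- c * sin (\<theta> \<bullet> x + \<alpha>)) *\<^sub>R \<theta>"
  by (rule grad_eqI) (auto intro!: derivative_eq_intros simp: fun_eq_iff)

lemma laplacian_cos_wave:
  "laplacian (\<lambda>x. c * cos (\<theta> \<bullet> x + \<alpha>)) x = - c * (\<theta> \<bullet> \<theta>) * cos (\<theta> \<bullet> x + \<alpha>)"
proof -
  have "((\<lambda>y. - c * sin (\<theta> \<bullet> y + \<alpha>) * \<theta> $ i) has_derivative
      (\<lambda>e. - c * (cos (\<theta> \<bullet> x + \<alpha>) * (\<theta> \<bullet> e)) * \<theta> $ i)) (at x)" for i
    by (auto intro!: derivative_eq_intros)
  from frechet_derivative_at[OF this, symmetric]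
  have "frechet_derivative (\<lambda>y. grad (\<lambda>x. c * cos (\<theta> \<bullet> x + \<alpha>)) y $ i) (at x) =
      (\<lambda>e. - c * (cos (\<theta> \<bullet> x + \<alpha>) * (\<theta> \<bullet> e)) * \<theta> $ i)" for i
    by (simp add: grad_cos_wave)
  then show ?thesis
    by (simp add: laplacian_def inner_axis inner_vec_def[of \<theta> \<theta>] sum_distrib_left
        sum_distrib_right sum_negf ac_simps)
qed

lemma test_function_wave:
  assumes "\<And>k. Ck k \<eta>" "\<And>t. t \<ge> c \<Longrightarrow> \<eta> t = 0" "c < T"
  shows "test_function T (\<lambda>t x. \<eta> t * cos (wavevec k \<bullet> x + \<alpha>))"
  unfolding test_function_def using assms
  by (auto intro!: smooth_separated_wave periodic_cos_wave exI[of _ c])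

lemma interior_test_function_wave:
  assumes "0 < a" "c < T"
  shows "interior_test_function T (\<lambda>t x. bump a c n t * cos (wavevec k \<bullet> x + \<alpha>))"
  unfolding interior_test_function_def using assms
  by (intro conjI allI impI smooth_separated_wave periodic_cos_wave Ck_bump exI[of _ a] exI[of _ c])
    (auto simp: bump_outside)

section \<open>Weak derivatives in time\<close>

lemma borel_measurable_cnj [measurable]: "cnj \<in> borel_measurable borel"
  by (intro borel_measurable_continuous_onI continuous_intros)

text \<open>
  The time interval carries the Borel measure, not its completion, so that Fubini's theorem applies
  without null set corrections.
\<close>

definition tim :: "real \<Rightarrow> real measure" where
  "tim T = restrict_space lborel {0..T}"

lemma space_tim [simp]: "space (tim T) = {0..T}"
  by (simp add: tim_def space_restrict_space)

lemma measurable_timI [measurable (raw)]: "f \<in> measurable borel N \<Longrightarrow> f \<in> measurable (tim T) N"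
  unfolding tim_def by (rule measurable_restrict_space1) simp

lemma finite_measure_tim: "finite_measure (tim T)"
  by standard (cases "0 \<le> T"; simp add: tim_def space_restrict_space emeasure_restrict_space)

interpretation tim: finite_measure "tim T" for T by (rule finite_measure_tim)

lemma AE_tim_iff: "(AE t in tim T. P t) \<longleftrightarrow> (AE t in lborel. t \<in> {0..T} \<longrightarrow> P t)"
  unfolding tim_def by (subst AE_restrict_space_iff) auto

lemma AE_tim_neq: "AE t in tim T. t \<noteq> r"
  by (simp add: AE_tim_iff AE_lborel_singleton eventually_mono[OF AE_lborel_singleton[of r]])

lemma integrable_tim_times_bounded:
  fixes h :: "real \<Rightarrow> 'b::{banach, second_countable_topology}"
  assumes "integrable (tim T) h" and [measurable]: "w \<in> borel_measurable borel" and "\<And>t. \<bar>w t\<bar> \<le> C"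
  shows "integrable (tim T) (\<lambda>t. w t *\<^sub>R h t)"
proof (rule Bochner_Integration.integrable_bound)
  show "integrable (tim T) (\<lambda>t. C *\<^sub>R h t)" using assms by simp
  show "(\<lambda>t. w t *\<^sub>R h t) \<in> borel_measurable (tim T)"
    using assms(1)[THEN borel_measurable_integrable] by measurable
  have "C \<ge> 0" using assms(3)[of 0] by simp
  then show "AE t in tim T. norm (w t *\<^sub>R h t) \<le> norm (C *\<^sub>R h t)"
    using assms(3) by (auto intro!: mult_right_mono)
qed

lemma bump_measurable [measurable]: "bump a c n \<in> borel_measurable borel"
  using Ck_bump[of 0 a c n] by (simp add: borel_measurable_continuous_onI)

lemma integral_tim_interval_limit:
  fixes h :: "real \<Rightarrow> 'b::{banach, second_countable_topology}"
  assumes h: "integrable (tim T) h" and [measurable]: "\<And>n. w n \<in> borel_measurable borel" "A \<in> sets borel"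
    and bd: "\<And>n t. \<bar>w n t\<bar> \<le> 1" and lim: "\<And>t. (\<lambda>n::nat. w n t) \<longlonglongrightarrow> indicat_real A t"
    and zero: "\<And>n. (LINT t|tim T. w n t *\<^sub>R h t) = 0"
  shows "(LINT t|tim T. indicat_real A t *\<^sub>R h t) = 0"
proof -
  note [measurable] = h[THEN borel_measurable_integrable]
  have "(\<lambda>n. LINT t|tim T. w n t *\<^sub>R h t) \<longlonglongrightarrow> (LINT t|tim T. indicat_real A t *\<^sub>R h t)"
  proof (rule integral_dominated_convergence[where w = "\<lambda>t. norm (h t)"])
    show "AE t in tim T. (\<lambda>n. w n t *\<^sub>R h t) \<longlonglongrightarrow> indicat_real A t *\<^sub>R h t"
      by (auto intro!: tendsto_scaleR lim)
    show "AE t in tim T. norm (w n t *\<^sub>R h t) \<le> norm (h t)" for n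
      using bd by (auto intro!: mult_left_le_one_le)
  qed (use h in auto)
  then show ?thesis by (simp add: zero LIMSEQ_const_iff)
qed

text \<open>
  In the limit, the bumps become indicator functions of open intervals. These form a generator of the
  Borel sets that is stable under intersection, hence the integral of \<open>h\<close> over every Borel set
  vanishes.
\<close>

lemma AE_zero_if_orthogonal_to_bumps:
  fixes h :: "real \<Rightarrow> 'b::{banach, second_countable_topology}"
  assumes h: "integrable (tim T) h"
    and orth: "\<And>a c n. 0 < a \<Longrightarrow> c < T \<Longrightarrow> (LINT t|tim T. bump a c n t *\<^sub>R h t) = 0"
  shows "AE t in tim T. h t = 0"
proof -
  note [measurable] = h[THEN borel_measurable_integrable]
  have inner: "(LINT t|tim T. indicat_real {a<..<c} t *\<^sub>R h t) = 0" if "0 < a" "c < T" for a c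
    by (rule integral_tim_interval_limit[OF h, of "bump a c"])
      (use that in \<open>auto simp: bump_range abs_of_nonneg intro!: orth bump_tendsto\<close>)
  have any: "(LINT t|tim T. indicat_real {a<..<c} t *\<^sub>R h t) = 0" for a c
  proof -
    \<comment> \<open>Bumps are available on compact parts of the open time interval only; the intervals I n exhaust it.\<close>
    define I where "I n = {max a (1 / Suc n)<..<min c (T - 1 / Suc n)}" for n
    have "(LINT t|tim T. indicat_real ({a<..<c} \<inter> {0<..<T}) t *\<^sub>R h t) = 0"
    proof (rule integral_tim_interval_limit[OF h, of "\<lambda>n. indicator (I n)"])
      show "(\<lambda>n. indicat_real (I n) t) \<longlonglongrightarrow> indicat_real ({a<..<c} \<inter> {0<..<T}) t" for t
      proof (cases "t \<in> {a<..<c} \<inter> {0<..<T}")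
        case False
        then have "t \<notin> I n" for n
          unfolding I_def by (auto simp: not_less) (smt (verit) divide_nonneg_nonneg of_nat_0_le_iff)+
        then show ?thesis using False by simp
      next
        case True
        then have "\<forall>\<^sub>F n in sequentially. inverse (real (Suc n)) < t"
          "\<forall>\<^sub>F n in sequentially. inverse (real (Suc n)) < T - t"
          by (intro order_tendstoD(2)[OF LIMSEQ_inverse_real_of_nat]; simp)+
        then have "\<forall>\<^sub>F n in sequentially. indicat_real (I n) t = 1"
          by eventually_elim (use True in \<open>auto simp: I_def inverse_eq_divide\<close>)
        then show ?thesis using True by (simp add: tendsto_eventually)
      qed
      show "(LINT t|tim T. indicat_real (I n) t *\<^sub>R h t) = 0" for n
        unfolding I_def by (rule inner) (auto simp: less_max_iff_disj min_less_iff_disj)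
    qed (auto simp: I_def indicator_def)
    moreover have "AE t in tim T. indicat_real {a<..<c} t *\<^sub>R h t =
        indicat_real ({a<..<c} \<inter> {0<..<T}) t *\<^sub>R h t"
      using AE_tim_neq[of 0 T] AE_tim_neq[of T T] AE_space[of "tim T"]
      by eventually_elim (auto simp: indicator_def)
    ultimately show ?thesis
      by (subst integral_cong_AE[where g = "\<lambda>t. indicat_real ({a<..<c} \<inter> {0<..<T}) t *\<^sub>R h t"]) auto
  qed
  let ?G = "range (\<lambda>(a, c). {a<..<c::real})"
  have sb: "sets (borel :: real measure) = sigma_sets UNIV ?G"
    by (subst borel_eq_box) (simp add: case_prod_beta' box_real)
  have total: "(LINT t|tim T. h t) = 0"
    using any[of "-1" "T + 1"] by (subst (asm) Bochner_Integration.integral_cong[OF refl, where g = h]) auto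
  have all: "(LINT t|tim T. indicat_real A t *\<^sub>R h t) = 0" if "A \<in> sets borel" for A
  proof -
    have "Int_stable ?G"
    proof -
      have "{a<..<b} \<inter> {c<..<d} = {max a c<..<min b d}" for a b c d :: real by auto
      then show ?thesis unfolding Int_stable_def by (auto intro: range_eqI)
    qed
    moreover have "?G \<subseteq> Pow UNIV" by simp
    moreover have "A \<in> sigma_sets UNIV ?G"
      using that by (simp add: sb)
    ultimately show ?thesis
    proof (induction rule: sigma_sets_induct_disjoint)
      case (basic A) then show ?case using any by auto
    next
      case (compl A)
      have [measurable]: "A \<in> sets borel" using compl(1) by (simp add: sb)
      have "(LINT t|tim T. indicat_real (UNIV - A) t *\<^sub>R h t)
          = (LINT t|tim T. h t - indicat_real A t *\<^sub>R h t)"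
        by (rule Bochner_Integration.integral_cong) (auto simp: indicator_def)
      also have "\<dots> = 0"
        using compl total by (subst Bochner_Integration.integral_diff)
          (auto intro!: h integrable_tim_times_bounded[of _ _ _ 1] simp: indicator_def)
      finally show ?case .
    next
      case (union A)
      have [measurable]: "A i \<in> sets borel" for i
        using union(2) by (auto simp: sb)
      have "(\<lambda>n. \<Sum>i<n. indicat_real (A i) t) \<longlonglongrightarrow> indicat_real (\<Union>i. A i) t" for t
        using indicator_sums[of A t] union(1) by (auto simp: sums_def disjoint_family_on_def)
      moreover have "(LINT t|tim T. (\<Sum>i<n. indicat_real (A i) t) *\<^sub>R h t) = 0" for n
        unfolding scaleR_sum_left using union
        by (subst Bochner_Integration.integral_sum)
          (auto intro!: h integrable_tim_times_bounded[of _ _ _ 1] simp: indicator_def)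
      moreover have "\<bar>\<Sum>i<n. indicat_real (A i) t\<bar> \<le> 1" for n t
        using union(1) by (subst indicator_UN_disjoint[symmetric])
          (auto simp: indicator_def intro: disjoint_family_on_mono[of _ UNIV])
      ultimately show ?case
        by (intro integral_tim_interval_limit[OF h, of "\<lambda>n t. \<Sum>i<n. indicat_real (A i) t"]) auto
    qed auto
  qed
  show ?thesis
  proof (rule tim.density_zero[OF h])
    fix A assume "A \<in> sets (tim T)"
    then obtain A' where "A' \<in> sets borel" "A = {0..T} \<inter> A'"
      by (auto simp: tim_def sets_restrict_space)
    then show "set_lebesgue_integral (tim T) A h = 0"
      using all[of A'] unfolding set_lebesgue_integral_def
      by (subst Bochner_Integration.integral_cong[OF refl, where g = "\<lambda>t. indicat_real A' t *\<^sub>R h t"])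
        (auto simp: indicator_def)
  qed
qed

lemma primitive_integrand_measurable:
  fixes g :: "real \<Rightarrow> complex"
  assumes "integrable (tim T) g"
  shows "(\<lambda>(s, t). indicat_real {..t} s *\<^sub>R g s) \<in> borel_measurable (tim T \<Otimes>\<^sub>M tim T)"
proof -
  note [measurable] = assms[THEN borel_measurable_integrable]
  have [measurable]: "(\<lambda>z. fst z) \<in> borel_measurable (tim T \<Otimes>\<^sub>M tim T)"
    "(\<lambda>z. snd z) \<in> borel_measurable (tim T \<Otimes>\<^sub>M tim T)"
    by (rule measurable_compose[OF measurable_fst], rule measurable_timI, simp)
      (rule measurable_compose[OF measurable_snd], rule measurable_timI, simp)
  have "(\<lambda>z. (if fst z \<le> snd z then g (fst z) else 0)) \<in> borel_measurable (tim T \<Otimes>\<^sub>M tim T)"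
    by measurable
  then show ?thesis
    by (rule measurable_cong[THEN iffD1, rotated]) (auto simp: indicator_def split: prod.split)
qed

lemma primitive_measurable:
  fixes g :: "real \<Rightarrow> complex"
  assumes "integrable (tim T) g"
  shows "(\<lambda>t. LINT s|tim T. indicat_real {..t} s *\<^sub>R g s) \<in> borel_measurable (tim T)"
proof (rule tim.borel_measurable_lebesgue_integral)
  show "(\<lambda>(t, s). indicat_real {..t} s *\<^sub>R g s) \<in> borel_measurable (tim T \<Otimes>\<^sub>M tim T)"
    using measurable_pair_swap[OF primitive_integrand_measurable[OF assms]] by (simp add: case_prod_beta')
qed

text \<open>
  The test functions \<open>\<eta>\<close> need not vanish at time zero, so the hypothesis encodes the initial value
  \<open>f 0 = 0\<close> as well as \<open>f' = g\<close>. Writing \<open>\<eta>\<close> as minus the integral of its derivative over later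
  times and exchanging the integrals turns the hypothesis into the orthogonality of the bumps to the
  difference of \<open>f\<close> and the primitive of \<open>g\<close>.
\<close>

lemma weak_derivative_AE_primitive:
  fixes f g :: "real \<Rightarrow> complex"
  assumes f: "integrable (tim T) f" and g: "integrable (tim T) g"
    and weak: "\<And>a c n \<eta>. c < T \<Longrightarrow> (\<And>t. (\<eta> has_real_derivative bump a c n t) (at t)) \<Longrightarrow>
      (\<And>t. t \<ge> c \<Longrightarrow> \<eta> t = 0) \<Longrightarrow> (\<And>k. Ck k \<eta>) \<Longrightarrow>
      (LINT t|tim T. bump a c n t *\<^sub>R f t + \<eta> t *\<^sub>R g t) = 0"
  shows "AE t in tim T. f t = (LINT s|tim T. indicat_real {..t} s *\<^sub>R g s)"
proof -
  note [measurable] = f[THEN borel_measurable_integrable] g[THEN borel_measurable_integrable]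
  interpret pair_sigma_finite "tim T" "tim T" ..
  define G where "G t = (LINT s|tim T. indicat_real {..t} s *\<^sub>R g s)" for t
  note kernel_measurable = primitive_integrand_measurable[OF g]
  have gint: "integrable (tim T \<Otimes>\<^sub>M tim T) (\<lambda>(s, t). g s)"
  proof (rule Fubini_integrable)
    show "(\<lambda>(s, t). g s) \<in> borel_measurable (tim T \<Otimes>\<^sub>M tim T)"
      unfolding case_prod_beta' by (rule measurable_compose[OF measurable_fst]) simp
    show "integrable (tim T) (\<lambda>s. LINT t|tim T. norm (case (s, t) of (s, t) \<Rightarrow> g s))"
      using g by simp
    show "AE s in tim T. integrable (tim T) (\<lambda>t. case (s, t) of (s, t) \<Rightarrow> g s)"
      unfolding prod.case by (intro AE_I2 tim.integrable_const)
  qed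
  have [measurable]: "G \<in> borel_measurable (tim T)"
    unfolding G_def by (rule primitive_measurable[OF g])
  have Gbd: "norm (G t) \<le> (LINT s|tim T. norm (g s))" for t
  proof -
    have "integrable (tim T) (\<lambda>s. indicat_real {..t} s *\<^sub>R g s)"
      by (rule integrable_tim_times_bounded[OF g, of _ 1]) (auto simp: indicator_def)
    from integrable_norm[OF this] show ?thesis
      unfolding G_def
      by (rule order_trans[OF integral_norm_bound integral_mono[OF _ integrable_norm[OF g]]])
        (simp add: indicator_def)
  qed
  have Gint: "integrable (tim T) G"
    by (rule tim.integrable_const_bound[where B = "LINT s|tim T. norm (g s)"]) (use Gbd in auto)
  have "AE t in tim T. f t - G t = 0"
  proof (rule AE_zero_if_orthogonal_to_bumps[of T])
    show "integrable (tim T) (\<lambda>t. f t - G t)" using f Gint by simp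
    fix a c :: real and n :: nat assume "0 < a" "c < T"
    obtain \<eta> where \<eta>: "\<And>t. (\<eta> has_real_derivative bump a c n t) (at t)" "\<And>t. t \<ge> c \<Longrightarrow> \<eta> t = 0" "\<And>k. Ck k \<eta>"
      by (rule bump_antiderivative[of a c n]) blast
    have \<eta>eq: "\<eta> s = - (LINT t|tim T. indicat_real {..t} s * bump a c n t)" if "s \<in> {0..T}" for s
    proof -
      have "(LINT t|tim T. indicat_real {..t} s * bump a c n t)
          = (LINT t|tim T. indicat_real {s..T} t *\<^sub>R bump a c n t)"
        by (rule Bochner_Integration.integral_cong) (auto simp: indicator_def)
      also have "\<dots> = (LINT t:{s..T}|lborel. bump a c n t)"
        unfolding tim_def set_lebesgue_integral_def
        by (subst integral_restrict_space) (use that in \<open>auto intro!: Bochner_Integration.integral_cong simp: indicator_def\<close>)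
      also have "\<dots> = (LBINT t. bump a c n t * indicat_real {s..T} t)"
        by (simp add: set_lebesgue_integral_def mult.commute)
      also have "\<dots> = \<eta> T - \<eta> s"
        using that \<eta>(1) Ck_bump[of 0 a c n]
        by (intro integral_FTC_Icc_real) (auto simp: continuous_on_eq_continuous_at)
      also have "\<eta> T = 0" using \<open>c < T\<close> \<eta>(2) by simp
      finally show ?thesis by simp
    qed
    have bg: "integrable (tim T \<Otimes>\<^sub>M tim T) (\<lambda>(s, t). bump a c n t *\<^sub>R indicat_real {..t} s *\<^sub>R g s)"
    proof (rule Bochner_Integration.integrable_bound[OF gint])
      show "(\<lambda>(s, t). bump a c n t *\<^sub>R indicat_real {..t} s *\<^sub>R g s) \<in> borel_measurable (tim T \<Otimes>\<^sub>M tim T)"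
        using borel_measurable_scaleR[OF measurable_compose[OF measurable_snd
            measurable_timI[OF bump_measurable]] kernel_measurable]
        by (simp only: case_prod_beta')
      show "AE z in tim T \<Otimes>\<^sub>M tim T. norm (case z of (s, t) \<Rightarrow> bump a c n t *\<^sub>R indicat_real {..t} s *\<^sub>R g s)
          \<le> norm (case z of (s, t) \<Rightarrow> g s)"
        by (intro AE_I2) (auto simp: indicator_def bump_range abs_of_nonneg intro!: mult_left_le_one_le)
    qed
    have "(LINT s|tim T. \<eta> s *\<^sub>R g s) = (LINT s|tim T. - (LINT t|tim T. bump a c n t *\<^sub>R indicat_real {..t} s *\<^sub>R g s))"
    proof (rule Bochner_Integration.integral_cong[OF refl])
      fix s assume s: "s \<in> space (tim T)"
      have "(LINT t|tim T. bump a c n t *\<^sub>R indicat_real {..t} s *\<^sub>R g s)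
          = (LINT t|tim T. (indicat_real {..t} s * bump a c n t) *\<^sub>R g s)"
        by (simp add: mult.commute)
      also have "\<dots> = (LINT t|tim T. indicat_real {..t} s * bump a c n t) *\<^sub>R g s"
        by (rule integral_scaleR_left, rule tim.integrable_const_bound[where B = 1])
          (auto simp: indicator_def bump_range abs_of_nonneg, measurable)
      finally show "\<eta> s *\<^sub>R g s = - (LINT t|tim T. bump a c n t *\<^sub>R indicat_real {..t} s *\<^sub>R g s)"
        using \<eta>eq[of s] s by simp
    qed
    also have "\<dots> = - (LINT t|tim T. LINT s|tim T. bump a c n t *\<^sub>R indicat_real {..t} s *\<^sub>R g s)"
      using Fubini_integral[OF bg] by simp
    also have "\<dots> = - (LINT t|tim T. bump a c n t *\<^sub>R G t)"
      unfolding G_def by (simp only: Bochner_Integration.integral_scaleR_right)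
    finally have "(LINT s|tim T. \<eta> s *\<^sub>R g s) = - (LINT t|tim T. bump a c n t *\<^sub>R G t)" .
    moreover have ib: "integrable (tim T) (\<lambda>t. bump a c n t *\<^sub>R F t)" if "integrable (tim T) F" for F :: "real \<Rightarrow> complex"
      by (rule integrable_tim_times_bounded[OF that, of _ 1]) (auto simp: bump_range abs_of_nonneg)
    moreover have "integrable (tim T) (\<lambda>t. \<eta> t *\<^sub>R g t)"
    proof -
      have "\<bar>\<eta> t\<bar> \<le> T" if "t \<in> {0..T}" for t
      proof -
        have "\<bar>LINT s|tim T. indicat_real {..s} t * bump a c n s\<bar> \<le> (LINT s|tim T. 1)"
          by (rule order_trans[OF integral_abs_bound integral_mono])
            (auto simp: indicator_def bump_range abs_of_nonneg intro!: tim.integrable_const_bound[where B = 1])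
        also have "\<dots> = T" using that by (simp add: tim_def measure_restrict_space)
        finally show ?thesis using \<eta>eq[OF that] by simp
      qed
      note bd = this
      have m: "\<eta> \<in> borel_measurable (tim T)"
        using \<eta>(3)[of 0] by (intro measurable_timI borel_measurable_continuous_onI) simp
      show ?thesis
      proof (rule Bochner_Integration.integrable_bound[of _ "\<lambda>t. T *\<^sub>R g t"])
        show "integrable (tim T) (\<lambda>t. T *\<^sub>R g t)" using g by simp
        show "(\<lambda>t. \<eta> t *\<^sub>R g t) \<in> borel_measurable (tim T)"
          by (rule borel_measurable_scaleR[OF m]) (use g in simp)
        show "AE t in tim T. norm (\<eta> t *\<^sub>R g t) \<le> norm (T *\<^sub>R g t)"
        proof (rule AE_I2)
          fix t assume "t \<in> space (tim T)"
          with bd[of t] show "norm (\<eta> t *\<^sub>R g t) \<le> norm (T *\<^sub>R g t)"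
            by (auto intro!: mult_right_mono)
        qed
      qed
    qed
    ultimately show "(LINT t|tim T. bump a c n t *\<^sub>R (f t - G t)) = 0"
      using weak[OF \<open>c < T\<close> \<eta>] f Gint ib[OF f] ib[OF Gint]
      by (simp add: scaleR_diff_right)
  qed
  then show ?thesis by (simp add: G_def)
qed

text \<open>
  This is the integrated form of \<open>(|G|\<^sup>2)' = 2 Re (cnj G g)\<close>. Since \<open>g\<close> is merely integrable,
  it is obtained from Fubini's theorem: the square of an integral is a double integral over a square,
  and the two triangles below and above the diagonal contribute complex conjugate values.
\<close>

lemma norm_square_primitive:
  fixes g :: "real \<Rightarrow> complex"
  assumes g: "integrable (tim T) g"
  defines "G \<equiv> \<lambda>t. LINT s|tim T. indicat_real {..t} s *\<^sub>R g s"
  shows "(cmod (G t))\<^sup>2 = 2 * (LINT s|tim T. indicat_real {..t} s * Re (cnj (G s) * g s))"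
proof -
  note [measurable] = g[THEN borel_measurable_integrable]
  interpret pair_sigma_finite "tim T" "tim T" ..
  have fs[measurable]: "(\<lambda>z. fst z) \<in> borel_measurable (tim T \<Otimes>\<^sub>M tim T)"
      "(\<lambda>z. snd z) \<in> borel_measurable (tim T \<Otimes>\<^sub>M tim T)"
      by (rule measurable_compose[OF measurable_fst], rule measurable_timI, simp)
        (rule measurable_compose[OF measurable_snd], rule measurable_timI, simp)
  define h where "h s = indicat_real {..t} s *\<^sub>R g s" for s
  have h: "integrable (tim T) h"
    unfolding h_def by (rule integrable_tim_times_bounded[OF g, of _ 1]) auto
  note [measurable] = h[THEN borel_measurable_integrable]
  have prod: "integrable (tim T \<Otimes>\<^sub>M tim T) (\<lambda>(r, s). cnj (h r) * h s)"
    by (intro Fubini_integrable) (auto simp: case_prod_beta' norm_mult intro!: h integrable_norm)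
  have bd: "integrable (tim T \<Otimes>\<^sub>M tim T) (\<lambda>(r, s). of_bool (P r s) * (cnj (h r) * h s))"
    if "Measurable.pred (tim T \<Otimes>\<^sub>M tim T) (\<lambda>z. P (fst z) (snd z))" for P
    by (rule Bochner_Integration.integrable_bound[OF prod]) (use that in \<open>auto simp: case_prod_beta'\<close>)
  have le: "integrable (tim T \<Otimes>\<^sub>M tim T) (\<lambda>(r, s). of_bool (r \<le> s) * (cnj (h r) * h s))" by (rule bd) measurable
  have gt: "integrable (tim T \<Otimes>\<^sub>M tim T) (\<lambda>(r, s). of_bool (s < r) * (cnj (h r) * h s))" by (rule bd) measurable
  define H where "H t = (LINT s|tim T. indicat_real {..t} s *\<^sub>R h s)" for t
  have cG: "cnj (H s) = (LINT r|tim T. of_bool (r \<le> s) * cnj (h r))" for s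
  proof -
    have "(LINT r|tim T. of_bool (r \<le> s) * cnj (h r)) = (LINT r|tim T. cnj (indicat_real {..s} r *\<^sub>R h r))"
      by (rule Bochner_Integration.integral_cong) (auto simp: indicator_def)
    then show ?thesis unfolding H_def by (simp only: Bochner_Integration.integral_cnj)
  qed
  \<comment> \<open>The closed triangle below the diagonal gives the primitive in the variable s, and the open one above it the primitive in r, up to the diagonal, which is null in each section.\<close>
  have A: "(LINT r|tim T. LINT s|tim T. of_bool (r \<le> s) * (cnj (h r) * h s)) = (LINT s|tim T. cnj (H s) * h s)"
    unfolding Fubini_integral[OF le, symmetric] cG
    by (simp flip: integral_mult_left_zero add: mult.assoc)
  have B: "(LINT r|tim T. LINT s|tim T. of_bool (s < r) * (cnj (h r) * h s)) = (LINT r|tim T. cnj (h r) * H r)"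
  proof (rule Bochner_Integration.integral_cong[OF refl])
    fix r
    have "(LINT s|tim T. of_bool (s < r) * (cnj (h r) * h s)) = (LINT s|tim T. cnj (h r) * (indicat_real {..r} s *\<^sub>R h s))"
    proof (rule integral_cong_AE)
      show "AE s in tim T. of_bool (s < r) * (cnj (h r) * h s) = cnj (h r) * (indicat_real {..r} s *\<^sub>R h s)"
        using AE_tim_neq[of r T] by eventually_elim (auto simp: indicator_def)
    qed measurable
    then show "(LINT s|tim T. of_bool (s < r) * (cnj (h r) * h s)) = cnj (h r) * H r"
      unfolding H_def by (simp only: Bochner_Integration.integral_mult_right_zero)
  qed
  have "(LINT r|tim T. cnj (h r) * H r) = cnj (LINT s|tim T. cnj (H s) * h s)"
    unfolding Bochner_Integration.integral_cnj[symmetric] by (simp add: mult.commute)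
  moreover have "cnj (integral\<^sup>L (tim T) h) * integral\<^sup>L (tim T) h
      = (LINT r|tim T. LINT s|tim T. of_bool (r \<le> s) * (cnj (h r) * h s))
        + (LINT r|tim T. LINT s|tim T. of_bool (s < r) * (cnj (h r) * h s))"
  proof -
    have "cnj (integral\<^sup>L (tim T) h) * integral\<^sup>L (tim T) h = (LINT r|tim T. LINT s|tim T. cnj (h r) * h s)"
      by (simp flip: Bochner_Integration.integral_cnj)
    also have "\<dots> = integral\<^sup>L (tim T \<Otimes>\<^sub>M tim T) (\<lambda>(r, s). cnj (h r) * h s)"
      using integral_fst'[OF prod] by simp
    also have "\<dots> = integral\<^sup>L (tim T \<Otimes>\<^sub>M tim T)
       (\<lambda>z. (\<lambda>(r, s). of_bool (r \<le> s) * (cnj (h r) * h s)) z + (\<lambda>(r, s). of_bool (s < r) * (cnj (h r) * h s)) z)"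
      by (rule Bochner_Integration.integral_cong) (auto simp: not_le)
    also have "\<dots> = integral\<^sup>L (tim T \<Otimes>\<^sub>M tim T) (\<lambda>(r, s). of_bool (r \<le> s) * (cnj (h r) * h s))
       + integral\<^sup>L (tim T \<Otimes>\<^sub>M tim T) (\<lambda>(r, s). of_bool (s < r) * (cnj (h r) * h s))"
      by (rule Bochner_Integration.integral_add[OF le gt])
    finally show ?thesis using integral_fst'[OF le] integral_fst'[OF gt] by simp
  qed
  ultimately have sq: "cnj (integral\<^sup>L (tim T) h) * integral\<^sup>L (tim T) h
      = (LINT s|tim T. cnj (H s) * h s) + cnj (LINT s|tim T. cnj (H s) * h s)"
    using A B by simp
  have "(cmod (integral\<^sup>L (tim T) h))\<^sup>2 = Re (cnj (integral\<^sup>L (tim T) h) * integral\<^sup>L (tim T) h)"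
    by (subst cmod_power2) (simp add: power2_eq_square)
  also have "\<dots> = 2 * Re (LINT s|tim T. cnj (H s) * h s)"
    unfolding sq by simp
  also have "(LINT s|tim T. cnj (H s) * h s) = (LINT s|tim T. indicat_real {..t} s *\<^sub>R (cnj (G s) * g s))"
  proof (rule Bochner_Integration.integral_cong[OF refl])
    fix s
    have "H s = G s" if "s \<le> t"
      unfolding H_def G_def h_def
      by (rule Bochner_Integration.integral_cong) (use that in \<open>auto simp: indicator_def\<close>)
    then show "cnj (H s) * h s = indicat_real {..t} s *\<^sub>R (cnj (G s) * g s)"
      by (auto simp: h_def indicator_def)
  qed
  also have "Re \<dots> = (LINT s|tim T. indicat_real {..t} s * Re (cnj (G s) * g s))"
  proof (subst integral_Re[symmetric])
    have "integrable (tim T) (\<lambda>s. cnj (H s) * h s)"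
      using integrable_fst'[OF gt] integrable_snd[OF le] unfolding cG
      by (simp flip: integral_mult_left_zero add: mult.assoc)
    then show "integrable (tim T) (\<lambda>s. indicat_real {..t} s *\<^sub>R (cnj (G s) * g s))"
    proof (rule Bochner_Integration.integrable_cong[OF refl, THEN iffD1, rotated])
      fix s
      have "H s = G s" if "s \<le> t"
        unfolding H_def G_def h_def
        by (rule Bochner_Integration.integral_cong) (use that in \<open>auto simp: indicator_def\<close>)
      then show "cnj (H s) * h s = indicat_real {..t} s *\<^sub>R (cnj (G s) * g s)"
        by (auto simp: h_def indicator_def)
    qed
  qed simp
  finally show ?thesis by (simp add: G_def h_def)
qed

section \<open>Integration over the torus and its characters\<close>

definition lattice_point :: "int ^ 'n \<Rightarrow> real ^ 'n" where
  "lattice_point k = (\<chi> i. of_int (k $ i))"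

definition lattice_periodic :: "(real ^ 'n \<Rightarrow> 'b) \<Rightarrow> bool" where
  "lattice_periodic f \<longleftrightarrow> (\<forall>x k. f (x + lattice_point k) = f x)"

lemma lattice_periodicD: "lattice_periodic f \<Longrightarrow> f (x + lattice_point k) = f x"
  by (simp add: lattice_periodic_def)

lemma lattice_point_minus: "lattice_point (- k) = - lattice_point k"
  by (simp add: lattice_point_def vec_eq_iff)

lemma lattice_periodic_minusD: "lattice_periodic f \<Longrightarrow> f (x - lattice_point k) = f x"
  using lattice_periodicD[of f x "- k"] by (simp add: lattice_point_minus)

lemma lattice_periodic_shift:
  "lattice_periodic f \<Longrightarrow> lattice_periodic (\<lambda>x. f (x + a))" "lattice_periodic f \<Longrightarrow> lattice_periodic (\<lambda>x. f (a - x))"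
  unfolding lattice_periodic_def
  by (metis add.assoc add.commute)
    (metis (no_types, opaque_lifting) add_diff_cancel_right' diff_add_cancel diff_diff_eq)

definition fundamental_domain :: "(real ^ 'n) set \<Rightarrow> bool" where
  "fundamental_domain D \<longleftrightarrow> D \<in> sets borel \<and> (\<forall>x. \<exists>!k. x + lattice_point k \<in> D)"

definition halfopen_cube :: "real ^ 'n \<Rightarrow> (real ^ 'n) set" where
  "halfopen_cube c = {x. \<forall>i. c $ i \<le> x $ i \<and> x $ i < c $ i + 1}"

lemma halfopen_cube_measurable [measurable]: "halfopen_cube (c :: real ^ 'n) \<in> sets borel"
proof -
  have "Measurable.pred borel (\<lambda>x::real^'n. \<forall>i\<in>UNIV. c $ i \<le> x $ i \<and> x $ i < c $ i + 1)"
    by measurable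
  then show ?thesis by (simp add: halfopen_cube_def pred_def)
qed

lemma fundamental_domain_halfopen_cube: "fundamental_domain (halfopen_cube (c :: real ^ 'n))"
  unfolding fundamental_domain_def
proof (intro conjI allI)
  fix x :: "real ^ 'n"
  have *: "x + lattice_point k \<in> halfopen_cube c \<longleftrightarrow> (\<forall>i. k $ i = \<lceil>c $ i - x $ i\<rceil>)" for k
  proof -
    have "(c $ i \<le> x $ i + of_int (k $ i) \<and> x $ i + of_int (k $ i) < c $ i + 1) \<longleftrightarrow> k $ i = \<lceil>c $ i - x $ i\<rceil>" for i
      by (subst eq_commute, subst ceiling_eq_iff) auto
    then show ?thesis by (simp add: halfopen_cube_def lattice_point_def)
  qed
  show "\<exists>!k. x + lattice_point k \<in> halfopen_cube c"
    unfolding * by (rule ex1I[of _ "\<chi> i. \<lceil>c $ i - x $ i\<rceil>"]) (auto simp: vec_eq_iff)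
qed simp

lemma nn_integral_count_space_fundamental:
  fixes D :: "(real ^ 'n) set"
  assumes "fundamental_domain D"
  shows "(\<integral>\<^sup>+ k. indicator D (x + lattice_point k) \<partial>count_space UNIV) = 1"
proof -
  obtain k0 where k0: "\<And>k. x + lattice_point k \<in> D \<longleftrightarrow> k = k0"
    using assms unfolding fundamental_domain_def by metis
  have "(\<integral>\<^sup>+ k. indicator D (x + lattice_point k) \<partial>count_space UNIV)
      = (\<integral>\<^sup>+ k. indicator {k0} k \<partial>count_space (UNIV :: (int ^ 'n) set))"
    by (rule nn_integral_cong) (simp add: indicator_def k0)
  then show ?thesis by simp
qed

lemma nn_integral_lborel_shift:
  fixes f :: "'a::euclidean_space \<Rightarrow> ennreal"
  assumes [measurable]: "f \<in> borel_measurable borel"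
  shows "(\<integral>\<^sup>+ x. f (x + a) \<partial>lborel) = (\<integral>\<^sup>+ x. f x \<partial>lborel)"
proof -
  have "(\<integral>\<^sup>+ x. f x \<partial>lborel) = (\<integral>\<^sup>+ x. f x \<partial>distr lborel borel ((+) a))"
    by (simp add: lborel_distr_plus)
  also have "\<dots> = (\<integral>\<^sup>+ x. f (a + x) \<partial>lborel)" by (rule nn_integral_distr) auto
  finally show ?thesis by (simp add: add.commute)
qed

lemma nn_integral_lborel_reflect:
  fixes f :: "'a::euclidean_space \<Rightarrow> ennreal"
  assumes [measurable]: "f \<in> borel_measurable borel"
  shows "(\<integral>\<^sup>+ x. f (a - x) \<partial>lborel) = (\<integral>\<^sup>+ x. f x \<partial>lborel)"
proof -
  have "(\<integral>\<^sup>+ x. f x \<partial>lborel) = (\<integral>\<^sup>+ x. f x \<partial>density (distr lborel borel (\<lambda>x. a + (-1) *\<^sub>R x)) (\<lambda>_. 1))"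
    by (subst lborel_affine[of "-1" a]) (simp_all add: one_ennreal_def)
  also have "\<dots> = (\<integral>\<^sup>+ x. f (a - x) \<partial>lborel)"
    by (subst nn_integral_density) (auto simp: nn_integral_distr)
  finally show ?thesis by simp
qed

text \<open>
  Insert the sum over all lattice translates of the indicator function of \<open>E\<close>, which is one
  everywhere, and translate each summand: this moves the lattice vector from \<open>E\<close> to \<open>D\<close>, whose
  translates sum to one again.
\<close>

lemma nn_integral_fundamental_domains_eq:
  fixes g :: "real ^ 'n \<Rightarrow> ennreal"
  assumes [measurable]: "g \<in> borel_measurable borel" and g: "lattice_periodic g"
    and D: "fundamental_domain D" and E: "fundamental_domain E"
  shows "(\<integral>\<^sup>+ x. indicator D x * g x \<partial>lborel) = (\<integral>\<^sup>+ x. indicator E x * g x \<partial>lborel)"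
proof -
  have [measurable]: "D \<in> sets borel" "E \<in> sets borel"
    using D E by (auto simp: fundamental_domain_def)
  let ?C = "count_space (UNIV :: (int ^ 'n) set)"
  have ps: "pair_sigma_finite ?C (lborel :: (real ^ 'n) measure)"
    by (intro pair_sigma_finite.intro sigma_finite_lborel sigma_finite_measure_count_space)
  have m: "(\<lambda>(k, x). indicator D x * indicator E (x + lattice_point k) * g x) \<in> borel_measurable (?C \<Otimes>\<^sub>M lborel)"
    "(\<lambda>(k, x). indicator D (x + lattice_point k) * indicator E x * g x) \<in> borel_measurable (?C \<Otimes>\<^sub>M lborel)"
    by (rule measurable_pair_measure_countable1, auto)+
  have "(\<integral>\<^sup>+ x. indicator D x * g x \<partial>lborel)
      = (\<integral>\<^sup>+ x. \<integral>\<^sup>+ k. indicator D x * indicator E (x + lattice_point k) * g x \<partial>?C \<partial>lborel)"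
    by (rule nn_integral_cong) (simp add: nn_integral_cmult nn_integral_multc nn_integral_count_space_fundamental[OF E])
  also have "\<dots> = (\<integral>\<^sup>+ k. \<integral>\<^sup>+ x. indicator D x * indicator E (x + lattice_point k) * g x \<partial>lborel \<partial>?C)"
    using pair_sigma_finite.Fubini'[OF ps m(1)] by simp
  also have "\<dots> = (\<integral>\<^sup>+ k. \<integral>\<^sup>+ x. indicator D (x + lattice_point (- k)) * indicator E x * g x \<partial>lborel \<partial>?C)"
  proof (rule nn_integral_cong)
    fix k :: "int ^ 'n"
    show "(\<integral>\<^sup>+ x. indicator D x * indicator E (x + lattice_point k) * g x \<partial>lborel)
        = (\<integral>\<^sup>+ x. indicator D (x + lattice_point (- k)) * indicator E x * g x \<partial>lborel)"
      using nn_integral_lborel_shift[of "\<lambda>x. indicator D (x + lattice_point (- k)) * indicator E x * g x" "lattice_point k"]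
      by (simp add: lattice_point_minus lattice_periodicD[OF g])
  qed
  also have "\<dots> = (\<integral>\<^sup>+ k. \<integral>\<^sup>+ x. indicator D (x + lattice_point k) * indicator E x * g x \<partial>lborel \<partial>?C)"
    by (rule nn_integral_bij_count_space[of uminus UNIV UNIV]) (simp add: bij_uminus)
  also have "\<dots> = (\<integral>\<^sup>+ x. \<integral>\<^sup>+ k. indicator D (x + lattice_point k) * indicator E x * g x \<partial>?C \<partial>lborel)"
    using pair_sigma_finite.Fubini'[OF ps m(2)] by simp
  also have "\<dots> = (\<integral>\<^sup>+ x. indicator E x * g x \<partial>lborel)"
    by (rule nn_integral_cong) (simp add: nn_integral_multc mult.assoc nn_integral_count_space_fundamental[OF D])
  finally show ?thesis .
qed

text \<open>
  The half-open cube meets each lattice orbit exactly once, which the closed cube does not. The measure is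
  the Borel one, for the same reason as in time.
\<close>

definition tor :: "(real ^ 'n) measure" where
  "tor = restrict_space lborel (halfopen_cube 0)"

lemma space_tor [simp]: "space tor = halfopen_cube 0"
  by (simp add: tor_def space_restrict_space)

lemma measurable_torI [measurable (raw)]: "f \<in> measurable borel N \<Longrightarrow> f \<in> measurable tor N"
  unfolding tor_def by (rule measurable_restrict_space1) simp

lemma nn_integral_tor: "(\<integral>\<^sup>+ x. g x \<partial>tor) = (\<integral>\<^sup>+ x. indicator (halfopen_cube 0) x * g x \<partial>lborel)"
  unfolding tor_def by (subst nn_integral_restrict_space) (auto simp: mult.commute)

lemma nn_integral_tor_fundamental:
  fixes g :: "real ^ 'n \<Rightarrow> ennreal"
  assumes "g \<in> borel_measurable borel" "lattice_periodic g" "fundamental_domain D"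
  shows "(\<integral>\<^sup>+ x. g x \<partial>tor) = (\<integral>\<^sup>+ x. indicator D x * g x \<partial>lborel)"
  unfolding nn_integral_tor
  by (rule nn_integral_fundamental_domains_eq[OF assms(1,2) fundamental_domain_halfopen_cube assms(3)])

lemma nn_integral_tor_shift:
  fixes g :: "real ^ 'n \<Rightarrow> ennreal"
  assumes [measurable]: "g \<in> borel_measurable borel" and g: "lattice_periodic g"
  shows "(\<integral>\<^sup>+ x. g (x + a) \<partial>tor) = (\<integral>\<^sup>+ x. g x \<partial>tor)"
proof -
  have "(\<integral>\<^sup>+ x. g (x + a) \<partial>tor) = (\<integral>\<^sup>+ x. indicator (halfopen_cube a) (x + a) * g (x + a) \<partial>lborel)"
    unfolding nn_integral_tor by (rule nn_integral_cong) (auto simp: indicator_def halfopen_cube_def)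
  also have "\<dots> = (\<integral>\<^sup>+ x. indicator (halfopen_cube a) x * g x \<partial>lborel)"
    by (rule nn_integral_lborel_shift) measurable
  finally show ?thesis
    using nn_integral_tor_fundamental[OF assms fundamental_domain_halfopen_cube] by simp
qed

text \<open>
  The result lives on a cube with an arbitrary corner \<open>c\<close>: later it is centred at the origin, where
  the kernels concentrate.
\<close>

lemma nn_integral_tor_reflect:
  fixes g :: "real ^ 'n \<Rightarrow> ennreal"
  assumes [measurable]: "g \<in> borel_measurable borel" and g: "lattice_periodic g"
  shows "(\<integral>\<^sup>+ y. g y \<partial>tor) = (\<integral>\<^sup>+ z. indicator (halfopen_cube c) z * g (x - z) \<partial>lborel)"
proof -
  let ?E = "{z. x - z \<in> halfopen_cube 0}"
  have "?E \<in> sets borel" by measurable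
  moreover have "\<exists>!k. z + lattice_point k \<in> ?E" for z
  proof -
    obtain k where k: "x - z + lattice_point k \<in> halfopen_cube 0"
      "\<And>l. x - z + lattice_point l \<in> halfopen_cube 0 \<Longrightarrow> l = k"
      using fundamental_domain_halfopen_cube[of 0] unfolding fundamental_domain_def by metis
    have *: "z + lattice_point l \<in> ?E \<longleftrightarrow> x - z + lattice_point (- l) \<in> halfopen_cube 0" for l
      by (simp add: lattice_point_minus algebra_simps)
    show ?thesis
    proof (rule ex1I[of _ "- k"])
      show "z + lattice_point (- k) \<in> ?E" unfolding * using k(1) by simp
      show "l = - k" if "z + lattice_point l \<in> ?E" for l
        using k(2)[of "- l"] that unfolding * by (simp add: minus_equation_iff eq_commute)
    qed
  qed
  ultimately have E: "fundamental_domain ?E" by (simp add: fundamental_domain_def)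
  have "(\<integral>\<^sup>+ y. g y \<partial>tor) = (\<integral>\<^sup>+ z. indicator (halfopen_cube 0) (x - z) * g (x - z) \<partial>lborel)"
    unfolding nn_integral_tor by (rule nn_integral_lborel_reflect[symmetric]) measurable
  also have "\<dots> = (\<integral>\<^sup>+ z. indicator ?E z * g (x - z) \<partial>lborel)"
    by (rule nn_integral_cong) (auto simp: indicator_def)
  also have "\<dots> = (\<integral>\<^sup>+ z. indicator (halfopen_cube c) z * g (x - z) \<partial>lborel)"
    by (rule nn_integral_fundamental_domains_eq[OF _ lattice_periodic_shift(2)[OF g] E fundamental_domain_halfopen_cube]) measurable
  finally show ?thesis .
qed

lemma AE_unit_cube_open: "AE x in lborel. x \<in> cbox 0 1 \<longrightarrow> x \<in> box 0 (1 :: real ^ 'n)"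
proof -
  have "emeasure lborel (cbox 0 1 - box 0 (1 :: real ^ 'n)) = 0"
    by (subst emeasure_Diff) (auto simp: emeasure_lborel_box_eq emeasure_lborel_cbox_eq box_subset_cbox)
  then have "cbox 0 1 - box 0 (1 :: real ^ 'n) \<in> null_sets lborel" by auto
  from AE_not_in[OF this] show ?thesis by eventually_elim auto
qed

lemma halfopen_cube_bounds: "box 0 1 \<subseteq> halfopen_cube 0" "halfopen_cube 0 \<subseteq> cbox 0 (1 :: real ^ 'n)"
  by (auto simp: halfopen_cube_def mem_box_cart less_imp_le)

lemma prob_space_tor: "prob_space (tor :: (real ^ 'n) measure)"
proof
  have one: "(1 :: real ^ 'n) \<bullet> b = 1" if "b \<in> Basis" for b
    using that by (auto simp: Basis_vec_def inner_axis)
  have "emeasure lborel (box 0 (1::real^'n)) = 1" "emeasure lborel (cbox 0 (1::real^'n)) = 1"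
    using one by (simp_all add: emeasure_lborel_box_eq emeasure_lborel_cbox_eq cong: prod.cong)
  moreover have "emeasure lborel (box 0 (1::real^'n)) \<le> emeasure lborel (halfopen_cube (0::real^'n))"
    "emeasure lborel (halfopen_cube (0::real^'n)) \<le> emeasure lborel (cbox 0 (1::real^'n))"
    by (intro emeasure_mono halfopen_cube_bounds; simp)+
  ultimately show "emeasure (tor :: (real ^ 'n) measure) (space tor) = 1"
    by (simp add: tor_def emeasure_restrict_space space_restrict_space)
qed

interpretation tor: prob_space "tor :: (real ^ 'n) measure" by (rule prob_space_tor)

lemma measure_tor [simp]: "measure (tor :: (real ^ 'n) measure) (halfopen_cube 0) = 1"
  using tor.prob_space by simp

lemma AE_tor_iff: "(AE x in tor. P x) \<longleftrightarrow> (AE x in lborel. x \<in> halfopen_cube 0 \<longrightarrow> P x)"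
  unfolding tor_def by (subst AE_restrict_space_iff) auto

text \<open>
  The characters of the torus.
\<close>

definition wave :: "int ^ 'n \<Rightarrow> real ^ 'n \<Rightarrow> complex" where
  "wave k x = cis (wavevec k \<bullet> x)"

lemma wave_add_freq: "wave (k + l) x = wave k x * wave l x"
  by (simp add: wave_def wavevec_add inner_add_left cis_mult)

lemma cnj_wave: "cnj (wave k x) = wave (- k) x"
  by (simp add: wave_def wavevec_minus cis_cnj)

lemma wave_0 [simp]: "wave 0 x = 1"
  by (simp add: wave_def)

lemma norm_wave [simp]: "cmod (wave k x) = 1"
  by (simp add: wave_def)

lemma wave_diff: "wave k (x - y) = wave k x * cnj (wave k y)"
  by (simp add: wave_def inner_diff_right cis_cnj cis_mult)

lemma wave_measurable [measurable]: "wave k \<in> borel_measurable borel"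
  unfolding wave_def by (intro borel_measurable_continuous_onI continuous_intros)

lemma wavevec_lattice_point: "wavevec k \<bullet> lattice_point l = 2 * pi * of_int (\<Sum>i\<in>UNIV. k $ i * l $ i)"
  by (simp add: wavevec_def lattice_point_def inner_vec_def sum_distrib_left mult.assoc)

lemma lattice_periodic_cos: "lattice_periodic (\<lambda>x. cos (wavevec k \<bullet> x + \<alpha>))"
proof -
  have "wavevec k \<bullet> (x + lattice_point l) + \<alpha> = (wavevec k \<bullet> x + \<alpha>) + wavevec k \<bullet> lattice_point l" for x l
    by (simp add: inner_add_right)
  then show ?thesis
    by (simp only: lattice_periodic_def wavevec_lattice_point cos_add[of _ "2 * pi * real_of_int _"]
        cos_int_2pin sin_int_2pin mult_1_right mult_zero_right diff_zero)
       simp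
qed

lemma integral_tor_cos_wave:
  fixes k :: "int ^ 'n"
  assumes "k \<noteq> 0"
  shows "(LINT x|tor. cos (wavevec k \<bullet> x + \<alpha>)) = 0"
proof -
  obtain i where i: "k $ i \<noteq> 0" using assms by (auto simp: vec_eq_iff)
  \<comment> \<open>Translation by h shifts the phase by half a period and therefore changes the sign of the cosine.\<close>
  define h :: "real ^ 'n" where "h = axis i (1 / (2 * of_int (k $ i)))"
  have h: "wavevec k \<bullet> h = pi" using i by (simp add: h_def inner_axis wavevec_def)
  let ?c = "\<lambda>x. cos (wavevec k \<bullet> x + \<alpha>)"
  have [measurable]: "?c \<in> borel_measurable borel"
    by (intro borel_measurable_continuous_onI continuous_intros)
  have int: "integrable tor ?c" by (rule tor.integrable_const_bound[of _ 1]) auto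
  have shift: "?c (x + h) = - ?c x" for x
    using cos_periodic_pi[of "wavevec k \<bullet> x + \<alpha>"] by (simp add: inner_add_right h ac_simps)
  have per: "lattice_periodic (\<lambda>x. ennreal (1 + ?c x))"
    using lattice_periodic_cos[of k \<alpha>] by (simp add: lattice_periodic_def)
  have "(\<integral>\<^sup>+ x. ennreal (1 + ?c (x + h)) \<partial>tor) = (\<integral>\<^sup>+ x. ennreal (1 + ?c x) \<partial>tor)"
    by (rule nn_integral_tor_shift[OF _ per]) measurable
  then have "(\<integral>\<^sup>+ x. ennreal (1 - ?c x) \<partial>tor) = (\<integral>\<^sup>+ x. ennreal (1 + ?c x) \<partial>tor)"
    unfolding shift by simp
  then have "ennreal (LINT x|tor. 1 - ?c x) = ennreal (LINT x|tor. 1 + ?c x)"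
    using int cos_ge_minus_one[of "wavevec k \<bullet> _ + \<alpha>"]
    by (subst (asm) (1 2) nn_integral_eq_integral) (auto simp: add.commute[of 1] simp flip: diff_minus_eq_add)
  moreover have "(LINT x|tor. 1 - ?c x) = 1 - (LINT x|tor. ?c x)" "(LINT x|tor. 1 + ?c x) = 1 + (LINT x|tor. ?c x)"
    using int by simp_all
  moreover have "\<bar>LINT x|tor. ?c x\<bar> \<le> 1"
    by (rule order_trans[OF integral_abs_bound tor.integral_le_const]) (use int in auto)
  ultimately show ?thesis by (auto simp: ennreal_inj abs_le_iff)
qed

lemma integrable_wave: "integrable tor (\<lambda>x. wave k x)"
  by (rule tor.integrable_const_bound[of _ 1]) auto

lemma integral_wave: "(LINT x|tor. wave k x) = of_bool (k = 0)"
proof (cases "k = 0")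
  case False
  have "Re (LINT x|tor. wave k x) = (LINT x|tor. cos (wavevec k \<bullet> x + 0))"
    by (subst integral_Re[OF integrable_wave, symmetric]) (simp add: wave_def)
  moreover have "Im (LINT x|tor. wave k x) = (LINT x|tor. cos (wavevec k \<bullet> x + (- pi / 2)))"
    by (subst integral_Im[OF integrable_wave, symmetric]) (simp add: wave_def cos_diff)
  ultimately show ?thesis
    using False by (simp only: integral_tor_cos_wave[OF False] complex_eq_iff) simp
qed simp

lemma integral_norm_square_trig_poly:
  assumes "finite A"
  shows "(LINT x|tor. (cmod (\<Sum>k\<in>A. c k * wave k x))\<^sup>2) = (\<Sum>k\<in>A. (cmod (c k))\<^sup>2)"
proof -
  have "complex_of_real (LINT x|tor. (cmod (\<Sum>k\<in>A. c k * wave k x))\<^sup>2)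
      = (LINT x|tor. (\<Sum>k\<in>A. \<Sum>l\<in>A. c k * cnj (c l) * wave (k - l) x))"
    unfolding integral_complex_of_real[symmetric]
  proof (rule Bochner_Integration.integral_cong[OF refl])
    fix x
    have "complex_of_real ((cmod (\<Sum>k\<in>A. c k * wave k x))\<^sup>2) = (\<Sum>k\<in>A. c k * wave k x) * cnj (\<Sum>k\<in>A. c k * wave k x)"
      by (rule complex_norm_square)
    also have "\<dots> = (\<Sum>k\<in>A. \<Sum>l\<in>A. c k * cnj (c l) * wave (k - l) x)"
      by (simp add: sum_product cnj_wave wave_add_freq mult.assoc mult.left_commute flip: add_uminus_conv_diff)
    finally show "complex_of_real ((cmod (\<Sum>k\<in>A. c k * wave k x))\<^sup>2) = (\<Sum>k\<in>A. \<Sum>l\<in>A. c k * cnj (c l) * wave (k - l) x)" .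
  qed
  also have "\<dots> = (\<Sum>k\<in>A. \<Sum>l\<in>A. c k * cnj (c l) * of_bool (k = l))"
    by (subst Bochner_Integration.integral_sum, simp add: integrable_wave)+
      (simp add: integral_wave integrable_wave)
  also have "\<dots> = (\<Sum>k\<in>A. complex_of_real ((cmod (c k))\<^sup>2))"
    using assms by (simp add: of_bool_def if_distrib sum.delta' complex_norm_square del: of_real_power cong: if_cong)
  finally show ?thesis by (simp flip: of_real_sum del: of_real_power)
qed

section \<open>An approximate identity of positive trigonometric polynomials\<close>

lemma emeasure_tor [simp]: "emeasure (tor :: (real ^ 'n) measure) (halfopen_cube 0) = 1"
  using tor.emeasure_space_1 by simp

text \<open>
  The trigonometric polynomials with nonnegative coefficients form a convex cone that is closed under
  multiplication, which gives the signs of all coefficients of a power without computing them.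
\<close>

definition positive_trig_poly :: "(real ^ 'n \<Rightarrow> complex) \<Rightarrow> bool" where
  "positive_trig_poly f \<longleftrightarrow> (\<exists>A c. finite A \<and> (\<forall>k. 0 \<le> c k) \<and>
     f = (\<lambda>x. \<Sum>k\<in>A. complex_of_real (c k) * wave k x))"

lemma positive_trig_polyI:
  "finite A \<Longrightarrow> (\<And>k. 0 \<le> c k) \<Longrightarrow> (\<And>x. f x = (\<Sum>k\<in>A. complex_of_real (c k) * wave k x)) \<Longrightarrow> positive_trig_poly f"
  unfolding positive_trig_poly_def by blast

lemma positive_trig_polyE:
  assumes "positive_trig_poly f"
  obtains A c where "finite A" "\<And>k. 0 \<le> c k" "f = (\<lambda>x. \<Sum>k\<in>A. complex_of_real (c k) * wave k x)"
  using assms unfolding positive_trig_poly_def by (elim exE conjE) (rule that; simp)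

lemma positive_trig_poly_wave: "0 \<le> r \<Longrightarrow> positive_trig_poly (\<lambda>x. complex_of_real r * wave k x)"
  by (rule positive_trig_polyI[of "{k}" "\<lambda>_. r"]) auto

lemma positive_trig_poly_const: "0 \<le> r \<Longrightarrow> positive_trig_poly (\<lambda>x. complex_of_real r)"
  using positive_trig_poly_wave[of r 0] by simp

lemma positive_trig_poly_add:
  assumes "positive_trig_poly f" "positive_trig_poly g"
  shows "positive_trig_poly (\<lambda>x. f x + g x)"
proof -
  obtain A c where A: "finite A" "\<And>k. 0 \<le> c k" "f = (\<lambda>x. \<Sum>k\<in>A. complex_of_real (c k) * wave k x)"
    by (rule positive_trig_polyE[OF assms(1)]) (rule that; assumption)
  obtain B d where B: "finite B" "\<And>k. 0 \<le> d k" "g = (\<lambda>x. \<Sum>k\<in>B. complex_of_real (d k) * wave k x)"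
    by (rule positive_trig_polyE[OF assms(2)]) (rule that; assumption)
  define e where "e k = of_bool (k \<in> A) * c k + of_bool (k \<in> B) * d k" for k
  show ?thesis
  proof (rule positive_trig_polyI[of "A \<union> B" e])
    fix x
    have "f x = (\<Sum>k\<in>A \<union> B. complex_of_real (of_bool (k \<in> A) * c k) * wave k x)"
      unfolding A(3) by (rule sum.mono_neutral_cong_left) (use A B in auto)
    moreover have "g x = (\<Sum>k\<in>A \<union> B. complex_of_real (of_bool (k \<in> B) * d k) * wave k x)"
      unfolding B(3) by (rule sum.mono_neutral_cong_left) (use A B in auto)
    ultimately show "f x + g x = (\<Sum>k\<in>A \<union> B. complex_of_real (e k) * wave k x)"
      by (simp add: e_def algebra_simps sum.distrib)
  qed (use A B in \<open>auto simp: e_def\<close>)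
qed

lemma positive_trig_poly_sum:
  "(\<And>i. i \<in> I \<Longrightarrow> positive_trig_poly (f i)) \<Longrightarrow> positive_trig_poly (\<lambda>x. \<Sum>i\<in>I. f i x)"
  using positive_trig_poly_const[of 0]
  by (induction I rule: infinite_finite_induct) (auto intro: positive_trig_poly_add)

lemma positive_trig_poly_wave_mult:
  assumes "0 \<le> r" "positive_trig_poly f"
  shows "positive_trig_poly (\<lambda>x. complex_of_real r * wave k x * f x)"
proof -
  obtain A c where A: "finite A" "\<And>k. 0 \<le> c k" "f = (\<lambda>x. \<Sum>k\<in>A. complex_of_real (c k) * wave k x)"
    by (rule positive_trig_polyE[OF assms(2)]) (rule that; assumption)
  have "positive_trig_poly (\<lambda>x. \<Sum>l\<in>A. complex_of_real (r * c l) * wave (k + l) x)"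
    by (intro positive_trig_poly_sum positive_trig_poly_wave) (use A assms in auto)
  then show ?thesis
    unfolding A(3) by (simp add: sum_distrib_left wave_add_freq mult.assoc mult.left_commute)
qed

lemma positive_trig_poly_mult:
  assumes "positive_trig_poly f" "positive_trig_poly g"
  shows "positive_trig_poly (\<lambda>x. f x * g x)"
proof -
  obtain A c where A: "finite A" "\<And>k. 0 \<le> c k" "f = (\<lambda>x. \<Sum>k\<in>A. complex_of_real (c k) * wave k x)"
    by (rule positive_trig_polyE[OF assms(1)]) (rule that; assumption)
  show ?thesis
    unfolding A(3) sum_distrib_right
    by (intro positive_trig_poly_sum positive_trig_poly_wave_mult assms(2) A(2))
qed

lemma positive_trig_poly_power:
  "positive_trig_poly f \<Longrightarrow> positive_trig_poly (\<lambda>x. f x ^ m)"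
  using positive_trig_poly_const[of 1]
  by (induction m) (auto intro: positive_trig_poly_mult)

text \<open>
  A trigonometric polynomial with values between 0 and 1 that attains 1 on the lattice only. Its
  normalised powers concentrate at the lattice and have nonnegative Fourier coefficients.
\<close>

definition peak :: "real ^ 'n \<Rightarrow> real" where
  "peak x = 1 / 2 + (\<Sum>i\<in>UNIV. cos (2 * pi * x $ i)) / (2 * CARD('n))"

lemma positive_trig_poly_peak: "positive_trig_poly (\<lambda>x :: real ^ 'n. complex_of_real (peak x))"
proof -
  have "complex_of_real (peak x) = complex_of_real (1 / 2) + (\<Sum>i\<in>UNIV.
      complex_of_real (1 / (4 * CARD('n))) * wave (axis i 1) x + complex_of_real (1 / (4 * CARD('n))) * wave (- axis i 1) x)"
    for x :: "real ^ 'n"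
  proof -
    have "wavevec (axis i 1) \<bullet> x = 2 * pi * x $ i" for i
    proof -
      have "wavevec (axis i 1) = axis i (2 * pi)"
        by (auto simp: wavevec_def axis_def vec_eq_iff)
      then show ?thesis by (simp add: inner_axis')
    qed
    then have "wave (axis i 1) x + wave (- axis i 1) x = complex_of_real (2 * cos (2 * pi * x $ i))" for i
      unfolding cnj_wave[symmetric] by (subst complex_add_cnj) (simp add: wave_def)
    then have "complex_of_real (1 / (4 * CARD('n))) * wave (axis i 1) x + complex_of_real (1 / (4 * CARD('n))) * wave (- axis i 1) x
        = complex_of_real (cos (2 * pi * x $ i) / (2 * CARD('n)))" for i
      unfolding distrib_left[symmetric] by (simp only: flip: of_real_mult) simp
    then show ?thesis
      by (simp only: peak_def sum_divide_distrib of_real_add of_real_sum)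
  qed
  then show ?thesis
    by (simp only:) (intro positive_trig_poly_add positive_trig_poly_const positive_trig_poly_sum positive_trig_poly_wave; simp)
qed

lemma peak_range: "0 \<le> peak x" "peak x \<le> 1"
proof -
  have "(\<Sum>i\<in>UNIV. cos (2 * pi * x $ i)) \<le> (\<Sum>i\<in>(UNIV :: 'a set). 1)"
    "(\<Sum>i\<in>(UNIV :: 'a set). - 1) \<le> (\<Sum>i\<in>UNIV. cos (2 * pi * x $ i))"
    by (intro sum_mono; simp)+
  then show "0 \<le> peak x" "peak x \<le> 1" by (simp_all add: peak_def field_simps)
qed

lemma continuous_peak: "continuous_on S peak"
  unfolding peak_def by (intro continuous_intros) auto

lemma peak_measurable [measurable]: "peak \<in> borel_measurable borel"
  by (rule borel_measurable_continuous_onI[OF continuous_peak])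

lemma peak_0 [simp]: "peak 0 = 1"
  by (simp add: peak_def)

lemma peak_less_1:
  assumes "\<And>i. \<bar>x $ i\<bar> \<le> 1 / 2" "x \<noteq> 0"
  shows "peak x < 1"
proof -
  obtain j where j: "x $ j \<noteq> 0" using assms(2) by (auto simp: vec_eq_iff)
  have "cos (2 * pi * x $ j) \<noteq> 1"
  proof
    assume "cos (2 * pi * x $ j) = 1"
    then obtain m :: int where "2 * pi * x $ j = m * 2 * pi" by (auto simp: cos_one_2pi_int)
    then have "x $ j = m" by simp
    with assms(1)[of j] have "\<bar>real_of_int m\<bar> < 1" by simp
    then have "m = 0" by linarith
    with \<open>x $ j = m\<close> j show False by simp
  qed
  then have "cos (2 * pi * x $ j) < 1" using cos_le_one[of "2 * pi * x $ j"] by linarith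
  then have "(\<Sum>i\<in>UNIV. cos (2 * pi * x $ i)) < (\<Sum>i\<in>(UNIV :: 'a set). 1)"
    by (intro sum_strict_mono2[of _ _ j] sum_strict_mono_ex1) auto
  then show ?thesis by (simp add: peak_def field_simps)
qed

lemma lattice_periodic_peak: "lattice_periodic peak"
proof -
  have "cos (2 * pi * (x + of_int m)) = cos (2 * pi * x)" for x :: real and m :: int
    unfolding distrib_left cos_add by (simp only: cos_int_2pin sin_int_2pin mult_1_right mult_zero_right diff_zero)
  then show ?thesis by (simp add: lattice_periodic_def peak_def lattice_point_def)
qed

definition peak_mass :: "'n::finite itself \<Rightarrow> nat \<Rightarrow> real" where
  "peak_mass _ N = (LINT x|(tor :: (real ^ 'n::finite) measure). peak x ^ N)"

definition centered_cube :: "(real ^ 'n) set" where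
  "centered_cube = halfopen_cube (\<chi> i. - 1 / 2)"

lemma centered_cubeD: "x \<in> centered_cube \<Longrightarrow> \<bar>x $ i\<bar> \<le> 1 / 2"
proof -
  assume "x \<in> centered_cube"
  then have "- 1 / 2 \<le> x $ i \<and> x $ i < - 1 / 2 + 1"
    unfolding centered_cube_def halfopen_cube_def mem_Collect_eq by (metis vec_lambda_beta)
  then show ?thesis by linarith
qed

lemma centered_cube_measurable [measurable]: "centered_cube \<in> sets borel"
  by (simp add: centered_cube_def)

lemma fundamental_domain_centered_cube: "fundamental_domain centered_cube"
  unfolding centered_cube_def by (rule fundamental_domain_halfopen_cube)

lemma ennreal_peak_mass: "ennreal (peak_mass TYPE('n) N) = (\<integral>\<^sup>+ x. indicator centered_cube x * ennreal (peak x ^ N) \<partial>(lborel :: (real ^ 'n) measure))"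
proof -
  have "ennreal (peak_mass TYPE('n) N) = (\<integral>\<^sup>+ x. ennreal (peak x ^ N) \<partial>(tor :: (real ^ 'n) measure))"
    unfolding peak_mass_def
    by (subst nn_integral_eq_integral)
      (auto intro!: tor.integrable_const_bound[of _ 1] simp: peak_range power_le_one)
  also have "\<dots> = (\<integral>\<^sup>+ x. indicator centered_cube x * ennreal (peak x ^ N) \<partial>(lborel :: (real ^ 'n) measure))"
    by (rule nn_integral_tor_fundamental[OF _ _ fundamental_domain_centered_cube])
      (auto simp: lattice_periodic_def lattice_periodicD[OF lattice_periodic_peak])
  finally show ?thesis .
qed

lemma ball_subset_centered_cube: "\<delta> \<le> 1 / 2 \<Longrightarrow> ball 0 \<delta> \<subseteq> centered_cube"
proof
  fix x :: "real ^ 'n" assume "\<delta> \<le> 1 / 2" "x \<in> ball 0 \<delta>"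
  then have lt: "\<bar>x $ i\<bar> < 1 / 2" for i using component_le_norm_cart[of x i] by (simp add: dist_norm)
  then have "- 1 / 2 \<le> x $ i \<and> x $ i < - 1 / 2 + 1" for i
    using lt[of i] by linarith
  then show "x \<in> centered_cube" by (simp add: centered_cube_def halfopen_cube_def)
qed

text \<open>
  By continuity the peak exceeds \<open>s\<close> on a ball around the origin; \<open>\<mu>\<close> is the volume of that ball.
\<close>

lemma peak_mass_lower_bound:
  assumes "0 < s" "s < 1"
  obtains \<mu> where "\<mu> > 0" "\<And>N. \<mu> * s ^ N \<le> peak_mass TYPE('n::finite) N"
proof -
  have "isCont peak (0 :: real ^ 'n)"
    using continuous_peak[of "UNIV :: (real ^ 'n) set"] by (simp add: continuous_on_eq_continuous_at)
  then obtain \<delta> where \<delta>: "\<delta> > 0" "\<And>x :: real ^ 'n. dist x 0 < \<delta> \<Longrightarrow> dist (peak x) 1 < 1 - s"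
    using assms(2) by (auto simp: continuous_at_eps_delta) (metis diff_gt_0_iff_gt)
  define \<rho> where "\<rho> = min \<delta> (1 / 2)"
  define B :: "(real ^ 'n) set" where "B = ball 0 \<rho>"
  have B: "B \<subseteq> centered_cube" unfolding B_def by (rule ball_subset_centered_cube) (simp add: \<rho>_def)
  have "\<rho> > 0" using \<delta> by (simp add: \<rho>_def)
  have Bfin: "emeasure lborel B < \<infinity>" unfolding B_def by (rule emeasure_bounded_finite) simp
  define \<mu> where "\<mu> = measure lborel B"
  have "\<mu> > 0" unfolding \<mu>_def B_def using \<open>\<rho> > 0\<close> by (simp add: content_ball_pos)
  moreover have "\<mu> * s ^ N \<le> peak_mass TYPE('n) N" for N
  proof -
    have "ennreal (\<mu> * s ^ N) = (\<integral>\<^sup>+ x. ennreal (s ^ N) * indicator B x \<partial>lborel)"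
      using Bfin assms by (subst nn_integral_cmult_indicator)
        (simp_all add: B_def \<mu>_def emeasure_eq_ennreal_measure ennreal_mult mult.commute)
    also have "\<dots> \<le> (\<integral>\<^sup>+ x. indicator centered_cube x * ennreal (peak x ^ N) \<partial>(lborel :: (real ^ 'n) measure))"
    proof (rule nn_integral_mono)
      fix x :: "real ^ 'n"
      show "ennreal (s ^ N) * indicator B x \<le> indicator centered_cube x * ennreal (peak x ^ N)"
      proof (cases "x \<in> B")
        case True
        then have "s \<le> peak x" using \<delta>(2)[of x] peak_range[of x]
          by (auto simp: B_def \<rho>_def dist_commute dist_real_def)
        then have "s ^ N \<le> peak x ^ N" using assms by (intro power_mono) auto
        then show ?thesis using True B by (auto simp: indicator_def intro!: ennreal_leI)
      qed simp
    qed
    also have "\<dots> = ennreal (peak_mass TYPE('n) N)" by (rule ennreal_peak_mass[symmetric])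
    finally show ?thesis
      by (subst (asm) ennreal_le_iff) (auto simp: peak_mass_def peak_range intro!: integral_nonneg)
  qed
  ultimately show thesis using that by blast
qed

lemma peak_mass_pos: "0 < peak_mass TYPE('n::finite) N"
proof -
  obtain \<mu> where "\<mu> > 0" "\<mu> * (1 / 2) ^ N \<le> peak_mass TYPE('n) N"
    using peak_mass_lower_bound[of "1 / 2", where 'n = 'n] by auto
  then show ?thesis by (smt (verit) mult_pos_pos zero_less_power divide_pos_pos)
qed

definition peak_kernel :: "nat \<Rightarrow> real ^ 'n \<Rightarrow> real" where
  "peak_kernel N x = peak x ^ N / peak_mass TYPE('n) N"

lemma kernel_nonneg: "0 \<le> peak_kernel N x"
  by (simp add: peak_kernel_def peak_range less_imp_le[OF peak_mass_pos])

lemma kernel_measurable [measurable]: "peak_kernel N \<in> borel_measurable borel"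
  unfolding peak_kernel_def[abs_def] by measurable

lemma lattice_periodic_kernel: "lattice_periodic (peak_kernel N)"
  by (simp add: lattice_periodic_def peak_kernel_def lattice_periodicD[OF lattice_periodic_peak])

lemma nn_integral_kernel: "(\<integral>\<^sup>+ x. indicator centered_cube x * ennreal (peak_kernel N x) \<partial>(lborel :: (real ^ 'n) measure)) = 1"
proof -
  let ?Z = "peak_mass TYPE('n) N"
  have "(\<integral>\<^sup>+ x. indicator centered_cube x * ennreal (peak_kernel N x) \<partial>(lborel :: (real ^ 'n) measure))
    = (\<integral>\<^sup>+ x. ennreal (1 / ?Z) * (indicator centered_cube x * ennreal (peak x ^ N)) \<partial>(lborel :: (real ^ 'n) measure))"
    by (rule nn_integral_cong) (auto simp: peak_kernel_def indicator_def peak_range less_imp_le[OF peak_mass_pos] simp flip: ennreal_mult)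
  also have "\<dots> = ennreal (1 / ?Z) * ennreal ?Z"
    by (subst nn_integral_cmult) (auto simp: ennreal_peak_mass)
  also have "\<dots> = 1" using peak_mass_pos[where 'n = 'n, of N] by (simp flip: ennreal_mult)
  finally show ?thesis .
qed

text \<open>
  Away from the origin the peak is at most some \<open>r < 1\<close>, by compactness, whereas the normalising
  integral decays more slowly than \<open>s ^ N\<close> up to a constant, for any \<open>s\<close> between \<open>r\<close> and \<open>1\<close>.
\<close>

lemma kernel_concentrates:
  assumes "\<delta> > 0"
  shows "(\<lambda>N. \<integral>\<^sup>+ x. indicator (centered_cube - ball 0 \<delta>) x * ennreal (peak_kernel N x) \<partial>(lborel :: (real ^ 'n) measure)) \<longlonglongrightarrow> 0"
proof -
  define C :: "(real ^ 'n) set" where "C = cbox (\<chi> i. - 1 / 2) (\<chi> i. 1 / 2) - ball 0 \<delta>"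
  have "compact C" unfolding C_def by (intro compact_diff compact_cbox open_ball)
  have sub: "centered_cube - ball 0 \<delta> \<subseteq> C"
  proof
    fix x :: "real ^ 'n" assume x: "x \<in> centered_cube - ball 0 \<delta>"
    then have "- 1 / 2 \<le> x $ i \<and> x $ i \<le> 1 / 2" for i
      using x centered_cubeD[of x i] by (simp add: abs_le_iff) linarith
    with x show "x \<in> C" by (simp add: C_def mem_box_cart)
  qed
  obtain r where r: "0 \<le> r" "r < 1" "\<And>x. x \<in> C \<Longrightarrow> peak x \<le> r"
  proof (cases "C = {}")
    case False
    then obtain z where z: "z \<in> C" "\<And>x. x \<in> C \<Longrightarrow> peak x \<le> peak z"
      using continuous_attains_sup[OF \<open>compact C\<close> _ continuous_peak] by blast
    have zb: "- 1 / 2 \<le> z $ i \<and> z $ i \<le> 1 / 2" for i using z(1) by (simp add: C_def mem_box_cart)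
    have "\<bar>z $ i\<bar> \<le> 1 / 2" for i using zb[of i] by linarith
    moreover have "z \<noteq> 0" using z(1) assms by (auto simp: C_def)
    ultimately show thesis using peak_less_1 z peak_range that by blast
  qed (use that[of 0] in auto)
  define s where "s = (1 + r) / 2"
  have s: "r < s" "0 < s" "s < 1" using r by (auto simp: s_def)
  obtain \<mu> where \<mu>: "\<mu> > 0" "\<And>N. \<mu> * s ^ N \<le> peak_mass TYPE('n) N"
    using peak_mass_lower_bound[OF s(2,3), where 'n = 'n] by blast
  have bound: "(\<integral>\<^sup>+ x. indicator (centered_cube - ball 0 \<delta>) x * ennreal (peak_kernel N x) \<partial>(lborel :: (real ^ 'n) measure))
      \<le> ennreal ((r / s) ^ N / \<mu>)" for N
  proof -
    have "peak_kernel N x \<le> (r / s) ^ N / \<mu>" if "x \<in> C" for x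
    proof -
      have "peak_kernel N x \<le> r ^ N / (\<mu> * s ^ N)"
        unfolding peak_kernel_def using that r \<mu> s peak_range[of x]
        by (intro frac_le power_mono) auto
      then show ?thesis by (simp add: power_divide field_simps)
    qed
    then have "(\<integral>\<^sup>+ x. indicator (centered_cube - ball 0 \<delta>) x * ennreal (peak_kernel N x) \<partial>(lborel :: (real ^ 'n) measure))
        \<le> (\<integral>\<^sup>+ x. ennreal ((r / s) ^ N / \<mu>) * indicator centered_cube x \<partial>(lborel :: (real ^ 'n) measure))"
      using sub by (intro nn_integral_mono) (auto simp: indicator_def intro!: ennreal_leI)
    also have "\<dots> = ennreal ((r / s) ^ N / \<mu>) * (\<integral>\<^sup>+ x. 1 \<partial>(tor :: (real ^ 'n) measure))"
      using nn_integral_tor_fundamental[OF _ _ fundamental_domain_centered_cube, of "\<lambda>_ :: real ^ 'n. 1"]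
      by (subst nn_integral_cmult) (auto simp: lattice_periodic_def)
    finally show ?thesis by simp
  qed
  have "(\<lambda>N. (r / s) ^ N / \<mu>) \<longlonglongrightarrow> 0 / \<mu>"
    using r s by (intro tendsto_divide LIMSEQ_power_zero tendsto_const) (use \<mu>(1) in auto)
  then have "(\<lambda>N. ennreal ((r / s) ^ N / \<mu>)) \<longlonglongrightarrow> 0"
    using tendsto_ennrealI by fastforce
  from tendsto_sandwich[OF _ _ tendsto_const this] show ?thesis
    using bound by simp
qed

text \<open>
  The upper bound for the coefficients holds because a Fourier coefficient of a nonnegative function is
  bounded by its integral, which is one.
\<close>

lemma kernel_trig_poly:
  obtains A a where "finite (A :: (int ^ 'n) set)" "\<And>k. 0 \<le> a k" "\<And>k. k \<in> A \<Longrightarrow> a k \<le> 1"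
    "\<And>x. complex_of_real (peak_kernel N x) = (\<Sum>k\<in>A. complex_of_real (a k) * wave k x)"
proof -
  have "positive_trig_poly (\<lambda>x :: real ^ 'n. complex_of_real (1 / peak_mass TYPE('n) N) * complex_of_real (peak x) ^ N)"
    by (intro positive_trig_poly_mult positive_trig_poly_const positive_trig_poly_power positive_trig_poly_peak)
      (simp add: less_imp_le[OF peak_mass_pos])
  then obtain A a where A: "finite (A :: (int ^ 'n) set)" "\<And>k. 0 \<le> a k"
    "\<And>x. complex_of_real (peak_kernel N x) = (\<Sum>k\<in>A. complex_of_real (a k) * wave k x)"
    by (rule positive_trig_polyE) (auto simp: peak_kernel_def fun_eq_iff)
  have kint: "integrable (tor :: (real ^ 'n) measure) (peak_kernel N)"
    by (rule tor.integrable_const_bound[of _ "1 / peak_mass TYPE('n) N"])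
      (use peak_mass_pos[where 'n = 'n, of N] in \<open>auto simp: peak_kernel_def peak_range power_le_one divide_right_mono less_imp_le\<close>)
  have mass: "(LINT x|(tor :: (real ^ 'n) measure). peak_kernel N x) = 1"
    using peak_mass_pos[where 'n = 'n, of N] by (simp add: peak_kernel_def peak_mass_def)
  have "a k \<le> 1" if "k \<in> A" for k
  proof -
    have "(LINT x|tor. complex_of_real (peak_kernel N x) * wave (- k) x)
        = (LINT x|tor. (\<Sum>l\<in>A. complex_of_real (a l) * wave (l - k) x))"
      by (simp add: A(3) sum_distrib_right wave_add_freq mult.assoc flip: add_uminus_conv_diff)
    also have "\<dots> = (\<Sum>l\<in>A. complex_of_real (a l) * of_bool (l = k))"
      by (subst Bochner_Integration.integral_sum) (auto simp: integral_wave integrable_wave)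
    also have "\<dots> = complex_of_real (a k)"
      using A(1) that by (simp add: of_bool_def if_distrib sum.delta cong: if_cong)
    finally have "a k = cmod (LINT x|tor. complex_of_real (peak_kernel N x) * wave (- k) x)"
      using A(2)[of k] by simp
    also have "\<dots> \<le> (LINT x|tor. cmod (complex_of_real (peak_kernel N x) * wave (- k) x))"
      by (rule integral_norm_bound)
    also have "\<dots> = 1" using mass by (simp add: norm_mult kernel_nonneg)
    finally show ?thesis .
  qed
  with A show thesis using that by blast
qed

section \<open>Continuity of translations in square mean\<close>

definition clamp_real :: "real \<Rightarrow> real \<Rightarrow> real" where
  "clamp_real M s = max (- M) (min M s)"

lemma clamp_real_continuous: "continuous_on S (clamp_real M)"
  unfolding clamp_real_def by (intro continuous_intros)

lemma clamp_real_measurable [measurable]: "clamp_real M \<in> borel_measurable borel"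
  by (rule borel_measurable_continuous_onI[OF clamp_real_continuous])

lemma clamp_real_bound: "0 \<le> M \<Longrightarrow> \<bar>clamp_real M s\<bar> \<le> M"
  by (auto simp: clamp_real_def)

lemma square_sum3_le: "(a + b + c)\<^sup>2 \<le> 3 * (a\<^sup>2 + b\<^sup>2 + c\<^sup>2 :: real)"
  using sum_squares_ge_zero[of "a - b" "b - c"] zero_le_power2[of "a - c"]
  by (simp add: power2_eq_square algebra_simps)

lemma square_sum2_le: "(a + b)\<^sup>2 \<le> 2 * (a\<^sup>2 + b\<^sup>2 :: real)"
  using zero_le_power2[of "a - b"] by (simp add: power2_eq_square algebra_simps)

lemma square_integrable_approx_bounded:
  fixes f :: "'a \<Rightarrow> real"
  assumes [measurable]: "f \<in> borel_measurable M" and fin: "(\<integral>\<^sup>+ x. ennreal ((f x)\<^sup>2) \<partial>M) < \<infinity>"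
  shows "(\<lambda>n. \<integral>\<^sup>+ x. ennreal ((f x - clamp_real (real n) (f x))\<^sup>2) \<partial>M) \<longlonglongrightarrow> 0"
proof -
  have "(\<lambda>n. \<integral>\<^sup>+ x. ennreal ((f x - clamp_real (real n) (f x))\<^sup>2) \<partial>M) \<longlonglongrightarrow> (\<integral>\<^sup>+ x. 0 \<partial>M)"
  proof (rule nn_integral_dominated_convergence[OF _ _ _ _ fin])
    have "\<bar>f x - clamp_real (real n) (f x)\<bar> \<le> \<bar>f x\<bar>" for n x
      by (auto simp: clamp_real_def max_def min_def)
    then show "AE x in M. ennreal ((f x - clamp_real (real n) (f x))\<^sup>2) \<le> ennreal ((f x)\<^sup>2)" for n
      by (intro AE_I2 ennreal_leI) (simp add: abs_le_square_iff)
    show "AE x in M. (\<lambda>n. ennreal ((f x - clamp_real (real n) (f x))\<^sup>2)) \<longlonglongrightarrow> 0"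
    proof (intro AE_I2 tendsto_eventually)
      fix x
      have "\<forall>\<^sub>F n in sequentially. \<bar>f x\<bar> \<le> real n"
        using eventually_ge_at_top[of "nat \<lceil>\<bar>f x\<bar>\<rceil>"] by eventually_elim linarith
      then show "\<forall>\<^sub>F n in sequentially. ennreal ((f x - clamp_real (real n) (f x))\<^sup>2) = 0"
        by eventually_elim (auto simp: clamp_real_def max_def min_def)
    qed
  qed measurable
  then show ?thesis by simp
qed

text \<open>
  A measurable function is an almost everywhere limit of continuous functions. Clamping these to the
  bound of \<open>f\<close> keeps them continuous and permits dominated convergence on \<open>R\<close>.
\<close>

lemma bounded_function_approx_continuous:
  fixes f :: "'a::euclidean_space \<Rightarrow> real"
  assumes [measurable]: "f \<in> borel_measurable borel" "R \<in> sets borel"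
    and bd: "\<And>x. \<bar>f x\<bar> \<le> C" and R: "emeasure lborel R < \<infinity>" and "\<epsilon> > 0"
  obtains g where "continuous_on UNIV g" "(\<integral>\<^sup>+ x. indicator R x * ennreal ((f x - g x)\<^sup>2) \<partial>lborel) < \<epsilon>"
proof -
  have C: "0 \<le> C" using bd[of undefined] by linarith
  have "f measurable_on UNIV"
    by (intro lebesgue_measurable_imp_measurable_on measurable_completion) simp_all
  then obtain N g where N: "negligible N" and g: "\<And>n. continuous_on UNIV (g n)"
    and lim: "\<And>x. x \<notin> N \<Longrightarrow> (\<lambda>n. g n x) \<longlonglongrightarrow> f x"
    by (auto simp: measurable_on_def)
  define h where "h n x = clamp_real C (g n x)" for n x
  have h: "continuous_on UNIV (h n)" for n
    unfolding h_def by (rule continuous_on_compose2[OF clamp_real_continuous g]) auto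
  have [measurable]: "h n \<in> borel_measurable borel" for n by (rule borel_measurable_continuous_onI[OF h])
  have hlim: "(\<lambda>n. h n x) \<longlonglongrightarrow> f x" if "x \<notin> N" for x
  proof -
    have "(\<lambda>n. h n x) \<longlonglongrightarrow> clamp_real C (f x)"
      unfolding h_def using clamp_real_continuous[of UNIV C] lim[OF that]
      by (auto simp: continuous_on_eq_continuous_at intro: isCont_tendsto_compose)
    moreover have "clamp_real C (f x) = f x" using bd[of x] by (auto simp: clamp_real_def)
    ultimately show ?thesis by simp
  qed
  have "AE x in lebesgue. x \<notin> N"
    using N AE_not_in[of N lebesgue] by (simp add: negligible_iff_null_sets)
  then have AE: "AE x in lborel. x \<notin> N" by (simp add: AE_completion_iff)
  have "(\<lambda>n. \<integral>\<^sup>+ x. indicator R x * ennreal ((f x - h n x)\<^sup>2) \<partial>lborel) \<longlonglongrightarrow> (\<integral>\<^sup>+ x. 0 \<partial>(lborel :: 'a measure))"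
  proof (rule nn_integral_dominated_convergence[where w = "\<lambda>x. ennreal ((2 * C)\<^sup>2) * indicator R x"])
    show "AE x in lborel. indicator R x * ennreal ((f x - h n x)\<^sup>2) \<le> ennreal ((2 * C)\<^sup>2) * indicator R x" for n
    proof (rule AE_I2)
      fix x
      have "\<bar>f x - h n x\<bar> \<le> \<bar>2 * C\<bar>" using bd[of x] clamp_real_bound[OF C, of "g n x"] unfolding h_def by linarith
      then show "indicator R x * ennreal ((f x - h n x)\<^sup>2) \<le> ennreal ((2 * C)\<^sup>2) * indicator R x"
        by (auto simp: indicator_def abs_le_square_iff intro!: ennreal_leI simp del: abs_mult)
    qed
    show "(\<integral>\<^sup>+ x. ennreal ((2 * C)\<^sup>2) * indicator R x \<partial>lborel) < \<infinity>"
      using R by (subst nn_integral_cmult_indicator) (auto simp: ennreal_mult_less_top)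
    show "AE x in lborel. (\<lambda>n. indicator R x * ennreal ((f x - h n x)\<^sup>2)) \<longlonglongrightarrow> 0"
      using AE
    proof eventually_elim
      case (elim x)
      have "(\<lambda>n. ennreal ((f x - h n x)\<^sup>2)) \<longlonglongrightarrow> ennreal ((f x - f x)\<^sup>2)"
        by (intro tendsto_intros hlim[OF elim])
      then show ?case by (cases "x \<in> R") auto
    qed
  qed measurable
  then have "\<forall>\<^sub>F n in sequentially. (\<integral>\<^sup>+ x. indicator R x * ennreal ((f x - h n x)\<^sup>2) \<partial>lborel) < \<epsilon>"
    using \<open>\<epsilon> > 0\<close> by (intro order_tendstoD(2)) auto
  then obtain n where "(\<integral>\<^sup>+ x. indicator R x * ennreal ((f x - h n x)\<^sup>2) \<partial>lborel) < \<epsilon>"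
    by (auto simp: eventually_sequentially)
  then show thesis using that h by blast
qed

lemma square_integrable_approx_continuous:
  fixes f :: "'a::euclidean_space \<Rightarrow> real"
  assumes [measurable]: "f \<in> borel_measurable borel" "R \<in> sets borel"
    and fin: "(\<integral>\<^sup>+ x. indicator R x * ennreal ((f x)\<^sup>2) \<partial>lborel) < \<infinity>"
    and R: "emeasure lborel R < \<infinity>" and "\<epsilon> > 0"
  obtains g where "continuous_on UNIV g" "(\<integral>\<^sup>+ x. indicator R x * ennreal ((f x - g x)\<^sup>2) \<partial>lborel) < ennreal \<epsilon>"
proof -
  let ?I = "\<lambda>h. \<integral>\<^sup>+ x. indicator R x * ennreal ((h x)\<^sup>2) \<partial>lborel"
  have IR: "?I h = (\<integral>\<^sup>+ x. ennreal ((h x)\<^sup>2) \<partial>restrict_space lborel R)" for h :: "'a \<Rightarrow> real"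
    by (subst nn_integral_restrict_space) (auto simp: mult.commute)
  have "(\<lambda>n. ?I (\<lambda>x. f x - clamp_real (real n) (f x))) \<longlonglongrightarrow> 0"
    unfolding IR by (rule square_integrable_approx_bounded) (use fin in \<open>simp_all add: IR measurable_restrict_space1\<close>)
  then have "\<forall>\<^sub>F n in sequentially. ?I (\<lambda>x. f x - clamp_real (real n) (f x)) < ennreal (\<epsilon> / 4)"
    using \<open>\<epsilon> > 0\<close> by (intro order_tendstoD(2)) auto
  then obtain n where n: "?I (\<lambda>x. f x - clamp_real (real n) (f x)) < ennreal (\<epsilon> / 4)"
    by (auto simp: eventually_sequentially)
  obtain g where g: "continuous_on UNIV g" "?I (\<lambda>x. clamp_real (real n) (f x) - g x) < ennreal (\<epsilon> / 4)"
    by (rule bounded_function_approx_continuous[of "\<lambda>x. clamp_real (real n) (f x)" R "real n" "ennreal (\<epsilon> / 4)"])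
      (use clamp_real_bound \<open>\<epsilon> > 0\<close> R in auto)
  have [measurable]: "g \<in> borel_measurable borel" by (rule borel_measurable_continuous_onI[OF g(1)])
  have "?I (\<lambda>x. f x - g x) \<le> (\<integral>\<^sup>+ x. 2 * (indicator R x * ennreal ((f x - clamp_real (real n) (f x))\<^sup>2))
       + 2 * (indicator R x * ennreal ((clamp_real (real n) (f x) - g x)\<^sup>2)) \<partial>lborel)"
  proof (rule nn_integral_mono)
    fix x
    have "ennreal ((f x - g x)\<^sup>2) \<le> ennreal (2 * ((f x - clamp_real (real n) (f x))\<^sup>2 + (clamp_real (real n) (f x) - g x)\<^sup>2))"
      using square_sum2_le[of "f x - clamp_real (real n) (f x)" "clamp_real (real n) (f x) - g x"] by (intro ennreal_leI) simp
    then show "indicator R x * ennreal ((f x - g x)\<^sup>2) \<le> 2 * (indicator R x * ennreal ((f x - clamp_real (real n) (f x))\<^sup>2))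
       + 2 * (indicator R x * ennreal ((clamp_real (real n) (f x) - g x)\<^sup>2))"
      by (auto simp: indicator_def ennreal_mult ennreal_plus distrib_left)
  qed
  also have "\<dots> = 2 * ?I (\<lambda>x. f x - clamp_real (real n) (f x)) + 2 * ?I (\<lambda>x. clamp_real (real n) (f x) - g x)"
    by (subst nn_integral_add) (auto simp: nn_integral_cmult)
  also have "\<dots> < 2 * ennreal (\<epsilon> / 4) + 2 * ennreal (\<epsilon> / 4)"
    using n g(2) by (intro add_strict_mono ennreal_mult_strict_left_mono) auto
  also have "\<dots> = ennreal \<epsilon>"
    using \<open>\<epsilon> > 0\<close> by (simp add: ennreal_mult[of 2 "\<epsilon> / 4", simplified, symmetric] ennreal_plus[symmetric] del: ennreal_plus)
  finally show thesis using that g(1) by blast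
qed


lemma finite_int_vectors: "finite {k :: int ^ 'n. \<forall>i. k $ i \<in> {a..b}}"
proof (rule finite_subset)
  show "{k :: int ^ 'n. \<forall>i. k $ i \<in> {a..b}} \<subseteq> vec_lambda ` (PiE UNIV (\<lambda>_. {a..b}))"
  proof
    fix k :: "int ^ 'n" assume "k \<in> {k. \<forall>i. k $ i \<in> {a..b}}"
    then have "(\<lambda>i. k $ i) \<in> PiE UNIV (\<lambda>_. {a..b})" by auto
    then have "vec_lambda (\<lambda>i. k $ i) \<in> vec_lambda ` (PiE UNIV (\<lambda>_. {a..b}))" by (rule imageI)
    then show "k \<in> vec_lambda ` (PiE UNIV (\<lambda>_. {a..b}))" by simp
  qed
  show "finite (vec_lambda ` (PiE (UNIV :: 'n set) (\<lambda>_. {a..b})))"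
    by (intro finite_imageI finite_PiE) auto
qed

text \<open>
  A box that contains the translates of the unit cube by all vectors of norm at most one.
\<close>

abbreviation big_box :: "(real ^ 'n) set" where
  "big_box \<equiv> cbox (\<chi> i. - 1) (\<chi> i. 2)"

lemma nn_integral_big_box_le:
  fixes g :: "real ^ 'n \<Rightarrow> ennreal"
  assumes [measurable]: "g \<in> borel_measurable borel" and g: "lattice_periodic g"
  shows "(\<integral>\<^sup>+ x. indicator big_box x * g x \<partial>lborel)
    \<le> of_nat (card {k :: int ^ 'n. \<forall>i. k $ i \<in> {-1..2}}) * (\<integral>\<^sup>+ x. g x \<partial>tor)"
proof -
  let ?F = "{k :: int ^ 'n. \<forall>i. k $ i \<in> {-1..2}}"
  have "(\<integral>\<^sup>+ x. indicator big_box x * g x \<partial>lborel)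
      \<le> (\<integral>\<^sup>+ x. (\<Sum>k\<in>?F. indicator (halfopen_cube 0) (x + - lattice_point k) * g (x + - lattice_point k)) \<partial>lborel)"
  proof (rule nn_integral_mono)
    fix x :: "real ^ 'n"
    show "indicator big_box x * g x
      \<le> (\<Sum>k\<in>?F. indicator (halfopen_cube 0) (x + - lattice_point k) * g (x + - lattice_point k))"
    proof (cases "x \<in> big_box")
      case True
      define k :: "int ^ 'n" where "k = (\<chi> i. \<lfloor>x $ i\<rfloor>)"
      have "- 1 \<le> x $ i \<and> x $ i \<le> 2" for i using True by (simp add: mem_box_cart)
      then have "- 1 \<le> \<lfloor>x $ i\<rfloor> \<and> \<lfloor>x $ i\<rfloor> \<le> 2" for i
        by (metis floor_mono floor_numeral floor_uminus_of_int floor_of_int le_floor_iff of_int_1 of_int_minus)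
      then have "k \<in> ?F" by (simp add: k_def)
      moreover have "x + - lattice_point k \<in> halfopen_cube 0"
        by (auto simp: halfopen_cube_def lattice_point_def k_def) linarith
      ultimately have "g x = indicator (halfopen_cube 0) (x + - lattice_point k) * g (x + - lattice_point k)"
        using lattice_periodic_minusD[OF g, of x k] by simp
      also have "\<dots> \<le> (\<Sum>k\<in>?F. indicator (halfopen_cube 0) (x + - lattice_point k) * g (x + - lattice_point k))"
        by (rule member_le_sum[OF \<open>k \<in> ?F\<close>]) (use finite_int_vectors in auto)
      finally show ?thesis using True by simp
    qed simp
  qed
  also have "\<dots> = (\<Sum>k\<in>?F. \<integral>\<^sup>+ x. indicator (halfopen_cube 0) (x + - lattice_point k) * g (x + - lattice_point k) \<partial>lborel)"
    by (rule nn_integral_sum) measurable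
  also have "\<dots> = (\<Sum>k\<in>?F. \<integral>\<^sup>+ x. g x \<partial>tor)"
    by (intro sum.cong refl, unfold nn_integral_tor, rule nn_integral_lborel_shift) measurable
  finally show ?thesis by simp
qed

lemma measurable_spacetimeI:
  assumes "F \<in> measurable (borel :: (real \<times> (real ^ 'n)) measure) N"
  shows "F \<in> measurable (tim T \<Otimes>\<^sub>M tor) N"
proof -
  have "(\<lambda>z. (fst z, snd z)) \<in> measurable (tim T \<Otimes>\<^sub>M (tor :: (real ^ 'n) measure)) (borel \<Otimes>\<^sub>M borel)"
    by (intro measurable_Pair measurable_compose[OF measurable_fst] measurable_compose[OF measurable_snd]
        measurable_timI measurable_torI) simp_all
  then have "(\<lambda>z. z) \<in> measurable (tim T \<Otimes>\<^sub>M (tor :: (real ^ 'n) measure)) borel"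
    by (simp add: borel_prod)
  from measurable_compose[OF this assms] show ?thesis .
qed

lemma borel_measurable_section:
  fixes F :: "real \<times> (real ^ 'n) \<Rightarrow> 'b::topological_space"
  assumes "F \<in> borel_measurable borel"
  shows "(\<lambda>x. F (t, x)) \<in> borel_measurable borel"
  by (rule measurable_compose[OF _ assms]) (intro borel_measurable_continuous_onI continuous_intros)

lemma nn_integral_tor_measurable:
  fixes F :: "real \<times> (real ^ 'n) \<Rightarrow> ennreal"
  assumes "F \<in> borel_measurable borel"
  shows "(\<lambda>t. \<integral>\<^sup>+ x. F (t, x) \<partial>tor) \<in> borel_measurable (tim T)"
  by (rule tor.borel_measurable_nn_integral) (use measurable_spacetimeI[OF assms] in simp)

lemma emeasure_tim: "0 \<le> T \<Longrightarrow> emeasure (tim T) {0..T} = ennreal T"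
  by (simp add: tim_def emeasure_restrict_space)

lemma nn_integral_spacetime:
  fixes h :: "real \<times> (real ^ 'n) \<Rightarrow> ennreal"
  assumes [measurable]: "h \<in> borel_measurable borel" "D \<in> sets borel"
  shows "(\<integral>\<^sup>+ t. \<integral>\<^sup>+ x. indicator D x * h (t, x) \<partial>lborel \<partial>tim T) = (\<integral>\<^sup>+ z. indicator ({0..T} \<times> D) z * h z \<partial>lborel)"
proof -
  have [measurable]: "h \<in> borel_measurable (borel \<Otimes>\<^sub>M borel)" by (simp add: borel_prod)
  have "(\<integral>\<^sup>+ t. \<integral>\<^sup>+ x. indicator D x * h (t, x) \<partial>lborel \<partial>tim T)
      = (\<integral>\<^sup>+ t. (\<integral>\<^sup>+ x. indicator D x * h (t, x) \<partial>lborel) * indicator {0..T} t \<partial>lborel)"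
    unfolding tim_def by (subst nn_integral_restrict_space) auto
  also have "\<dots> = (\<integral>\<^sup>+ t. \<integral>\<^sup>+ x. indicator ({0..T} \<times> D) (t, x) * h (t, x) \<partial>lborel \<partial>lborel)"
    by (rule nn_integral_cong) (auto simp: indicator_def intro!: nn_integral_cong)
  also have "\<dots> = (\<integral>\<^sup>+ z. indicator ({0..T} \<times> D) z * h z \<partial>(lborel \<Otimes>\<^sub>M lborel))"
    by (rule lborel.nn_integral_fst) measurable
  finally show ?thesis by (simp add: lborel_prod)
qed

text \<open>
  Approximate by a continuous function on the box, whose translates are close by uniform continuity. The
  two approximation errors are unaffected by the translation, as the box contains the translated cube.
\<close>

lemma L2_translation_continuity:
  fixes W :: "real \<Rightarrow> real ^ 'n \<Rightarrow> real"
  assumes meas: "(\<lambda>z. W (fst z) (snd z)) \<in> borel_measurable borel"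
    and per: "\<And>t. lattice_periodic (W t)"
    and fin: "(\<integral>\<^sup>+ t. \<integral>\<^sup>+ x. ennreal ((W t x)\<^sup>2) \<partial>tor \<partial>tim T) < \<infinity>"
    and "\<epsilon> > 0" "T \<ge> 0"
  obtains \<delta> where "\<delta> > 0"
    "\<And>y. norm y < \<delta> \<Longrightarrow> (\<integral>\<^sup>+ t. \<integral>\<^sup>+ x. ennreal ((W t x - W t (x - y))\<^sup>2) \<partial>tor \<partial>tim T) \<le> ennreal \<epsilon>"
proof -
  let ?R = "{0..T} \<times> (big_box :: (real ^ 'n) set)"
  let ?Q = "{0..T} \<times> (halfopen_cube 0 :: (real ^ 'n) set)"
  define f where "f z = W (fst z) (snd z)" for z :: "real \<times> (real ^ 'n)"
  have [measurable]: "f \<in> borel_measurable borel" unfolding f_def using meas by simp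
  have [measurable]: "?Q \<in> sets borel" "?R \<in> sets borel"
    by (auto simp: borel_prod[symmetric])
  have fsec[measurable]: "W t \<in> borel_measurable borel" for t
    using borel_measurable_section[OF meas, of t] by simp
  have "(\<integral>\<^sup>+ z. indicator ?R z * ennreal ((f z)\<^sup>2) \<partial>lborel)
      = (\<integral>\<^sup>+ t. \<integral>\<^sup>+ x. indicator big_box x * ennreal ((W t x)\<^sup>2) \<partial>lborel \<partial>tim T)"
  proof -
    have "(\<lambda>z. ennreal ((f z)\<^sup>2)) \<in> borel_measurable borel" by measurable
    from nn_integral_spacetime[OF this, of big_box T] show ?thesis by (simp add: f_def)
  qed
  also have "\<dots> \<le> (\<integral>\<^sup>+ t. of_nat (card {k :: int ^ 'n. \<forall>i. k $ i \<in> {-1..2}}) * (\<integral>\<^sup>+ x. ennreal ((W t x)\<^sup>2) \<partial>tor) \<partial>tim T)"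
    by (intro nn_integral_mono nn_integral_big_box_le)
      (auto simp: lattice_periodic_def lattice_periodicD[OF per])
  also have "\<dots> = of_nat (card {k :: int ^ 'n. \<forall>i. k $ i \<in> {-1..2}}) * (\<integral>\<^sup>+ t. (\<integral>\<^sup>+ x. ennreal ((W t x)\<^sup>2) \<partial>tor) \<partial>tim T)"
  proof (rule nn_integral_cmult)
    have "(\<lambda>z. ennreal ((f z)\<^sup>2)) \<in> borel_measurable borel" by measurable
    from nn_integral_tor_measurable[OF this]
    show "(\<lambda>t. \<integral>\<^sup>+ x. ennreal ((W t x)\<^sup>2) \<partial>tor) \<in> borel_measurable (tim T)" by (simp add: f_def)
  qed
  also have "\<dots> < \<infinity>" using fin by (auto simp: ennreal_mult_less_top of_nat_less_top)
  finally have finR: "(\<integral>\<^sup>+ z. indicator ?R z * ennreal ((f z)\<^sup>2) \<partial>lborel) < \<infinity>" .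
  have bR: "bounded ?R" by (intro bounded_Times bounded_cbox) auto
  have Rfin: "emeasure lborel ?R < \<infinity>" by (rule emeasure_bounded_finite[OF bR])
  obtain g where g: "continuous_on UNIV g"
    "(\<integral>\<^sup>+ z. indicator ?R z * ennreal ((f z - g z)\<^sup>2) \<partial>lborel) < ennreal (\<epsilon> / 9)"
    by (rule square_integrable_approx_continuous[OF _ _ finR Rfin, of "\<epsilon> / 9"]) (use \<open>\<epsilon> > 0\<close> in auto)
  have [measurable]: "g \<in> borel_measurable borel" by (rule borel_measurable_continuous_onI[OF g(1)])
  \<comment> \<open>The three errors are each made at most a third of epsilon; the factor 3 below is that of the inequality for the square of a sum of three terms.\<close>
  define \<eta> where "\<eta> = sqrt (\<epsilon> / (9 * (T + 1)))"
  have \<eta>: "\<eta> > 0" using \<open>\<epsilon> > 0\<close> \<open>T \<ge> 0\<close> by (simp add: \<eta>_def)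
  have "3 * \<eta>\<^sup>2 * T = \<epsilon> / 3 * (T / (T + 1))" using \<open>\<epsilon> > 0\<close> \<open>T \<ge> 0\<close> by (simp add: \<eta>_def field_simps)
  also have "\<dots> \<le> \<epsilon> / 3 * 1" using \<open>\<epsilon> > 0\<close> \<open>T \<ge> 0\<close> by (intro mult_left_mono) auto
  finally have \<eta>T: "3 * \<eta>\<^sup>2 * T \<le> \<epsilon> / 3" by simp
  have "compact ?R" by (intro compact_Times compact_cbox) auto
  then have "uniformly_continuous_on ?R g"
    by (intro compact_uniformly_continuous continuous_on_subset[OF g(1)]) auto
  then obtain \<delta>0 where \<delta>0: "\<delta>0 > 0" "\<And>z w. z \<in> ?R \<Longrightarrow> w \<in> ?R \<Longrightarrow> dist w z < \<delta>0 \<Longrightarrow> dist (g w) (g z) < \<eta>"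
    using \<eta> unfolding uniformly_continuous_on_def by metis
  show thesis
  proof (rule that[of "min \<delta>0 1"])
    show "min \<delta>0 1 > 0" using \<delta>0 by simp
    fix y :: "real ^ 'n" assume y: "norm y < min \<delta>0 1"
    have inR: "x \<in> halfopen_cube 0 \<Longrightarrow> x \<in> big_box \<and> x - y \<in> big_box" "x + y \<in> halfopen_cube 0 \<Longrightarrow> x \<in> big_box" for x
    proof -
      have yi: "\<bar>y $ i\<bar> < 1" for i using y component_le_norm_cart[of y i] by simp
      show "x \<in> big_box \<and> x - y \<in> big_box" if "x \<in> halfopen_cube 0"
      proof -
        have "- 1 \<le> x $ i \<and> x $ i \<le> 2 \<and> - 1 \<le> x $ i - y $ i \<and> x $ i - y $ i \<le> 2" for i
        proof -
          have "0 \<le> x $ i \<and> x $ i < 1" using that by (simp add: halfopen_cube_def)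
          then show ?thesis using yi[of i] by linarith
        qed
        then show ?thesis by (simp add: mem_box_cart)
      qed
      show "x \<in> big_box" if "x + y \<in> halfopen_cube 0"
      proof -
        have "0 \<le> x $ i + y $ i \<and> x $ i + y $ i < 1" for i
          using that by (simp add: halfopen_cube_def)
        then have "- 1 \<le> x $ i \<and> x $ i \<le> 2" for i using yi[of i] by (smt (verit))
        then show ?thesis by (simp add: mem_box_cart)
      qed
    qed
    let ?s = "(0 :: real, y)"
    have pt: "ennreal ((W t x - W t (x - y))\<^sup>2)
      \<le> ennreal (3 * (f (t, x) - g (t, x))\<^sup>2) + ennreal (3 * \<eta>\<^sup>2) + ennreal (3 * (f ((t, x) - ?s) - g ((t, x) - ?s))\<^sup>2)"
      if "t \<in> {0..T}" "x \<in> halfopen_cube 0" for t x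
    proof -
      have "dist (g (t, x)) (g (t, x - y)) < \<eta>"
        using that inR(1)[of x] y by (intro \<delta>0(2)) (auto simp: dist_Pair_Pair dist_norm)
      then have "(g (t, x) - g (t, x - y))\<^sup>2 \<le> \<eta>\<^sup>2"
        using \<eta> by (simp add: dist_real_def abs_le_square_iff[symmetric])
      moreover have "(W t x - W t (x - y))\<^sup>2 \<le> 3 * ((f (t, x) - g (t, x))\<^sup>2
          + (g (t, x) - g (t, x - y))\<^sup>2 + (g (t, x - y) - f (t, x - y))\<^sup>2)"
        using square_sum3_le[of "f (t, x) - g (t, x)" "g (t, x) - g (t, x - y)" "g (t, x - y) - f (t, x - y)"]
        by (simp add: f_def)
      ultimately have "(W t x - W t (x - y))\<^sup>2
        \<le> 3 * (f (t, x) - g (t, x))\<^sup>2 + 3 * \<eta>\<^sup>2 + 3 * (f ((t, x) - ?s) - g ((t, x) - ?s))\<^sup>2"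
        by (simp add: power2_commute[of "g (t, x - y)"])
      then show ?thesis by (simp add: ennreal_leI flip: ennreal_plus)
    qed
    define G where "G z = ennreal (3 * (f z - g z)\<^sup>2)" for z
    have Gm [measurable]: "G \<in> borel_measurable borel" unfolding G_def by measurable
    have GR: "(\<integral>\<^sup>+ z. indicator ?R z * G z \<partial>lborel) \<le> ennreal (\<epsilon> / 3)"
    proof -
      have "(\<integral>\<^sup>+ z. indicator ?R z * G z \<partial>lborel) = (\<integral>\<^sup>+ z. 3 * (indicator ?R z * ennreal ((f z - g z)\<^sup>2)) \<partial>lborel)"
        by (rule nn_integral_cong) (auto simp: G_def indicator_def ennreal_mult)
      also have "\<dots> = 3 * (\<integral>\<^sup>+ z. indicator ?R z * ennreal ((f z - g z)\<^sup>2) \<partial>lborel)"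
        by (rule nn_integral_cmult) measurable
      also have "\<dots> \<le> 3 * ennreal (\<epsilon> / 9)" using g(2) by (intro mult_left_mono) auto
      also have "\<dots> = ennreal (3 * (\<epsilon> / 9))" by (subst ennreal_mult) (use \<open>\<epsilon> > 0\<close> in auto)
      finally show ?thesis by simp
    qed
    have iter: "(\<integral>\<^sup>+ t. \<integral>\<^sup>+ x. F (t, x) \<partial>tor \<partial>tim T) = (\<integral>\<^sup>+ z. indicator ?Q z * F z \<partial>lborel)"
      if "F \<in> borel_measurable borel" for F :: "real \<times> (real ^ 'n) \<Rightarrow> ennreal"
      unfolding nn_integral_tor by (rule nn_integral_spacetime[OF that]) simp
    have Gs [measurable]: "(\<lambda>z. G (z - ?s)) \<in> borel_measurable borel"
      by (rule measurable_compose[of "\<lambda>z. z - ?s" _ borel]) (auto intro!: borel_measurable_continuous_onI continuous_intros)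
    have T1: "(\<integral>\<^sup>+ t. \<integral>\<^sup>+ x. G (t, x) \<partial>tor \<partial>tim T) \<le> ennreal (\<epsilon> / 3)"
    proof -
      have "(\<integral>\<^sup>+ z. indicator ?Q z * G z \<partial>lborel) \<le> (\<integral>\<^sup>+ z. indicator ?R z * G z \<partial>lborel)"
        by (rule nn_integral_mono) (use inR(1) in \<open>auto simp: indicator_def\<close>)
      then show ?thesis using GR by (subst iter) auto
    qed
    have T3: "(\<integral>\<^sup>+ t. \<integral>\<^sup>+ x. G ((t, x) - ?s) \<partial>tor \<partial>tim T) \<le> ennreal (\<epsilon> / 3)"
    proof -
      have "(\<integral>\<^sup>+ z. indicator ?Q z * G (z - ?s) \<partial>lborel) = (\<integral>\<^sup>+ z. indicator ?Q ((z + - ?s) + ?s) * G (z + - ?s) \<partial>lborel)"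
        by (rule nn_integral_cong) (simp only: add.assoc left_minus add_0_right diff_conv_add_uminus)
      also have "\<dots> = (\<integral>\<^sup>+ z. indicator ?Q (z + ?s) * G z \<partial>lborel)"
      proof (rule nn_integral_lborel_shift)
        have "(\<lambda>z. indicator ?Q (z + ?s) :: ennreal) \<in> borel_measurable borel"
          by (rule measurable_compose[of "\<lambda>z. z + ?s" _ borel]) (auto intro!: borel_measurable_continuous_onI continuous_intros)
        then show "(\<lambda>z. indicator ?Q (z + ?s) * G z) \<in> borel_measurable borel" by measurable
      qed
      also have "\<dots> \<le> (\<integral>\<^sup>+ z. indicator ?R z * G z \<partial>lborel)"
        by (rule nn_integral_mono) (use inR(2) in \<open>auto simp: indicator_def\<close>)
      finally show ?thesis using GR by (subst iter) auto
    qed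
    have "(\<integral>\<^sup>+ t. \<integral>\<^sup>+ x. ennreal ((W t x - W t (x - y))\<^sup>2) \<partial>tor \<partial>tim T)
      \<le> (\<integral>\<^sup>+ t. \<integral>\<^sup>+ x. (G (t, x) + ennreal (3 * \<eta>\<^sup>2)) + G ((t, x) - ?s) \<partial>tor \<partial>tim T)"
      by (intro nn_integral_mono) (use pt in \<open>auto simp: G_def\<close>)
    also have "\<dots> = (\<integral>\<^sup>+ t. ((\<integral>\<^sup>+ x. G (t, x) \<partial>tor) + ennreal (3 * \<eta>\<^sup>2)) + (\<integral>\<^sup>+ x. G ((t, x) - ?s) \<partial>tor) \<partial>tim T)"
    proof (rule nn_integral_cong)
      fix t
      have [measurable]: "(\<lambda>x. G (t, x)) \<in> borel_measurable borel" "(\<lambda>x. G ((t, x) - ?s)) \<in> borel_measurable borel"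
        by (rule borel_measurable_section, measurable)+
      show "(\<integral>\<^sup>+ x. (G (t, x) + ennreal (3 * \<eta>\<^sup>2)) + G ((t, x) - ?s) \<partial>tor)
        = ((\<integral>\<^sup>+ x. G (t, x) \<partial>tor) + ennreal (3 * \<eta>\<^sup>2)) + (\<integral>\<^sup>+ x. G ((t, x) - ?s) \<partial>tor)"
        by (simp add: nn_integral_add)
    qed
    also have "\<dots> = (\<integral>\<^sup>+ t. \<integral>\<^sup>+ x. G (t, x) \<partial>tor \<partial>tim T) + ennreal (3 * \<eta>\<^sup>2) * ennreal T
        + (\<integral>\<^sup>+ t. \<integral>\<^sup>+ x. G ((t, x) - ?s) \<partial>tor \<partial>tim T)"
    proof -
      note m = nn_integral_tor_measurable[OF Gm, of T] nn_integral_tor_measurable[OF Gs, of T]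
      show ?thesis
        by (subst nn_integral_add[OF borel_measurable_add[OF m(1) borel_measurable_const] m(2)],
            subst nn_integral_add[OF m(1) borel_measurable_const])
          (simp add: emeasure_tim[OF \<open>T \<ge> 0\<close>])
    qed
    also have "\<dots> \<le> ennreal (\<epsilon> / 3) + ennreal (\<epsilon> / 3) + ennreal (\<epsilon> / 3)"
      using T1 T3 \<eta>T \<open>T \<ge> 0\<close> by (intro add_mono) (auto simp: ennreal_leI simp flip: ennreal_mult)
    also have "\<dots> = ennreal \<epsilon>" using \<open>\<epsilon> > 0\<close> by (simp flip: ennreal_plus)
    finally show "(\<integral>\<^sup>+ t. \<integral>\<^sup>+ x. ennreal ((W t x - W t (x - y))\<^sup>2) \<partial>tor \<partial>tim T) \<le> ennreal \<epsilon>" .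
  qed
qed

section \<open>Lebesgue norms and Hoelder's inequality\<close>

lemma ennreal_powr_measurable [measurable]: "(\<lambda>x. ennreal_powr x a) \<in> borel_measurable borel"
  unfolding ennreal_powr_def by measurable

lemma ennreal_powr_mono: "0 \<le> a \<Longrightarrow> x \<le> y \<Longrightarrow> ennreal_powr x a \<le> ennreal_powr y a"
  by (auto simp: ennreal_powr_def top_unique enn2real_mono less_top intro!: ennreal_leI powr_mono2)

lemma ennreal_powr_eq_0_iff: "ennreal_powr x a = 0 \<longleftrightarrow> x = 0"
  by (cases x) (auto simp: ennreal_powr_def ennreal_eq_0_iff)

lemma ennreal_powr_0 [simp]: "ennreal_powr 0 a = 0"
  by (simp add: ennreal_powr_def)

lemma ennreal_powr_eq_top_iff [simp]: "ennreal_powr x a = top \<longleftrightarrow> x = top"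
  by (simp add: ennreal_powr_def)

lemma ennreal_powr_tendsto_0:
  assumes "X \<longlonglongrightarrow> 0" "0 < a"
  shows "(\<lambda>n. ennreal_powr (X n) a) \<longlonglongrightarrow> 0"
proof -
  have "\<forall>\<^sub>F n in sequentially. X n < top" using assms(1) by (rule order_tendstoD) simp
  moreover have "(\<lambda>n. enn2real (X n)) \<longlonglongrightarrow> 0" by (rule tendsto_enn2real) (use assms(1) in auto)
  then have "(\<lambda>n. ennreal (enn2real (X n) powr a)) \<longlonglongrightarrow> ennreal 0"
    using assms(2) by (intro tendsto_ennrealI tendsto_zero_powrI[where b = a]) auto
  ultimately show ?thesis
    by (auto elim!: Lim_transform_eventually eventually_mono simp: ennreal_powr_def)
qed

lemma Lp_norm_finite_exponent:
  "p \<noteq> \<infinity> \<Longrightarrow> Lp_norm M p g = ennreal_powr (\<integral>\<^sup>+ x. ennreal_powr (g x) (enn2real p) \<partial>M) (1 / enn2real p)"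
  by (simp add: Lp_norm_def)

lemma finite_exponent_ge_1: "1 \<le> p \<Longrightarrow> p \<noteq> \<infinity> \<Longrightarrow> 1 \<le> enn2real p"
  by (cases p) auto

lemma enn2real_one_divide: "1 \<le> p \<Longrightarrow> p \<noteq> \<infinity> \<Longrightarrow> enn2real (1 / p) = 1 / enn2real p"
  by (cases p) (auto simp: divide_ennreal simp flip: ennreal_1)

lemma Lp_norm_mono:
  assumes "1 \<le> p" "f \<in> borel_measurable M" "AE x in M. f x \<le> g x"
  shows "Lp_norm M p f \<le> Lp_norm M p g"
proof (cases "p = \<infinity>")
  case True then show ?thesis using assms by (simp add: Lp_norm_def esssup_AE_mono)
next
  case False
  define r where "r = enn2real p"
  have r: "1 \<le> r"
    "\<And>g. Lp_norm M p g = ennreal_powr (\<integral>\<^sup>+ x. ennreal_powr (g x) r \<partial>M) (1 / r)"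
    using finite_exponent_ge_1[OF assms(1) False] enn2real_one_divide[OF assms(1) False]
    by (simp_all add: r_def Lp_norm_finite_exponent[OF False])
  show ?thesis unfolding r(2)
  proof (intro ennreal_powr_mono nn_integral_mono_AE)
    show "AE x in M. ennreal_powr (f x) r \<le> ennreal_powr (g x) r"
      using assms(3) by eventually_elim (rule ennreal_powr_mono, use r(1) in auto)
  qed (use r(1) in simp)
qed

lemma AE_zero_if_Lp_norm_zero:
  assumes "1 \<le> p" and [measurable]: "g \<in> borel_measurable M" and "Lp_norm M p g = 0"
  shows "AE x in M. g x = 0"
proof (cases "p = \<infinity>")
  case True
  then show ?thesis using esssup_AE[of g M] assms(3) by (simp add: Lp_norm_def)
next
  case False
  define r where "r = enn2real p"
  have r: "1 \<le> r"
    "\<And>g. Lp_norm M p g = ennreal_powr (\<integral>\<^sup>+ x. ennreal_powr (g x) r \<partial>M) (1 / r)"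
    using finite_exponent_ge_1[OF assms(1) False] enn2real_one_divide[OF assms(1) False]
    by (simp_all add: r_def Lp_norm_finite_exponent[OF False])
  then have "(\<integral>\<^sup>+ x. ennreal_powr (g x) r \<partial>M) = 0"
    using assms(3) by (simp add: ennreal_powr_eq_0_iff)
  then show ?thesis by (subst (asm) nn_integral_0_iff_AE) (auto simp: ennreal_powr_eq_0_iff)
qed

text \<open>
  A form of the statement that \<open>g\<close> has the given norm that is uniform in the exponent: up to the norm,
  \<open>g\<close> is bounded by the power \<open>1/p\<close> of a function of integral at most one. For infinite \<open>p\<close> the
  power is zero and the bound is the essential one.
\<close>

lemma Lp_norm_level_function:
  assumes "1 \<le> p" and [measurable]: "g \<in> borel_measurable M"
    and N: "0 < Lp_norm M p g" "Lp_norm M p g < \<infinity>"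
  obtains u where "u \<in> borel_measurable M" "(\<integral>\<^sup>+ x. u x \<partial>M) \<le> 1"
    "AE x in M. g x \<le> Lp_norm M p g * ennreal (max 1 (enn2real (u x)) powr enn2real (1 / p))"
proof (cases "p = \<infinity>")
  case True
  show thesis
    by (rule that[of "\<lambda>_. 0"]) (use esssup_AE[of g M] True in \<open>auto simp: Lp_norm_def\<close>)
next
  case False
  define r where "r = enn2real p"
  have r: "1 \<le> r" "enn2real (1 / p) = 1 / r"
    "\<And>g. Lp_norm M p g = ennreal_powr (\<integral>\<^sup>+ x. ennreal_powr (g x) r \<partial>M) (1 / r)"
    using finite_exponent_ge_1[OF assms(1) False] enn2real_one_divide[OF assms(1) False]
    by (simp_all add: r_def Lp_norm_finite_exponent[OF False])
  define I where "I = (\<integral>\<^sup>+ x. ennreal_powr (g x) r \<partial>M)"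
  have "I \<noteq> 0" "I \<noteq> top" using N unfolding r(3) I_def[symmetric] by (auto simp: ennreal_powr_eq_top_iff[THEN iffD2])
  then obtain i where i: "I = ennreal i" "0 < i" by (cases I) (auto simp: zero_less_iff_neq_zero less_le)
  have Ni: "Lp_norm M p g = ennreal (i powr (1 / r))"
    unfolding r(3) I_def[symmetric] using i by (simp add: ennreal_powr_def)
  show thesis
  proof (rule that[of "\<lambda>x. ennreal_powr (g x) r * ennreal (1 / i)"])
    have "(\<integral>\<^sup>+ x. ennreal_powr (g x) r * ennreal (1 / i) \<partial>M) = I * ennreal (1 / i)"
      unfolding I_def by (rule nn_integral_multc) measurable
    also have "\<dots> = 1" using i by (simp flip: ennreal_mult)
    finally show "(\<integral>\<^sup>+ x. ennreal_powr (g x) r * ennreal (1 / i) \<partial>M) \<le> 1" by simp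
    have "AE x in M. ennreal_powr (g x) r \<noteq> \<infinity>"
      by (rule nn_integral_PInf_AE) (use \<open>I \<noteq> top\<close> in \<open>auto simp: I_def\<close>)
    then show "AE x in M. g x \<le> Lp_norm M p g *
        ennreal (max 1 (enn2real (ennreal_powr (g x) r * ennreal (1 / i))) powr enn2real (1 / p))"
    proof eventually_elim
      case (elim x)
      then obtain s where s: "g x = ennreal s" "0 \<le> s" by (cases "g x") auto
      have "s = i powr (1 / r) * ((s powr r / i) powr (1 / r))"
        using s i r(1) by (simp add: powr_divide powr_powr)
      also have "\<dots> \<le> i powr (1 / r) * (max 1 (s powr r / i) powr (1 / r))"
        using r(1) i by (intro mult_left_mono powr_mono2) auto
      finally have "s \<le> i powr (1 / r) * (max 1 (s powr r / i) powr (1 / r))" .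
      then show ?case
        unfolding Ni r(2) using s i
        by (simp add: ennreal_powr_def enn2real_mult flip: ennreal_mult)
    qed
  qed measurable
qed

text \<open>
  The exponents satisfy an inequality only, and may be infinite. With level functions \<open>u\<close> and \<open>v\<close> for
  \<open>g\<close> and \<open>f\<close> and \<open>Z = max 1 (max u v)\<close>, the normalised product is at most
  \<open>Z powr (1/p + 1/q)\<close>, hence its square is at most \<open>Z\<close>, whose integral is at most 3. This
  replaces a case distinction at the cost of the constant.
\<close>

lemma Hoelder_square:
  assumes "prob_space M" "1 \<le> p" "1 \<le> q" "1 / p + 1 / q \<le> 1 / (2 :: ennreal)"
    and [measurable]: "g \<in> borel_measurable M" "f \<in> borel_measurable M"
  shows "(\<integral>\<^sup>+ x. (g x)\<^sup>2 * (f x)\<^sup>2 \<partial>M) \<le> 3 * (Lp_norm M p g)\<^sup>2 * (Lp_norm M q f)\<^sup>2"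
proof -
  interpret prob_space M by fact
  let ?P = "Lp_norm M p g" and ?Q = "Lp_norm M q f"
  consider "?P = 0 \<or> ?Q = 0" | "?P \<noteq> 0" "?Q \<noteq> 0" "?P = top \<or> ?Q = top"
    | "0 < ?P" "?P < \<infinity>" "0 < ?Q" "?Q < \<infinity>"
    by (auto simp: zero_less_iff_neq_zero less_top[symmetric])
  then show ?thesis
  proof cases
    case 1
    then have "AE x in M. (g x)\<^sup>2 * (f x)\<^sup>2 = 0"
      using AE_zero_if_Lp_norm_zero[OF assms(2), of g M] AE_zero_if_Lp_norm_zero[OF assms(3), of f M]
      by (elim disjE) auto
    then have "(\<integral>\<^sup>+ x. (g x)\<^sup>2 * (f x)\<^sup>2 \<partial>M) = (\<integral>\<^sup>+ x. 0 \<partial>M)" by (rule nn_integral_cong_AE)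
    then show ?thesis by simp
  next
    case 2
    then show ?thesis by (auto simp: ennreal_mult_top ennreal_top_mult power2_eq_square)
  next
    case 3
    define a b where "a = enn2real (1 / p)" and "b = enn2real (1 / q)"
    have fin: "1 / p < top" "1 / q < top"
      using assms(4) by (auto simp: less_top[symmetric] top_unique ennreal_divide_eq_top_iff)
    have ab: "a + b \<le> 1 / 2"
    proof -
      have "ennreal (a + b) \<le> ennreal (1 / 2)"
        using assms(4) fin by (simp add: a_def b_def divide_ennreal[of 1 2, simplified, symmetric])
      then show ?thesis by (subst (asm) ennreal_le_iff) auto
    qed
    have ab0: "0 \<le> a" "0 \<le> b" by (auto simp: a_def b_def)
    obtain u where u[measurable]: "u \<in> borel_measurable M" and u1: "(\<integral>\<^sup>+ x. u x \<partial>M) \<le> 1"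
      and gu: "AE x in M. g x \<le> ?P * ennreal (max 1 (enn2real (u x)) powr a)"
      unfolding a_def by (rule Lp_norm_level_function[OF assms(2) assms(5) 3(1,2)])
    obtain v where v[measurable]: "v \<in> borel_measurable M" and v1: "(\<integral>\<^sup>+ x. v x \<partial>M) \<le> 1"
      and fv: "AE x in M. f x \<le> ?Q * ennreal (max 1 (enn2real (v x)) powr b)"
      unfolding b_def by (rule Lp_norm_level_function[OF assms(3) assms(6) 3(3,4)])
    have "AE x in M. (g x)\<^sup>2 * (f x)\<^sup>2 \<le> ?P\<^sup>2 * ?Q\<^sup>2 * (1 + u x + v x)"
      using gu fv
    proof eventually_elim
      case (elim x)
      define Z where "Z = max 1 (max (enn2real (u x)) (enn2real (v x)))"
      have Z: "1 \<le> Z" by (simp add: Z_def)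
      have "max 1 (enn2real (u x)) powr a * (max 1 (enn2real (v x)) powr b) \<le> Z powr a * Z powr b"
        using ab0 by (intro mult_mono powr_mono2) (auto simp: Z_def)
      also have "\<dots> = Z powr (a + b)" by (simp add: powr_add)
      also have "\<dots> \<le> Z powr (1 / 2)" using Z ab by (intro powr_mono) auto
      finally have "(max 1 (enn2real (u x)) powr a * (max 1 (enn2real (v x)) powr b))\<^sup>2 \<le> (Z powr (1 / 2))\<^sup>2"
        by (intro power_mono) auto
      also have "\<dots> = Z" using Z by (simp add: powr_half_sqrt)
      finally have sq: "(max 1 (enn2real (u x)) powr a * (max 1 (enn2real (v x)) powr b))\<^sup>2 \<le> Z" .
      have "ennreal Z \<le> ennreal (1 + enn2real (u x) + enn2real (v x))"
        by (intro ennreal_leI) (auto simp: Z_def)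
      also have "\<dots> \<le> 1 + u x + v x"
        by (simp add: ennreal_plus) (intro add_mono order_refl; simp add: ennreal_enn2real_if)
      finally have Zle: "ennreal Z \<le> 1 + u x + v x" .
      have "(g x)\<^sup>2 * (f x)\<^sup>2 \<le> (?P * ennreal (max 1 (enn2real (u x)) powr a))\<^sup>2 * (?Q * ennreal (max 1 (enn2real (v x)) powr b))\<^sup>2"
        using elim by (intro mult_mono power_mono) auto
      also have "\<dots> = ?P\<^sup>2 * ?Q\<^sup>2 * ennreal ((max 1 (enn2real (u x)) powr a * (max 1 (enn2real (v x)) powr b))\<^sup>2)"
        by (simp add: power_mult_distrib ennreal_power ennreal_mult mult.assoc mult.left_commute flip: ennreal_power)
      also have "\<dots> \<le> ?P\<^sup>2 * ?Q\<^sup>2 * ennreal Z"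
        by (intro mult_left_mono ennreal_leI sq) auto
      also have "\<dots> \<le> ?P\<^sup>2 * ?Q\<^sup>2 * (1 + u x + v x)"
        by (intro mult_left_mono Zle) auto
      finally show ?case .
    qed
    then have "(\<integral>\<^sup>+ x. (g x)\<^sup>2 * (f x)\<^sup>2 \<partial>M) \<le> (\<integral>\<^sup>+ x. ?P\<^sup>2 * ?Q\<^sup>2 * (1 + u x + v x) \<partial>M)"
      by (rule nn_integral_mono_AE)
    also have "\<dots> = ?P\<^sup>2 * ?Q\<^sup>2 * (1 + (\<integral>\<^sup>+ x. u x \<partial>M) + (\<integral>\<^sup>+ x. v x \<partial>M))"
      by (simp add: nn_integral_cmult nn_integral_add emeasure_space_1)
    also have "\<dots> \<le> ?P\<^sup>2 * ?Q\<^sup>2 * (1 + 1 + 1)"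
      by (intro mult_left_mono add_mono u1 v1) auto
    finally show ?thesis by (simp add: mult.commute mult.left_commute)
  qed
qed

lemma Lp_norm_one:
  assumes "prob_space M" "1 \<le> p"
  shows "Lp_norm M p (\<lambda>_. 1) = 1"
proof -
  interpret prob_space M by fact
  show ?thesis
  proof (cases "p = \<infinity>")
    case False
    then show ?thesis by (simp add: Lp_norm_finite_exponent ennreal_powr_def emeasure_space_1)
  qed (simp add: Lp_norm_def esssup_const emeasure_space_1)
qed

lemma AE_tor_shift:
  assumes "Measurable.pred borel P" "lattice_periodic P"
  shows "(AE x in tor. P (x + a)) \<longleftrightarrow> (AE x in tor. P x)"
proof -
  note [measurable] = assms(1)
  have "(AE x in tor. P x) \<longleftrightarrow> (\<integral>\<^sup>+ x. of_bool (\<not> P x) \<partial>tor) = 0"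
    by (subst nn_integral_0_iff_AE) auto
  moreover have "(AE x in tor. P (x + a)) \<longleftrightarrow> (\<integral>\<^sup>+ x. of_bool (\<not> P (x + a)) \<partial>tor) = 0"
    by (subst nn_integral_0_iff_AE) auto
  moreover have "(\<integral>\<^sup>+ x. of_bool (\<not> P (x + a)) \<partial>tor) = (\<integral>\<^sup>+ x. of_bool (\<not> P x) \<partial>tor)"
    by (rule nn_integral_tor_shift[of "\<lambda>x. of_bool (\<not> P x)"])
      (auto simp: lattice_periodic_def lattice_periodicD[OF assms(2)])
  ultimately show ?thesis by simp
qed

lemma Lp_norm_tor_shift:
  fixes g :: "real ^ 'n \<Rightarrow> ennreal"
  assumes "1 \<le> p" and [measurable]: "g \<in> borel_measurable borel" and g: "lattice_periodic g"
  shows "Lp_norm tor p (\<lambda>x. g (x + a)) = Lp_norm tor p g"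
proof (cases "p = \<infinity>")
  case True
  have "(AE x in tor. g (x + a) \<le> z) \<longleftrightarrow> (AE x in tor. g x \<le> z)" for z
    by (rule AE_tor_shift[of "\<lambda>x. g x \<le> z"]) (auto simp: lattice_periodic_def lattice_periodicD[OF g])
  then show ?thesis using True by (simp add: Lp_norm_def esssup_eq_AE)
next
  case False
  define r where "r = enn2real p"
  have r: "\<And>g :: real ^ 'n \<Rightarrow> ennreal. Lp_norm tor p g = ennreal_powr (\<integral>\<^sup>+ x. ennreal_powr (g x) r \<partial>tor) (1 / r)"
    using finite_exponent_ge_1[OF assms(1) False] enn2real_one_divide[OF assms(1) False]
    by (simp_all add: r_def Lp_norm_finite_exponent[OF False])
  have "(\<integral>\<^sup>+ x. ennreal_powr (g (x + a)) r \<partial>tor) = (\<integral>\<^sup>+ x. ennreal_powr (g x) r \<partial>tor)"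
    by (rule nn_integral_tor_shift[of "\<lambda>x. ennreal_powr (g x) r"]) (auto simp: lattice_periodic_def lattice_periodicD[OF g])
  then show ?thesis unfolding r by simp
qed

definition tail :: "nat \<Rightarrow> ennreal \<Rightarrow> ennreal" where
  "tail m s = (if s \<le> of_nat m then 0 else s)"

lemma tail_measurable [measurable]: "tail m \<in> borel_measurable borel"
  unfolding tail_def[abs_def] by measurable

lemma tail_le: "tail m s \<le> s"
  by (simp add: tail_def)

lemma tail_eventually_0: "s < top \<Longrightarrow> \<forall>\<^sub>F m in sequentially. tail m s = 0"
proof -
  assume "s < top"
  then obtain m0 where "s < of_nat m0" using ennreal_Ex_less_of_nat by auto
  show ?thesis
    using eventually_ge_at_top[of m0]
  proof eventually_elim
    case (elim m)
    have "s \<le> of_nat m0" using \<open>s < of_nat m0\<close> by simp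
    also have "\<dots> \<le> (of_nat m :: ennreal)" using elim by (rule of_nat_mono)
    finally show ?case by (simp add: tail_def)
  qed
qed

text \<open>
  For infinite \<open>p\<close> the tail is eventually zero almost everywhere, and for finite \<open>p\<close> dominated
  convergence applies.
\<close>

lemma Lp_norm_tail_tendsto_0:
  assumes "1 \<le> p" and [measurable]: "g \<in> borel_measurable M" and "Lp_norm M p g < \<infinity>"
  shows "(\<lambda>m. Lp_norm M p (\<lambda>x. tail m (g x))) \<longlonglongrightarrow> 0"
proof (cases "p = \<infinity>")
  case True
  have "\<forall>\<^sub>F m in sequentially. tail m (esssup M g) = 0"
    using assms(3) True by (intro tail_eventually_0) (simp add: Lp_norm_def)
  then have "\<forall>\<^sub>F m in sequentially. Lp_norm M p (\<lambda>x. tail m (g x)) = 0"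
  proof eventually_elim
    case (elim m)
    have "AE x in M. tail m (g x) \<le> 0"
      using esssup_AE[of g M]
    proof eventually_elim
      case (elim x)
      then show ?case using \<open>tail m (esssup M g) = 0\<close> by (auto simp: tail_def split: if_splits)
    qed
    then have "esssup M (\<lambda>x. tail m (g x)) \<le> 0" by (intro esssup_I) auto
    then show ?case using True by (simp add: Lp_norm_def)
  qed
  then show ?thesis by (rule tendsto_eventually)
next
  case False
  define r where "r = enn2real p"
  have r: "1 \<le> r"
    "\<And>g. Lp_norm M p g = ennreal_powr (\<integral>\<^sup>+ x. ennreal_powr (g x) r \<partial>M) (1 / r)"
    using finite_exponent_ge_1[OF assms(1) False] enn2real_one_divide[OF assms(1) False]
    by (simp_all add: r_def Lp_norm_finite_exponent[OF False])
  have fin: "(\<integral>\<^sup>+ x. ennreal_powr (g x) r \<partial>M) < \<infinity>"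
    using assms(3) unfolding r(2) by (auto simp: less_top[symmetric])
  have "AE x in M. ennreal_powr (g x) r \<noteq> \<infinity>"
    by (rule nn_integral_PInf_AE) (use fin in auto)
  then have AE: "AE x in M. g x < top" by (auto simp: less_top)
  have "(\<lambda>m. \<integral>\<^sup>+ x. ennreal_powr (tail m (g x)) r \<partial>M) \<longlonglongrightarrow> (\<integral>\<^sup>+ x. 0 \<partial>M)"
  proof (rule nn_integral_dominated_convergence[OF _ _ _ _ fin])
    show "AE x in M. ennreal_powr (tail m (g x)) r \<le> ennreal_powr (g x) r" for m
      using r(1) by (intro AE_I2 ennreal_powr_mono tail_le) auto
    show "AE x in M. (\<lambda>m. ennreal_powr (tail m (g x)) r) \<longlonglongrightarrow> 0"
      using AE
    proof eventually_elim
      case (elim x)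
      show ?case
        by (rule tendsto_eventually, use tail_eventually_0[OF elim] in eventually_elim)
          (simp add: ennreal_powr_eq_0_iff)
    qed
  qed measurable
  then show ?thesis unfolding r(2) using r(1) by (intro ennreal_powr_tendsto_0) auto
qed

lemma Lp_norm_tor_measurable:
  fixes F :: "real \<times> (real ^ 'n) \<Rightarrow> ennreal"
  assumes [measurable]: "F \<in> borel_measurable borel" and "1 \<le> p"
  shows "(\<lambda>t. Lp_norm tor p (\<lambda>x. F (t, x))) \<in> borel_measurable (tim T)"
proof (cases "p = \<infinity>")
  case True
  show ?thesis
  proof (rule borel_measurableI_greater)
    fix z
    have sec[measurable]: "(\<lambda>x. F (t, x)) \<in> borel_measurable borel" for t
      by (rule borel_measurable_section) fact
    have eq: "z < Lp_norm tor p (\<lambda>x. F (t, x)) \<longleftrightarrow> (\<integral>\<^sup>+ x. indicator {z<..} (F (t, x)) \<partial>tor) \<noteq> 0" for t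
    proof -
      have "z < esssup tor (\<lambda>x. F (t, x)) \<longleftrightarrow> \<not> (AE x in tor. F (t, x) \<le> z)"
      proof
        assume "z < esssup tor (\<lambda>x. F (t, x))"
        then show "\<not> (AE x in tor. F (t, x) \<le> z)"
          using esssup_I[of "\<lambda>x. F (t, x)" tor z] by (auto simp: not_le[symmetric])
      next
        assume *: "\<not> (AE x in tor. F (t, x) \<le> z)"
        show "z < esssup tor (\<lambda>x. F (t, x))"
        proof (rule ccontr)
          assume "\<not> z < esssup tor (\<lambda>x. F (t, x))"
          then have "AE x in tor. F (t, x) \<le> z"
            using esssup_AE[of "\<lambda>x. F (t, x)" tor] by (auto elim!: eventually_mono)
          with * show False by simp
        qed
      qed
      also have "\<dots> \<longleftrightarrow> (\<integral>\<^sup>+ x. indicator {z<..} (F (t, x)) \<partial>tor) \<noteq> 0"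
        by (subst nn_integral_0_iff_AE) (auto simp: indicator_def not_less)
      finally show ?thesis using True by (simp add: Lp_norm_def)
    qed
    have [measurable]: "(\<lambda>t. \<integral>\<^sup>+ x. indicator {z<..} (F (t, x)) \<partial>tor) \<in> borel_measurable (tim T)"
      by (rule nn_integral_tor_measurable[of "\<lambda>z'. indicator {z<..} (F z')"]) measurable
    have "{t \<in> space (tim T). (\<integral>\<^sup>+ x. indicator {z<..} (F (t, x)) \<partial>tor) \<noteq> (0 :: ennreal)} \<in> sets (tim T)"
      by measurable
    then show "{t \<in> space (tim T). z < Lp_norm tor p (\<lambda>x. F (t, x))} \<in> sets (tim T)"
      by (simp only: eq)
  qed
next
  case False
  define r where "r = enn2real p"
  have r: "\<And>g :: real ^ 'n \<Rightarrow> ennreal. Lp_norm tor p g = ennreal_powr (\<integral>\<^sup>+ x. ennreal_powr (g x) r \<partial>tor) (1 / r)"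
    using finite_exponent_ge_1[OF assms(2) False] enn2real_one_divide[OF assms(2) False]
    by (simp_all add: r_def Lp_norm_finite_exponent[OF False])
  have [measurable]: "(\<lambda>t. \<integral>\<^sup>+ x. ennreal_powr (F (t, x)) r \<partial>tor) \<in> borel_measurable (tim T)"
    by (rule nn_integral_tor_measurable[of "\<lambda>z. ennreal_powr (F z) r"]) measurable
  show ?thesis unfolding r by measurable
qed

text \<open>
  For infinite \<open>p\<close> the level above which the tail vanishes depends on time, so this needs dominated
  convergence in time.
\<close>

lemma Lp_norm_tail_time_tendsto_0:
  fixes F :: "real \<times> (real ^ 'n) \<Rightarrow> ennreal"
  assumes F[measurable]: "F \<in> borel_measurable borel" and "1 \<le> p"
    and fin: "(\<integral>\<^sup>+ t. (Lp_norm tor p (\<lambda>x. F (t, x)))\<^sup>2 \<partial>tim T) < \<infinity>"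
  shows "(\<lambda>m. \<integral>\<^sup>+ t. (Lp_norm tor p (\<lambda>x. tail m (F (t, x))))\<^sup>2 \<partial>tim T) \<longlonglongrightarrow> 0"
proof -
  have sec[measurable]: "(\<lambda>x. F (t, x)) \<in> borel_measurable borel" for t
    by (rule borel_measurable_section) fact
  have m1[measurable]: "(\<lambda>t. Lp_norm tor p (\<lambda>x. F (t, x))) \<in> borel_measurable (tim T)"
    by (rule Lp_norm_tor_measurable) fact+
  have m2[measurable]: "(\<lambda>t. Lp_norm tor p (\<lambda>x. tail m (F (t, x)))) \<in> borel_measurable (tim T)" for m
    by (rule Lp_norm_tor_measurable[of "\<lambda>z. tail m (F z)"]) (use assms(2) in measurable)
  have "AE t in tim T. (Lp_norm tor p (\<lambda>x. F (t, x)))\<^sup>2 \<noteq> \<infinity>"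
    by (rule nn_integral_PInf_AE) (use fin in auto)
  then have AE: "AE t in tim T. Lp_norm tor p (\<lambda>x. F (t, x)) < \<infinity>"
    by eventually_elim (auto simp: power2_eq_square ennreal_top_mult less_top[symmetric])
  have "(\<lambda>m. \<integral>\<^sup>+ t. (Lp_norm tor p (\<lambda>x. tail m (F (t, x))))\<^sup>2 \<partial>tim T) \<longlonglongrightarrow> (\<integral>\<^sup>+ t. 0 \<partial>tim T)"
  proof (rule nn_integral_dominated_convergence[OF _ _ _ _ fin])
    show "AE t in tim T. (Lp_norm tor p (\<lambda>x. tail m (F (t, x))))\<^sup>2 \<le> (Lp_norm tor p (\<lambda>x. F (t, x)))\<^sup>2" for m
      by (intro AE_I2 power_mono Lp_norm_mono[OF assms(2)]) (auto intro: tail_le)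
    show "AE t in tim T. (\<lambda>m. (Lp_norm tor p (\<lambda>x. tail m (F (t, x))))\<^sup>2) \<longlonglongrightarrow> 0"
      using AE
    proof eventually_elim
      case (elim t)
      have lim: "(\<lambda>m. Lp_norm tor p (\<lambda>x. tail m (F (t, x)))) \<longlonglongrightarrow> 0"
        by (rule Lp_norm_tail_tendsto_0[OF assms(2) _ elim]) measurable
      show ?case
        unfolding power2_eq_square using tendsto_mult_ennreal[OF lim lim] by simp
    qed
  qed measurable
  then show ?thesis by simp
qed

section \<open>The commutator of smoothing and advection\<close>

text \<open>
  Near the origin \<open>\<Psi>\<close> is small and the kernel has mass one; elsewhere \<open>\<Psi>\<close> is bounded and the mass of
  the kernel tends to zero.
\<close>

lemma nn_integral_kernel_vanishes:
  fixes \<Psi> :: "real ^ 'n \<Rightarrow> ennreal"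
  assumes [measurable]: "\<Psi> \<in> borel_measurable borel" and C: "\<And>y. \<Psi> y \<le> C" "C < \<infinity>"
    and small: "\<And>\<epsilon>. 0 < \<epsilon> \<Longrightarrow> \<exists>\<delta>>0. \<forall>y. norm y < \<delta> \<longrightarrow> \<Psi> y \<le> ennreal \<epsilon>"
  shows "(\<lambda>N. \<integral>\<^sup>+ z. indicator centered_cube z * ennreal (peak_kernel N z) * \<Psi> z \<partial>lborel) \<longlonglongrightarrow> 0"
proof (rule tendsto_0_if_Limsup_eq_0_ennreal, rule antisym, rule ennreal_le_epsilon)
  fix \<epsilon> :: real assume "0 < \<epsilon>"
  obtain \<delta> where \<delta>: "\<delta> > 0" "\<And>y. norm y < \<delta> \<Longrightarrow> \<Psi> y \<le> ennreal \<epsilon>" using small[OF \<open>0 < \<epsilon>\<close>] by blast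
  let ?tail = "\<lambda>N. \<integral>\<^sup>+ z. indicator (centered_cube - ball 0 \<delta>) z * ennreal (peak_kernel N z) \<partial>(lborel :: (real ^ 'n) measure)"
  have bound: "(\<integral>\<^sup>+ z. indicator centered_cube z * ennreal (peak_kernel N z) * \<Psi> z \<partial>lborel) \<le> ennreal \<epsilon> + C * ?tail N" for N
  proof -
    have "(\<integral>\<^sup>+ z. indicator centered_cube z * ennreal (peak_kernel N z) * \<Psi> z \<partial>lborel)
        \<le> (\<integral>\<^sup>+ z. ennreal \<epsilon> * (indicator centered_cube z * ennreal (peak_kernel N z))
            + C * (indicator (centered_cube - ball 0 \<delta>) z * ennreal (peak_kernel N z)) \<partial>(lborel :: (real ^ 'n) measure))"
    proof (rule nn_integral_mono)
      fix z :: "real ^ 'n"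
      show "indicator centered_cube z * ennreal (peak_kernel N z) * \<Psi> z
        \<le> ennreal \<epsilon> * (indicator centered_cube z * ennreal (peak_kernel N z))
            + C * (indicator (centered_cube - ball 0 \<delta>) z * ennreal (peak_kernel N z))"
      proof (cases "norm z < \<delta>")
        case True
        then have "indicator centered_cube z * ennreal (peak_kernel N z) * \<Psi> z
            \<le> indicator centered_cube z * ennreal (peak_kernel N z) * ennreal \<epsilon>"
          by (intro mult_left_mono \<delta>(2)) auto
        then show ?thesis by (simp add: mult.commute add_increasing2)
      next
        case False
        have "indicator centered_cube z * ennreal (peak_kernel N z) * \<Psi> z
            \<le> indicator centered_cube z * ennreal (peak_kernel N z) * C"
          by (intro mult_left_mono C(1)) auto
        also have "\<dots> = C * (indicator (centered_cube - ball 0 \<delta>) z * ennreal (peak_kernel N z))"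
          using False by (auto simp: indicator_def mult.commute)
        finally show ?thesis by (simp add: add_increasing)
      qed
    qed
    also have "\<dots> = ennreal \<epsilon> * 1 + C * ?tail N"
    proof -
      have [measurable]: "centered_cube - ball 0 \<delta> \<in> sets (borel :: (real ^ 'n) measure)"
        by (intro sets.Diff) auto
      have m: "(\<lambda>z :: real ^ 'n. indicator centered_cube z * ennreal (peak_kernel N z)) \<in> borel_measurable lborel"
        "(\<lambda>z :: real ^ 'n. indicator (centered_cube - ball 0 \<delta>) z * ennreal (peak_kernel N z)) \<in> borel_measurable lborel"
        by measurable
      show ?thesis
        by (subst nn_integral_add[OF borel_measurable_times_ennreal[OF borel_measurable_const m(1)]
              borel_measurable_times_ennreal[OF borel_measurable_const m(2)]],
            subst nn_integral_cmult[OF m(1)], subst nn_integral_cmult[OF m(2)])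
          (simp add: nn_integral_kernel)
    qed
    finally show ?thesis by simp
  qed
  have "(\<lambda>N. ennreal \<epsilon> + C * ?tail N) \<longlonglongrightarrow> ennreal \<epsilon> + C * 0"
    using C(2) by (intro tendsto_add tendsto_const ennreal_tendsto_cmult kernel_concentrates \<delta>(1)) auto
  then have "limsup (\<lambda>N. ennreal \<epsilon> + C * ?tail N) = ennreal \<epsilon>"
    by (simp add: lim_imp_Limsup)
  moreover have "limsup (\<lambda>N. \<integral>\<^sup>+ z. indicator centered_cube z * ennreal (peak_kernel N z) * \<Psi> z \<partial>lborel)
      \<le> limsup (\<lambda>N. ennreal \<epsilon> + C * ?tail N)"
    by (rule Limsup_mono) (simp add: bound)
  ultimately show "limsup (\<lambda>N. \<integral>\<^sup>+ z. indicator centered_cube z * ennreal (peak_kernel N z) * \<Psi> z \<partial>lborel) \<le> 0 + ennreal \<epsilon>"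
    by simp
qed simp

definition smoothing :: "nat \<Rightarrow> (real ^ 'n \<Rightarrow> real) \<Rightarrow> real ^ 'n \<Rightarrow> real" where
  "smoothing N w x = (LINT y|tor. peak_kernel N (x - y) * w y)"

lemma peak_kernel_le: "peak_kernel N (x :: real ^ 'n) \<le> 1 / peak_mass TYPE('n) N"
  using peak_mass_pos[where 'n = 'n, of N] by (simp add: peak_kernel_def peak_range power_le_one divide_right_mono)

lemma integrable_kernel_times:
  assumes "integrable tor w"
  shows "integrable tor (\<lambda>y :: real ^ 'n. peak_kernel N (x - y) * w y)"
proof (rule Bochner_Integration.integrable_bound)
  show "integrable tor (\<lambda>y. (1 / peak_mass TYPE('n) N) * w y)" using assms by simp
  have "(\<lambda>y. peak_kernel N (x - y)) \<in> borel_measurable borel" by measurable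
  then have "(\<lambda>y. peak_kernel N (x - y)) \<in> borel_measurable tor" by (rule measurable_torI)
  then show "(\<lambda>y. peak_kernel N (x - y) * w y) \<in> borel_measurable tor"
    using assms by (intro borel_measurable_times) auto
  show "AE y in tor. norm (peak_kernel N (x - y) * w y) \<le> norm ((1 / peak_mass TYPE('n) N) * w y)"
  proof (rule AE_I2)
    fix y
    have "peak_kernel N (x - y) * \<bar>w y\<bar> \<le> (1 / peak_mass TYPE('n) N) * \<bar>w y\<bar>"
      by (intro mult_right_mono peak_kernel_le) auto
    then show "norm (peak_kernel N (x - y) * w y) \<le> norm ((1 / peak_mass TYPE('n) N) * w y)"
      using peak_mass_pos[where 'n = 'n, of N] by (simp add: abs_mult kernel_nonneg)
  qed
qed

lemma nn_integral_tor_kernel: "(\<integral>\<^sup>+ y. ennreal (peak_kernel N (x - y)) \<partial>tor) = 1"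
proof -
  have "lattice_periodic (\<lambda>y. ennreal (peak_kernel N (x - y)))"
    using lattice_periodic_shift(2)[OF lattice_periodic_kernel[of N], of x]
    by (simp add: lattice_periodic_def)
  then have "(\<integral>\<^sup>+ y. ennreal (peak_kernel N (x - y)) \<partial>tor)
      = (\<integral>\<^sup>+ z. indicator centered_cube z * ennreal (peak_kernel N (x - (x - z))) \<partial>lborel)"
    unfolding centered_cube_def by (intro nn_integral_tor_reflect) measurable
  then show ?thesis by (simp add: nn_integral_kernel)
qed

text \<open>
  Jensen's inequality for the probability density \<open>peak_kernel N\<close>, followed by a change of variables
  to the centred cube.
\<close>

lemma smoothing_error_square_le:
  fixes w :: "real ^ 'n \<Rightarrow> real"
  assumes [measurable]: "w \<in> borel_measurable borel" and per: "lattice_periodic w" and int: "integrable tor w"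
  shows "ennreal ((w x - smoothing N w x)\<^sup>2)
    \<le> (\<integral>\<^sup>+ z. indicator centered_cube z * ennreal (peak_kernel N z) * ennreal ((w x - w (x - z))\<^sup>2) \<partial>lborel)"
proof -
  let ?k = "\<lambda>y. peak_kernel N (x - y)"
  have km[measurable]: "?k \<in> borel_measurable tor" by (rule measurable_torI) measurable
  have ki: "integrable tor (\<lambda>y. ?k y * 1)" by (rule integrable_kernel_times) simp
  have "ennreal (LINT y|tor. ?k y) = 1"
    using nn_integral_tor_kernel[of N x] ki by (subst (asm) nn_integral_eq_integral) (auto simp: kernel_nonneg)
  then have k1: "(LINT y|tor. ?k y) = 1" by simp
  have "(LINT y|tor. ?k y * (w x - w y)) = (LINT y|tor. ?k y * w x - ?k y * w y)"
    by (simp add: right_diff_distrib)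
  also have "\<dots> = w x - smoothing N w x"
    unfolding smoothing_def
    by (subst Bochner_Integration.integral_diff) (use ki k1 integrable_kernel_times[OF int] in auto)
  finally have eq: "(LINT y|tor. ?k y * (w x - w y)) = w x - smoothing N w x" .
  have "ennreal \<bar>w x - smoothing N w x\<bar> \<le> (\<integral>\<^sup>+ y. ennreal (norm (?k y * (w x - w y))) \<partial>tor)"
    unfolding eq[symmetric] real_norm_def[symmetric]
    by (rule integral_norm_bound_ennreal, rule integrable_kernel_times) (use int in simp)
  \<comment> \<open>One square root of the kernel goes with each factor in the Cauchy-Schwarz inequality.\<close>
  also have "\<dots> = (\<integral>\<^sup>+ y. ennreal (sqrt (?k y)) * ennreal (sqrt (?k y) * \<bar>w x - w y\<bar>) \<partial>tor)"
    by (rule nn_integral_cong) (simp add: abs_mult kernel_nonneg flip: ennreal_mult mult.assoc)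
  finally have "(ennreal \<bar>w x - smoothing N w x\<bar>)\<^sup>2
      \<le> (\<integral>\<^sup>+ y. ennreal (sqrt (?k y)) * ennreal (sqrt (?k y) * \<bar>w x - w y\<bar>) \<partial>tor)\<^sup>2"
    by (rule power_mono) simp
  also have "\<dots> \<le> (\<integral>\<^sup>+ y. (ennreal (sqrt (?k y)))\<^sup>2 \<partial>tor) * (\<integral>\<^sup>+ y. (ennreal (sqrt (?k y) * \<bar>w x - w y\<bar>))\<^sup>2 \<partial>tor)"
    by (rule Cauchy_Schwarz_nn_integral) measurable
  also have "\<dots> = (\<integral>\<^sup>+ y. ennreal (?k y) \<partial>tor) * (\<integral>\<^sup>+ y. ennreal (?k y) * ennreal ((w x - w y)\<^sup>2) \<partial>tor)"
    by (simp add: ennreal_power kernel_nonneg power_mult_distrib flip: ennreal_mult)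
  also have "\<dots> = (\<integral>\<^sup>+ y. ennreal (?k y) * ennreal ((w x - w y)\<^sup>2) \<partial>tor)"
    by (simp add: nn_integral_tor_kernel)
  also have "\<dots> = (\<integral>\<^sup>+ z. indicator centered_cube z * (ennreal (peak_kernel N (x - (x - z))) * ennreal ((w x - w (x - z))\<^sup>2)) \<partial>lborel)"
    unfolding centered_cube_def
  proof (rule nn_integral_tor_reflect)
    show "lattice_periodic (\<lambda>y. ennreal (?k y) * ennreal ((w x - w y)\<^sup>2))"
      using lattice_periodic_shift(2)[OF lattice_periodic_kernel[of N], of x] per
      by (simp add: lattice_periodic_def)
  qed measurable
  finally show ?thesis by (simp add: ennreal_power mult.assoc)
qed

lemma nn_integral_spacetime_eq_pair:
  fixes F :: "real \<times> (real ^ 'n) \<Rightarrow> ennreal"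
  assumes "F \<in> borel_measurable borel"
  shows "(\<integral>\<^sup>+ t. \<integral>\<^sup>+ x. F (t, x) \<partial>tor \<partial>tim T) = (\<integral>\<^sup>+ z. F z \<partial>(tim T \<Otimes>\<^sub>M tor))"
  by (rule tor.nn_integral_fst) (rule measurable_spacetimeI[OF assms])

text \<open>
  What the estimates use of the integrability of the two functions: \<open>W\<close> acts at almost every time as a
  bounded multiplier from \<open>L\<^sup>p\<close> to \<open>L\<^sup>2\<close>, with a constant independent of time, and \<open>B\<close> belongs to
  \<open>L\<^sup>2\<close> in time with values in \<open>L\<^sup>p\<close>. By Hoelder's inequality \<open>W\<close> is such a multiplier if it is
  bounded in time with values in \<open>L\<^sup>q\<close>, but the multiplier condition passes to differences more easily
  and does not mention \<open>q\<close>.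
\<close>

locale advected =
  fixes T :: real and W :: "real \<Rightarrow> real ^ 'n \<Rightarrow> real" and B :: "real \<Rightarrow> real ^ 'n \<Rightarrow> real ^ 'n"
    and p K :: ennreal
  assumes T: "0 < T" and p: "1 \<le> p" and K: "K < \<infinity>"
    and W_borel: "(\<lambda>z. W (fst z) (snd z)) \<in> borel_measurable borel"
    and B_borel: "(\<lambda>z. B (fst z) (snd z)) \<in> borel_measurable borel"
    and W_periodic: "lattice_periodic (W t)" and B_periodic: "lattice_periodic (B t)"
    and multiplier: "AE t in tim T. \<forall>g \<in> borel_measurable borel. lattice_periodic g \<longrightarrow>
      (\<integral>\<^sup>+ x. (g x)\<^sup>2 * ennreal ((W t x)\<^sup>2) \<partial>tor) \<le> K * (Lp_norm tor p g)\<^sup>2"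
    and B_norm: "(\<integral>\<^sup>+ t. (Lp_norm tor p (\<lambda>x. ennreal (norm (B t x))))\<^sup>2 \<partial>tim T) < \<infinity>"
begin

lemma W_section [measurable]: "W t \<in> borel_measurable borel"
  using borel_measurable_section[OF W_borel, of t] by simp

lemma B_section [measurable]: "B t \<in> borel_measurable borel"
  using borel_measurable_section[OF B_borel, of t] by simp

lemma W_shift_borel [measurable]: "(\<lambda>z. W (fst z) (snd z - y)) \<in> borel_measurable borel"
proof -
  have "(\<lambda>z. (fst z, snd z - y)) \<in> borel_measurable (borel :: (real \<times> (real ^ 'n)) measure)"
    by (intro borel_measurable_continuous_onI continuous_intros)
  from measurable_compose[OF this W_borel] show ?thesis by simp
qed

text \<open>
  A translate of \<open>W\<close> is a multiplier with the same constant: move the translation to the weight \<open>G\<close>, whose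
  norm it does not change.
\<close>

lemma weighted_translation_le:
  fixes G :: "real \<times> (real ^ 'n) \<Rightarrow> ennreal"
  assumes G[measurable]: "G \<in> borel_measurable borel" and per: "\<And>t. lattice_periodic (\<lambda>x. G (t, x))"
  shows "(\<integral>\<^sup>+ t. \<integral>\<^sup>+ x. (G (t, x))\<^sup>2 * ennreal ((W t x - W t (x - y))\<^sup>2) \<partial>tor \<partial>tim T)
    \<le> 4 * K * (\<integral>\<^sup>+ t. (Lp_norm tor p (\<lambda>x. G (t, x)))\<^sup>2 \<partial>tim T)"
proof -
  have sec[measurable]: "(\<lambda>x. G (t, x)) \<in> borel_measurable borel" for t
    by (rule borel_measurable_section) fact
  have "AE t in tim T. (\<integral>\<^sup>+ x. (G (t, x))\<^sup>2 * ennreal ((W t x - W t (x - y))\<^sup>2) \<partial>tor)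
      \<le> 4 * K * (Lp_norm tor p (\<lambda>x. G (t, x)))\<^sup>2"
    using multiplier
  proof eventually_elim
    case (elim t)
    let ?L = "(Lp_norm tor p (\<lambda>x. G (t, x)))\<^sup>2"
    have 1: "(\<integral>\<^sup>+ x. (G (t, x))\<^sup>2 * ennreal ((W t x)\<^sup>2) \<partial>tor) \<le> K * ?L"
      using elim per by simp
    have "(\<integral>\<^sup>+ x. (G (t, x))\<^sup>2 * ennreal ((W t (x - y))\<^sup>2) \<partial>tor)
        = (\<integral>\<^sup>+ x. (G (t, (x + - y) + y))\<^sup>2 * ennreal ((W t (x + - y))\<^sup>2) \<partial>tor)" by simp
    also have "\<dots> = (\<integral>\<^sup>+ x. (G (t, x + y))\<^sup>2 * ennreal ((W t x)\<^sup>2) \<partial>tor)"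
    proof (rule nn_integral_tor_shift)
      have [measurable]: "(\<lambda>x. G (t, x + y)) \<in> borel_measurable borel"
        by (rule measurable_compose[OF _ sec]) measurable
      show "(\<lambda>x. (G (t, x + y))\<^sup>2 * ennreal ((W t x)\<^sup>2)) \<in> borel_measurable borel" by measurable
      show "lattice_periodic (\<lambda>x. (G (t, x + y))\<^sup>2 * ennreal ((W t x)\<^sup>2))"
        using lattice_periodic_shift(1)[OF per[of t], of y] W_periodic[of t] by (simp add: lattice_periodic_def)
    qed
    also have "\<dots> \<le> K * (Lp_norm tor p (\<lambda>x. G (t, x + y)))\<^sup>2"
    proof -
      have "(\<lambda>x. G (t, x + y)) \<in> borel_measurable borel"
        by (rule measurable_compose[OF _ sec]) measurable
      then show ?thesis using elim lattice_periodic_shift(1)[OF per[of t], of y] by simp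
    qed
    also have "\<dots> = K * ?L"
      using Lp_norm_tor_shift[OF p sec per, of t y] by simp
    finally have 2: "(\<integral>\<^sup>+ x. (G (t, x))\<^sup>2 * ennreal ((W t (x - y))\<^sup>2) \<partial>tor) \<le> K * ?L" .
    have "(\<integral>\<^sup>+ x. (G (t, x))\<^sup>2 * ennreal ((W t x - W t (x - y))\<^sup>2) \<partial>tor)
        \<le> (\<integral>\<^sup>+ x. 2 * ((G (t, x))\<^sup>2 * ennreal ((W t x)\<^sup>2)) + 2 * ((G (t, x))\<^sup>2 * ennreal ((W t (x - y))\<^sup>2)) \<partial>tor)"
    proof (rule nn_integral_mono)
      fix x
      have "ennreal ((W t x - W t (x - y))\<^sup>2) \<le> ennreal (2 * ((W t x)\<^sup>2 + (W t (x - y))\<^sup>2))"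
        using square_sum2_le[of "W t x" "- W t (x - y)"] by (intro ennreal_leI) simp
      also have "\<dots> = 2 * (ennreal ((W t x)\<^sup>2) + ennreal ((W t (x - y))\<^sup>2))"
        by (simp add: ennreal_mult)
      finally have "(G (t, x))\<^sup>2 * ennreal ((W t x - W t (x - y))\<^sup>2)
          \<le> (G (t, x))\<^sup>2 * (2 * (ennreal ((W t x)\<^sup>2) + ennreal ((W t (x - y))\<^sup>2)))"
        by (rule mult_left_mono) simp
      then show "(G (t, x))\<^sup>2 * ennreal ((W t x - W t (x - y))\<^sup>2)
        \<le> 2 * ((G (t, x))\<^sup>2 * ennreal ((W t x)\<^sup>2)) + 2 * ((G (t, x))\<^sup>2 * ennreal ((W t (x - y))\<^sup>2))"
        by (simp add: distrib_left mult.left_commute)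
    qed
    also have "\<dots> = 2 * (\<integral>\<^sup>+ x. (G (t, x))\<^sup>2 * ennreal ((W t x)\<^sup>2) \<partial>tor) + 2 * (\<integral>\<^sup>+ x. (G (t, x))\<^sup>2 * ennreal ((W t (x - y))\<^sup>2) \<partial>tor)"
      by (simp add: nn_integral_add nn_integral_cmult)
    also have "\<dots> \<le> 2 * (K * ?L) + 2 * (K * ?L)"
      by (intro add_mono mult_left_mono 1 2) auto
    also have "\<dots> = 4 * K * ?L" by (simp add: mult.assoc flip: distrib_right)
    finally show ?case .
  qed
  then have "(\<integral>\<^sup>+ t. \<integral>\<^sup>+ x. (G (t, x))\<^sup>2 * ennreal ((W t x - W t (x - y))\<^sup>2) \<partial>tor \<partial>tim T)
      \<le> (\<integral>\<^sup>+ t. 4 * K * (Lp_norm tor p (\<lambda>x. G (t, x)))\<^sup>2 \<partial>tim T)"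
    by (rule nn_integral_mono_AE)
  also have "\<dots> = 4 * K * (\<integral>\<^sup>+ t. (Lp_norm tor p (\<lambda>x. G (t, x)))\<^sup>2 \<partial>tim T)"
    using Lp_norm_tor_measurable[OF G p, of T] by (intro nn_integral_cmult) simp
  finally show ?thesis .
qed

lemma W_square_integrable: "(\<integral>\<^sup>+ t. \<integral>\<^sup>+ x. ennreal ((W t x)\<^sup>2) \<partial>tor \<partial>tim T) < \<infinity>"
proof -
  have "AE t in tim T. (\<integral>\<^sup>+ x. ennreal ((W t x)\<^sup>2) \<partial>tor) \<le> K"
    using multiplier
  proof eventually_elim
    case (elim t)
    from elim[THEN bspec, of "\<lambda>_. 1"] show ?case
      by (simp add: lattice_periodic_def Lp_norm_one[OF prob_space_tor p])
  qed
  then have "(\<integral>\<^sup>+ t. \<integral>\<^sup>+ x. ennreal ((W t x)\<^sup>2) \<partial>tor \<partial>tim T) \<le> (\<integral>\<^sup>+ t. K \<partial>tim T)"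
    by (rule nn_integral_mono_AE)
  also have "\<dots> < \<infinity>" using K T by (simp add: emeasure_tim ennreal_mult_less_top)
  finally show ?thesis .
qed

definition translation_defect :: "(real \<times> (real ^ 'n) \<Rightarrow> ennreal) \<Rightarrow> real ^ 'n \<Rightarrow> ennreal" where
  "translation_defect G y = (\<integral>\<^sup>+ t. \<integral>\<^sup>+ x. (G (t, x))\<^sup>2 * ennreal ((W t x - W t (x - y))\<^sup>2) \<partial>tor \<partial>tim T)"

definition speed :: "real \<times> (real ^ 'n) \<Rightarrow> ennreal" where
  "speed z = ennreal (norm (B (fst z) (snd z)))"

lemma speed_borel [measurable]: "speed \<in> borel_measurable borel"
  unfolding speed_def using B_borel by measurable

lemma speed_periodic: "lattice_periodic (\<lambda>x. speed (t, x))"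
  using B_periodic[of t] by (simp add: lattice_periodic_def speed_def)

lemma translation_defect_1_small:
  assumes "0 < \<epsilon>"
  shows "\<exists>\<delta>>0. \<forall>y. norm y < \<delta> \<longrightarrow> translation_defect (\<lambda>_. 1) y \<le> ennreal \<epsilon>"
proof -
  obtain \<delta> where "\<delta> > 0" and
    \<delta>: "\<And>y. norm y < \<delta> \<Longrightarrow> (\<integral>\<^sup>+ t. \<integral>\<^sup>+ x. ennreal ((W t x - W t (x - y))\<^sup>2) \<partial>tor \<partial>tim T) \<le> ennreal \<epsilon>"
    using L2_translation_continuity[OF W_borel W_periodic W_square_integrable assms less_imp_le[OF T]] by blast
  then show ?thesis by (intro exI[of _ \<delta>]) (simp add: translation_defect_def)
qed

text \<open>
  The part of the speed above the level \<open>m\<close> contributes little, uniformly in \<open>y\<close>, by the multiplier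
  bound; the part below \<open>m\<close> is bounded, so that for it the continuity of translations in square mean
  suffices.
\<close>

lemma translation_defect_speed_small:
  assumes "0 < \<epsilon>"
  shows "\<exists>\<delta>>0. \<forall>y. norm y < \<delta> \<longrightarrow> translation_defect speed y \<le> ennreal \<epsilon>"
proof -
  have "(\<lambda>m. 4 * K * (\<integral>\<^sup>+ t. (Lp_norm tor p (\<lambda>x. tail m (speed (t, x))))\<^sup>2 \<partial>tim T)) \<longlonglongrightarrow> 4 * K * 0"
    using K B_norm
    by (intro ennreal_tendsto_cmult Lp_norm_tail_time_tendsto_0[OF speed_borel p])
      (auto simp: speed_def ennreal_mult_less_top)
  then have "\<forall>\<^sub>F m in sequentially. 4 * K * (\<integral>\<^sup>+ t. (Lp_norm tor p (\<lambda>x. tail m (speed (t, x))))\<^sup>2 \<partial>tim T) < ennreal (\<epsilon> / 2)"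
    using assms by (intro order_tendstoD(2)) auto
  then obtain m where m: "4 * K * (\<integral>\<^sup>+ t. (Lp_norm tor p (\<lambda>x. tail m (speed (t, x))))\<^sup>2 \<partial>tim T) < ennreal (\<epsilon> / 2)"
    by (auto simp: eventually_sequentially)
  obtain \<delta> where \<delta>: "\<delta> > 0" "\<And>y. norm y < \<delta> \<Longrightarrow> translation_defect (\<lambda>_. 1) y \<le> ennreal (\<epsilon> / (2 * ((real m)\<^sup>2 + 1)))"
    using translation_defect_1_small[of "\<epsilon> / (2 * ((real m)\<^sup>2 + 1))"] assms
    by (meson add_nonneg_pos divide_pos_pos mult_pos_pos zero_le_power2 zero_less_numeral zero_less_one)
  have "translation_defect speed y \<le> ennreal \<epsilon>" if "norm y < \<delta>" for y
  proof -
    define H where "H z = ennreal ((W (fst z) (snd z) - W (fst z) (snd z - y))\<^sup>2)" for z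
    have H[measurable]: "H \<in> borel_measurable borel" unfolding H_def using W_borel by measurable
    have pair: "translation_defect G y = (\<integral>\<^sup>+ z. (G z)\<^sup>2 * H z \<partial>(tim T \<Otimes>\<^sub>M tor))"
      if [measurable]: "G \<in> borel_measurable borel" for G
    proof -
      have "(\<lambda>z. (G z)\<^sup>2 * H z) \<in> borel_measurable borel" by measurable
      from nn_integral_spacetime_eq_pair[OF this, of T] show ?thesis
        by (simp add: translation_defect_def H_def)
    qed
    have Hp: "H \<in> borel_measurable (tim T \<Otimes>\<^sub>M tor)" "(\<lambda>z. (tail m (speed z))\<^sup>2 * H z) \<in> borel_measurable (tim T \<Otimes>\<^sub>M tor)"
      by (rule measurable_spacetimeI, measurable)+
    have "translation_defect speed y \<le> (\<integral>\<^sup>+ z. ennreal ((real m)\<^sup>2) * H z + (tail m (speed z))\<^sup>2 * H z \<partial>(tim T \<Otimes>\<^sub>M tor))"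
      unfolding pair[OF speed_borel]
    proof (rule nn_integral_mono)
      fix z
      have "(speed z)\<^sup>2 \<le> ennreal ((real m)\<^sup>2) + (tail m (speed z))\<^sup>2"
      proof (cases "speed z \<le> of_nat m")
        case True
        then have "(speed z)\<^sup>2 \<le> (of_nat m)\<^sup>2" by (rule power_mono) simp
        then show ?thesis using True by (simp add: tail_def ennreal_of_nat_eq_real_of_nat ennreal_power)
      qed (simp add: tail_def)
      then show "(speed z)\<^sup>2 * H z \<le> ennreal ((real m)\<^sup>2) * H z + (tail m (speed z))\<^sup>2 * H z"
        unfolding distrib_right[symmetric] by (rule mult_right_mono) simp
    qed
    also have "\<dots> = ennreal ((real m)\<^sup>2) * translation_defect (\<lambda>_. 1) y + translation_defect (\<lambda>z. tail m (speed z)) y"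
      using Hp by (subst pair, simp, subst pair, measurable, subst nn_integral_add) (simp_all add: nn_integral_cmult)
    also have "\<dots> \<le> ennreal ((real m)\<^sup>2) * ennreal (\<epsilon> / (2 * ((real m)\<^sup>2 + 1))) + ennreal (\<epsilon> / 2)"
    proof (intro add_mono mult_left_mono \<delta>(2) that)
      have "translation_defect (\<lambda>z. tail m (speed z)) y \<le> 4 * K * (\<integral>\<^sup>+ t. (Lp_norm tor p (\<lambda>x. tail m (speed (t, x))))\<^sup>2 \<partial>tim T)"
        unfolding translation_defect_def
        by (rule weighted_translation_le)
          (use speed_periodic in \<open>auto simp: lattice_periodic_def\<close>)
      then show "translation_defect (\<lambda>z. tail m (speed z)) y \<le> ennreal (\<epsilon> / 2)" using m by (meson le_less_trans less_imp_le)
    qed simp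
    also have "\<dots> = ennreal ((real m)\<^sup>2 * (\<epsilon> / (2 * ((real m)\<^sup>2 + 1))) + \<epsilon> / 2)"
    proof -
      have c: "0 \<le> \<epsilon> / (2 * ((real m)\<^sup>2 + 1))" "0 \<le> \<epsilon> / 2"
        using assms by (simp_all add: add_nonneg_nonneg)
      show ?thesis
        by (simp only: ennreal_mult[OF zero_le_power2 c(1)] ennreal_plus[OF mult_nonneg_nonneg[OF zero_le_power2 c(1)] c(2)])
    qed
    also have "\<dots> \<le> ennreal \<epsilon>"
    proof (rule ennreal_leI)
      have "(real m)\<^sup>2 * (\<epsilon> / (2 * ((real m)\<^sup>2 + 1))) = \<epsilon> / 2 * ((real m)\<^sup>2 / ((real m)\<^sup>2 + 1))"
        by (simp add: field_simps)
      also have "\<dots> \<le> \<epsilon> / 2 * 1"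
        using assms by (intro mult_left_mono) (auto simp: divide_le_eq_1 add_nonneg_pos)
      finally show "(real m)\<^sup>2 * (\<epsilon> / (2 * ((real m)\<^sup>2 + 1))) + \<epsilon> / 2 \<le> \<epsilon>" by linarith
    qed
    finally show ?thesis .
  qed
  then show ?thesis using \<delta>(1) by blast
qed

definition smoothing_error :: "(real \<times> (real ^ 'n) \<Rightarrow> ennreal) \<Rightarrow> nat \<Rightarrow> ennreal" where
  "smoothing_error G N = (\<integral>\<^sup>+ t. \<integral>\<^sup>+ x. (G (t, x))\<^sup>2 * ennreal ((W t x - smoothing N (W t) x)\<^sup>2) \<partial>tor \<partial>tim T)"

lemma AE_W_integrable: "AE t in tim T. integrable tor (W t)"
proof -
  have "AE t in tim T. (\<integral>\<^sup>+ x. ennreal ((W t x)\<^sup>2) \<partial>tor) \<noteq> \<infinity>"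
  proof (rule nn_integral_PInf_AE)
    have "(\<lambda>z. ennreal ((W (fst z) (snd z))\<^sup>2)) \<in> borel_measurable borel" using W_borel by measurable
    from nn_integral_tor_measurable[OF this]
    show "(\<lambda>t. \<integral>\<^sup>+ x. ennreal ((W t x)\<^sup>2) \<partial>tor) \<in> borel_measurable (tim T)" by simp
  qed (use W_square_integrable in auto)
  then show ?thesis
  proof eventually_elim
    case (elim t)
    then have "integrable tor (\<lambda>x. (W t x)\<^sup>2)"
      by (intro integrableI_bounded) (auto simp: less_top)
    then show ?case by (rule tor.square_integrable_imp_integrable[rotated]) measurable
  qed
qed

text \<open>
  By Jensen's inequality and Tonelli's theorem, the smoothing error is at most the average of the
  translation defect with respect to the kernel.
\<close>

lemma smoothing_error_tendsto_0:
  assumes G[measurable]: "G \<in> borel_measurable borel" and C: "\<And>y. translation_defect G y \<le> C" "C < \<infinity>"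
    and small: "\<And>\<epsilon>. 0 < \<epsilon> \<Longrightarrow> \<exists>\<delta>>0. \<forall>y. norm y < \<delta> \<longrightarrow> translation_defect G y \<le> ennreal \<epsilon>"
  shows "smoothing_error G \<longlonglongrightarrow> 0"
proof -
  let ?P = "tim T \<Otimes>\<^sub>M (tor :: (real ^ 'n) measure)"
  interpret P: pair_sigma_finite "tim T" "tor :: (real ^ 'n) measure" ..
  have sfP: "sigma_finite_measure ?P" by (rule P.P.sigma_finite_measure_axioms)
  define H where "H z w = (G w)\<^sup>2 * ennreal ((W (fst w) (snd w) - W (fst w) (snd w - z))\<^sup>2)" for z w
  have Hm: "(\<lambda>(w, z). H z w) \<in> borel_measurable (?P \<Otimes>\<^sub>M lborel)"
  proof -
    have f1: "(\<lambda>q. fst (fst q)) \<in> measurable (?P \<Otimes>\<^sub>M (lborel :: (real ^ 'n) measure)) borel"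
      by (intro measurable_compose[OF measurable_fst] measurable_compose[OF measurable_fst] measurable_timI) simp
    have f2: "(\<lambda>q. snd (fst q)) \<in> measurable (?P \<Otimes>\<^sub>M (lborel :: (real ^ 'n) measure)) borel"
      by (rule measurable_compose[OF measurable_fst], rule measurable_compose[OF measurable_snd], rule measurable_torI) simp
    have f3: "(\<lambda>q. snd q) \<in> measurable (?P \<Otimes>\<^sub>M (lborel :: (real ^ 'n) measure)) borel" by simp
    have m1: "(\<lambda>q. (fst (fst q), snd (fst q))) \<in> measurable (?P \<Otimes>\<^sub>M (lborel :: (real ^ 'n) measure)) (borel \<Otimes>\<^sub>M borel)"
      by (rule measurable_Pair[OF f1 f2])
    have m2: "(\<lambda>q. (fst (fst q), snd (fst q) - snd q)) \<in> measurable (?P \<Otimes>\<^sub>M (lborel :: (real ^ 'n) measure)) (borel \<Otimes>\<^sub>M borel)"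
      by (rule measurable_Pair[OF f1 borel_measurable_diff[OF f2 f3]])
    have g1: "(\<lambda>q. G (fst q)) \<in> borel_measurable (?P \<Otimes>\<^sub>M (lborel :: (real ^ 'n) measure))"
      using measurable_compose[OF m1[unfolded borel_prod] G] by simp
    have g2: "(\<lambda>q. W (fst (fst q)) (snd (fst q))) \<in> borel_measurable (?P \<Otimes>\<^sub>M (lborel :: (real ^ 'n) measure))"
      using measurable_compose[OF m1[unfolded borel_prod] W_borel] by simp
    have g3: "(\<lambda>q. W (fst (fst q)) (snd (fst q) - snd q)) \<in> borel_measurable (?P \<Otimes>\<^sub>M (lborel :: (real ^ 'n) measure))"
      using measurable_compose[OF m2[unfolded borel_prod] W_borel] by simp
    show ?thesis unfolding H_def case_prod_beta'
      by (intro borel_measurable_times_ennreal borel_measurable_power_ennreal measurable_compose[OF _ measurable_ennreal]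
          borel_measurable_power borel_measurable_diff g1 g2 g3)
  qed
  have defect: "translation_defect G z = (\<integral>\<^sup>+ w. H z w \<partial>?P)" for z
  proof -
    have "H z \<in> borel_measurable borel" unfolding H_def using W_borel by measurable
    from nn_integral_spacetime_eq_pair[OF this, of T] show ?thesis by (simp add: translation_defect_def H_def)
  qed
  have swap: "(\<lambda>(z, w). H z w) \<in> borel_measurable (lborel \<Otimes>\<^sub>M ?P)"
    using measurable_pair_swap[OF Hm] by (simp add: case_prod_beta')
  have "(\<lambda>z. \<integral>\<^sup>+ w. H z w \<partial>?P) \<in> borel_measurable lborel"
    by (rule sigma_finite_measure.borel_measurable_nn_integral[OF sfP swap])
  then have defect_borel: "translation_defect G \<in> borel_measurable borel"
    by (simp add: defect[abs_def])
  have kH: "(\<lambda>(w, z). indicator centered_cube z * ennreal (peak_kernel N z) * H z w) \<in> borel_measurable (?P \<Otimes>\<^sub>M lborel)" for N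
  proof -
    have "(\<lambda>z :: real ^ 'n. indicator centered_cube z * ennreal (peak_kernel N z)) \<in> borel_measurable lborel" by measurable
    from borel_measurable_times_ennreal[OF measurable_compose[OF measurable_snd this] Hm] show ?thesis
      by (simp add: case_prod_beta')
  qed
  have "smoothing_error G N \<le> (\<integral>\<^sup>+ z. indicator centered_cube z * ennreal (peak_kernel N z) * translation_defect G z \<partial>lborel)" for N
  proof -
    have "smoothing_error G N \<le> (\<integral>\<^sup>+ t. \<integral>\<^sup>+ x. \<integral>\<^sup>+ z. indicator centered_cube z * ennreal (peak_kernel N z) * H z (t, x) \<partial>lborel \<partial>tor \<partial>tim T)"
      unfolding smoothing_error_def
    proof (rule nn_integral_mono_AE)
      show "AE t in tim T. (\<integral>\<^sup>+ x. (G (t, x))\<^sup>2 * ennreal ((W t x - smoothing N (W t) x)\<^sup>2) \<partial>tor)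
          \<le> (\<integral>\<^sup>+ x. \<integral>\<^sup>+ z. indicator centered_cube z * ennreal (peak_kernel N z) * H z (t, x) \<partial>lborel \<partial>tor)"
        using AE_W_integrable
      proof eventually_elim
        case (elim t)
        show ?case
        proof (rule nn_integral_mono)
          fix x
          have "(G (t, x))\<^sup>2 * ennreal ((W t x - smoothing N (W t) x)\<^sup>2)
            \<le> (G (t, x))\<^sup>2 * (\<integral>\<^sup>+ z. indicator centered_cube z * ennreal (peak_kernel N z) * ennreal ((W t x - W t (x - z))\<^sup>2) \<partial>lborel)"
            by (intro mult_left_mono smoothing_error_square_le elim W_periodic W_section) simp
          also have "\<dots> = (\<integral>\<^sup>+ z. indicator centered_cube z * ennreal (peak_kernel N z) * H z (t, x) \<partial>lborel)"
            by (subst nn_integral_cmult[symmetric]) (auto simp: H_def ac_simps intro!: nn_integral_cong)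
          finally show "(G (t, x))\<^sup>2 * ennreal ((W t x - smoothing N (W t) x)\<^sup>2)
            \<le> (\<integral>\<^sup>+ z. indicator centered_cube z * ennreal (peak_kernel N z) * H z (t, x) \<partial>lborel)" .
        qed
      qed
    qed
    also have "\<dots> = (\<integral>\<^sup>+ w. \<integral>\<^sup>+ z. indicator centered_cube z * ennreal (peak_kernel N z) * H z w \<partial>lborel \<partial>?P)"
      by (rule tor.nn_integral_fst) (rule lborel.borel_measurable_nn_integral[OF kH])
    also have "\<dots> = (\<integral>\<^sup>+ z. \<integral>\<^sup>+ w. indicator centered_cube z * ennreal (peak_kernel N z) * H z w \<partial>?P \<partial>lborel)"
      using pair_sigma_finite.Fubini'[OF pair_sigma_finite.intro[OF sfP sigma_finite_lborel] kH] by simp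
    also have "\<dots> = (\<integral>\<^sup>+ z. indicator centered_cube z * ennreal (peak_kernel N z) * translation_defect G z \<partial>lborel)"
      unfolding defect
      by (intro nn_integral_cong nn_integral_cmult measurable_spacetimeI) (use W_borel in \<open>unfold H_def, measurable\<close>)
    finally show ?thesis .
  qed
  note bound = this
  show ?thesis
    by (rule tendsto_sandwich[OF _ _ tendsto_const nn_integral_kernel_vanishes[OF defect_borel C small]])
      (simp_all add: bound)
qed

end

section \<open>The energy estimate\<close>

text \<open>
  The coefficients of \<open>w\<close> enter conjugated because they are taken with respect to \<open>wave k\<close> instead of its
  conjugate, which suits the weak form of the equation.
\<close>

lemma smoothing_eq_trig_poly:
  fixes w :: "real ^ 'n \<Rightarrow> real"
  assumes w: "integrable tor w" and A: "finite A"
    and kern: "\<And>x. complex_of_real (peak_kernel N x) = (\<Sum>k\<in>A. complex_of_real (a k) * wave k x)"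
  shows "complex_of_real (smoothing N w x)
    = (\<Sum>k\<in>A. complex_of_real (a k) * cnj (LINT y|tor. complex_of_real (w y) * wave k y) * wave k x)"
proof -
  have int: "integrable tor (\<lambda>y. complex_of_real (w y) * wave k y)" for k
  proof (rule Bochner_Integration.integrable_bound[OF w])
    show "(\<lambda>y. complex_of_real (w y) * wave k y) \<in> borel_measurable tor"
      using w by (intro borel_measurable_times measurable_torI[OF wave_measurable]) auto
  qed (simp add: norm_mult)
  have "complex_of_real (smoothing N w x) = (LINT y|tor. complex_of_real (peak_kernel N (x - y)) * complex_of_real (w y))"
    unfolding smoothing_def by (simp flip: integral_complex_of_real)
  also have "\<dots> = (LINT y|tor. (\<Sum>k\<in>A. (complex_of_real (a k) * wave k x) * cnj (complex_of_real (w y) * wave k y)))"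
    by (simp add: kern wave_diff sum_distrib_right sum_distrib_left ac_simps)
  also have "\<dots> = (\<Sum>k\<in>A. (complex_of_real (a k) * wave k x) * cnj (LINT y|tor. complex_of_real (w y) * wave k y))"
    by (subst Bochner_Integration.integral_sum)
      (auto simp: int Bochner_Integration.integral_cnj simp del: complex_cnj_mult intro!: integrable_cnj)
  finally show ?thesis by (simp add: ac_simps)
qed

text \<open>
  The weak form of \<open>\<integral> S (\<beta> \<bullet> \<nabla>S) = 0\<close> for a trigonometric polynomial \<open>S\<close>, up to a factor \<open>\<i>\<close>.
  Exchanging the two summation indices turns the double sum into half of one that contains the pairing
  of \<open>\<beta>\<close> with the gradients of the products of two waves; these products are waves again, so that
  the divergence condition applies.
\<close>

lemma transport_energy_vanishes:
  fixes \<beta> :: "real ^ 'n \<Rightarrow> real ^ 'n"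
  assumes \<beta>: "integrable tor \<beta>" and A: "finite A"
    and divfree: "\<And>k. (LINT x|tor. complex_of_real (\<beta> x \<bullet> wavevec k) * wave k x) = 0"
  shows "(LINT x|tor. (\<Sum>k\<in>A. c k * wave k x) * (\<Sum>k\<in>A. c k * wave k x * complex_of_real (\<beta> x \<bullet> wavevec k))) = 0"
proof -
  have int: "integrable tor (\<lambda>x. complex_of_real (\<beta> x \<bullet> v) * wave m x)" for v m
  proof (rule Bochner_Integration.integrable_bound)
    show "integrable tor (\<lambda>x. norm v * norm (\<beta> x))" using \<beta> by simp
    show "(\<lambda>x. complex_of_real (\<beta> x \<bullet> v) * wave m x) \<in> borel_measurable tor"
      using \<beta> by (intro borel_measurable_times measurable_torI[OF wave_measurable]) auto
    show "AE x in tor. norm (complex_of_real (\<beta> x \<bullet> v) * wave m x) \<le> norm (norm v * norm (\<beta> x))"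
      using Cauchy_Schwarz_ineq2[of "\<beta> _" v] by (auto simp: norm_mult mult.commute)
  qed
  let ?I = "\<lambda>k l v. LINT x|tor. complex_of_real (\<beta> x \<bullet> v) * wave (k + l) x"
  have eq: "(LINT x|tor. (\<Sum>k\<in>A. c k * wave k x) * (\<Sum>k\<in>A. c k * wave k x * complex_of_real (\<beta> x \<bullet> wavevec k)))
      = (\<Sum>k\<in>A. \<Sum>l\<in>A. c k * c l * ?I k l (wavevec l))" (is "?L = _")
  proof -
    have "?L = (LINT x|tor. (\<Sum>k\<in>A. \<Sum>l\<in>A. c k * c l * (complex_of_real (\<beta> x \<bullet> wavevec l) * wave (k + l) x)))"
      by (rule Bochner_Integration.integral_cong) (simp_all add: sum_product wave_add_freq ac_simps)
    also have "\<dots> = (\<Sum>k\<in>A. \<Sum>l\<in>A. c k * c l * ?I k l (wavevec l))"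
      by (subst Bochner_Integration.integral_sum, simp add: int)+ (simp add: int)
    finally show ?thesis .
  qed
  have "(\<Sum>k\<in>A. \<Sum>l\<in>A. c k * c l * ?I k l (wavevec l)) + (\<Sum>k\<in>A. \<Sum>l\<in>A. c k * c l * ?I k l (wavevec l))
      = (\<Sum>k\<in>A. \<Sum>l\<in>A. c k * c l * ?I k l (wavevec l)) + (\<Sum>k\<in>A. \<Sum>l\<in>A. c k * c l * ?I k l (wavevec k))"
    by (subst (2) sum.swap) (simp add: add.commute mult.commute)
  also have "\<dots> = (\<Sum>k\<in>A. \<Sum>l\<in>A. c k * c l * ?I k l (wavevec (k + l)))"
    by (simp add: wavevec_add inner_add_right distrib_right int distrib_left add.commute flip: sum.distrib)
  also have "\<dots> = 0" by (simp add: divfree)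
  finally show ?thesis unfolding eq by simp
qed

text \<open>
  The left-hand side is the time derivative of the weighted energy. The advection term pairs \<open>w \<beta>\<close> with
  the gradient of the smoothing \<open>S\<close>; as \<open>\<beta>\<close> is divergence free, \<open>w\<close> may be replaced by \<open>w - S\<close>
  there. Young's inequality bounds the result by half the right-hand side plus half the square integral
  of the gradient of \<open>S\<close>. By orthogonality and \<open>a\<^sup>2 \<le> a\<close>, the latter is absorbed by the dissipation
  \<open>R0\<close>; this is where the coefficients of the kernel must lie between 0 and 1.
\<close>

lemma spatial_energy_estimate:
  fixes w :: "real ^ 'n \<Rightarrow> real" and \<beta> :: "real ^ 'n \<Rightarrow> real ^ 'n"
  assumes wm[measurable]: "w \<in> borel_measurable borel" and bm[measurable]: "\<beta> \<in> borel_measurable borel"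
    and w2: "integrable tor (\<lambda>x. (w x)\<^sup>2)" and \<beta>2: "integrable tor (\<lambda>x. (norm (\<beta> x))\<^sup>2)"
    and \<beta>w: "integrable tor (\<lambda>x. (norm (\<beta> x))\<^sup>2 * (w x)\<^sup>2)"
    and divfree: "\<And>k. (LINT x|tor. complex_of_real (\<beta> x \<bullet> wavevec k) * wave k x) = 0"
    and A: "finite A" "\<And>k. 0 \<le> a k" "\<And>k. k \<in> A \<Longrightarrow> a k \<le> 1"
    and kern: "\<And>x. complex_of_real (peak_kernel N x) = (\<Sum>k\<in>A. complex_of_real (a k) * wave k x)"
  defines "f \<equiv> \<lambda>k. LINT x|tor. complex_of_real (w x) * wave k x"
  defines "g \<equiv> \<lambda>k. \<i> * (LINT x|tor. complex_of_real (w x * (\<beta> x \<bullet> wavevec k)) * wave k x)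
    - complex_of_real (wavevec k \<bullet> wavevec k) * f k"
  shows "ennreal (2 * (\<Sum>k\<in>A. a k * Re (cnj (f k) * g k)))
    \<le> (\<integral>\<^sup>+ x. (ennreal (norm (\<beta> x)))\<^sup>2 * ennreal ((w x - smoothing N w x)\<^sup>2) \<partial>tor)"
proof -
  have [measurable]: "w \<in> borel_measurable tor" "\<beta> \<in> borel_measurable tor" "\<And>k. wave k \<in> borel_measurable tor"
    by (auto intro: measurable_torI)
  have w1: "integrable tor w" by (rule tor.square_integrable_imp_integrable[OF _ w2]) measurable
  have b1: "integrable tor \<beta>"
  proof -
    have "integrable tor (\<lambda>x. norm (\<beta> x))" by (rule tor.square_integrable_imp_integrable[OF _ \<beta>2]) measurable
    then show ?thesis by (rule integrable_norm_cancel) measurable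
  qed
  have bw1: "integrable tor (\<lambda>x. norm (\<beta> x) * \<bar>w x\<bar>)"
    by (rule tor.square_integrable_imp_integrable) (use \<beta>w in \<open>auto simp: power_mult_distrib\<close>)
  define c where "c k = complex_of_real (a k) * cnj (f k)" for k
  define S where "S x = (\<Sum>k\<in>A. c k * wave k x)" for x
  define V where "V x = (\<Sum>k\<in>A. c k * wave k x * complex_of_real (\<beta> x \<bullet> wavevec k))" for x
  \<comment> \<open>Up to the factor of the imaginary unit, Q j is the j-th partial derivative of S, and V is the derivative of S along the vector field.\<close>
  define Q where "Q j x = (\<Sum>k\<in>A. c k * complex_of_real (wavevec k $ j) * wave k x)" for j x
  define R0 where "R0 = (\<Sum>k\<in>A. a k * (wavevec k \<bullet> wavevec k) * (cmod (f k))\<^sup>2)"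
  have [measurable]: "S \<in> borel_measurable tor" "V \<in> borel_measurable tor" "Q j \<in> borel_measurable tor" for j
    unfolding S_def V_def Q_def by measurable
  have S: "S x = complex_of_real (smoothing N w x)" for x
    unfolding S_def c_def f_def by (rule smoothing_eq_trig_poly[OF w1 A(1) kern, symmetric])
  define C where "C = (\<Sum>k\<in>A. cmod (c k))"
  have Sbd: "cmod (S x) \<le> C" for x
    unfolding S_def C_def by (rule order_trans[OF norm_sum]) (simp add: norm_mult)
  have C0: "0 \<le> C" by (simp add: C_def sum_nonneg)
  define D where "D x = norm (\<beta> x) * \<bar>w x - smoothing N w x\<bar>" for x
  have sm[measurable]: "smoothing N w \<in> borel_measurable tor"
  proof -
    have "(\<lambda>x. Re (S x)) \<in> borel_measurable tor" by measurable
    then show ?thesis by (simp add: S)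
  qed
  have [measurable]: "D \<in> borel_measurable tor" unfolding D_def by measurable
  have D2: "integrable tor (\<lambda>x. (D x)\<^sup>2)"
  proof (rule Bochner_Integration.integrable_bound)
    show "integrable tor (\<lambda>x. 2 * ((norm (\<beta> x))\<^sup>2 * (w x)\<^sup>2) + 2 * C\<^sup>2 * (norm (\<beta> x))\<^sup>2)"
      using \<beta>2 \<beta>w by simp
    show "AE x in tor. norm ((D x)\<^sup>2) \<le> norm (2 * ((norm (\<beta> x))\<^sup>2 * (w x)\<^sup>2) + 2 * C\<^sup>2 * (norm (\<beta> x))\<^sup>2)"
    proof (rule AE_I2)
      fix x
      have "\<bar>smoothing N w x\<bar> \<le> C" using Sbd[of x] by (simp add: S)
      then have "(smoothing N w x)\<^sup>2 \<le> C\<^sup>2" using C0 by (simp add: abs_le_square_iff[symmetric])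
      then have "(w x - smoothing N w x)\<^sup>2 \<le> 2 * (w x)\<^sup>2 + 2 * C\<^sup>2"
        using square_sum2_le[of "w x" "- smoothing N w x"] by simp
      then have "(norm (\<beta> x))\<^sup>2 * (w x - smoothing N w x)\<^sup>2 \<le> (norm (\<beta> x))\<^sup>2 * (2 * (w x)\<^sup>2 + 2 * C\<^sup>2)"
        by (rule mult_left_mono) simp
      then show "norm ((D x)\<^sup>2) \<le> norm (2 * ((norm (\<beta> x))\<^sup>2 * (w x)\<^sup>2) + 2 * C\<^sup>2 * (norm (\<beta> x))\<^sup>2)"
        by (simp add: D_def power_mult_distrib algebra_simps)
    qed
  qed measurable
  have Vbd: "cmod (V x) \<le> norm (\<beta> x) * L2_set (\<lambda>j. cmod (Q j x)) UNIV" for x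
  proof -
    have "V x = (\<Sum>k\<in>A. \<Sum>j\<in>UNIV. complex_of_real (\<beta> x $ j) * (c k * complex_of_real (wavevec k $ j) * wave k x))"
      unfolding V_def inner_vec_def by (simp add: sum_distrib_left ac_simps)
    also have "\<dots> = (\<Sum>j\<in>UNIV. complex_of_real (\<beta> x $ j) * Q j x)"
      unfolding Q_def by (subst sum.swap) (simp add: sum_distrib_left)
    finally have "cmod (V x) \<le> (\<Sum>j\<in>UNIV. cmod (complex_of_real (\<beta> x $ j) * Q j x))"
      by (simp add: norm_sum)
    also have "\<dots> = (\<Sum>j\<in>UNIV. \<bar>norm (\<beta> x $ j)\<bar> * \<bar>cmod (Q j x)\<bar>)" by (simp add: norm_mult)
    also have "\<dots> \<le> L2_set (\<lambda>j. norm (\<beta> x $ j)) UNIV * L2_set (\<lambda>j. cmod (Q j x)) UNIV"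
      by (rule L2_set_mult_ineq)
    finally show ?thesis by (simp add: norm_vec_def)
  qed
  have Q2: "integrable tor (\<lambda>x. (cmod (Q j x))\<^sup>2)" for j
  proof (rule tor.integrable_const_bound[where B = "(\<Sum>k\<in>A. cmod (c k * complex_of_real (wavevec k $ j)))\<^sup>2"])
    have "cmod (Q j x) \<le> (\<Sum>k\<in>A. cmod (c k * complex_of_real (wavevec k $ j)))" for x
      unfolding Q_def by (rule order_trans[OF norm_sum]) (simp add: norm_mult)
    then show "AE x in tor. norm ((cmod (Q j x))\<^sup>2) \<le> (\<Sum>k\<in>A. cmod (c k * complex_of_real (wavevec k $ j)))\<^sup>2"
      by (auto intro!: power_mono)
  qed measurable
  have Qint: "(LINT x|tor. (\<Sum>j\<in>UNIV. (cmod (Q j x))\<^sup>2)) \<le> R0"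
  proof -
    have "(LINT x|tor. (\<Sum>j\<in>UNIV. (cmod (Q j x))\<^sup>2)) = (\<Sum>j\<in>UNIV. LINT x|tor. (cmod (Q j x))\<^sup>2)"
      by (rule Bochner_Integration.integral_sum) (rule Q2)
    also have "\<dots> = (\<Sum>j\<in>UNIV. \<Sum>k\<in>A. (cmod (c k * complex_of_real (wavevec k $ j)))\<^sup>2)"
      unfolding Q_def using integral_norm_square_trig_poly[OF A(1)] by simp
    also have "\<dots> = (\<Sum>k\<in>A. (cmod (c k))\<^sup>2 * (wavevec k \<bullet> wavevec k))"
      by (subst sum.swap) (simp add: norm_mult power_mult_distrib inner_vec_def sum_distrib_left flip: power2_eq_square)
    also have "\<dots> \<le> R0"
      unfolding R0_def
    proof (rule sum_mono)
      fix k assume k: "k \<in> A"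
      have "(a k)\<^sup>2 \<le> a k" using A(2)[of k] A(3)[OF k] by (simp add: power2_eq_square mult_left_le)
      then have "(a k)\<^sup>2 * ((wavevec k \<bullet> wavevec k) * (cmod (f k))\<^sup>2) \<le> a k * ((wavevec k \<bullet> wavevec k) * (cmod (f k))\<^sup>2)"
        by (rule mult_right_mono) simp
      then show "(cmod (c k))\<^sup>2 * (wavevec k \<bullet> wavevec k) \<le> a k * (wavevec k \<bullet> wavevec k) * (cmod (f k))\<^sup>2"
        by (simp add: c_def norm_mult power_mult_distrib ac_simps)
    qed
    finally show ?thesis .
  qed
  have iwk: "integrable tor (\<lambda>x. complex_of_real (w x * (\<beta> x \<bullet> wavevec k)) * wave k x)" for k
  proof (rule Bochner_Integration.integrable_bound)
    show "integrable tor (\<lambda>x. norm (wavevec k) * (norm (\<beta> x) * \<bar>w x\<bar>))" using bw1 by simp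
    show "AE x in tor. norm (complex_of_real (w x * (\<beta> x \<bullet> wavevec k)) * wave k x) \<le> norm (norm (wavevec k) * (norm (\<beta> x) * \<bar>w x\<bar>))"
    proof (rule AE_I2)
      fix x
      have "\<bar>w x\<bar> * \<bar>\<beta> x \<bullet> wavevec k\<bar> \<le> \<bar>w x\<bar> * (norm (\<beta> x) * norm (wavevec k))"
        by (intro mult_left_mono Cauchy_Schwarz_ineq2) auto
      then show "norm (complex_of_real (w x * (\<beta> x \<bullet> wavevec k)) * wave k x) \<le> norm (norm (wavevec k) * (norm (\<beta> x) * \<bar>w x\<bar>))"
        by (simp add: norm_mult abs_mult ac_simps)
    qed
  qed measurable
  have wV: "(\<Sum>k\<in>A. c k * (LINT x|tor. complex_of_real (w x * (\<beta> x \<bullet> wavevec k)) * wave k x)) = (LINT x|tor. complex_of_real (w x) * V x)"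
  proof -
    have "(LINT x|tor. complex_of_real (w x) * V x) = (LINT x|tor. (\<Sum>k\<in>A. c k * (complex_of_real (w x * (\<beta> x \<bullet> wavevec k)) * wave k x)))"
      unfolding V_def by (simp add: sum_distrib_left ac_simps)
    also have "\<dots> = (\<Sum>k\<in>A. c k * (LINT x|tor. complex_of_real (w x * (\<beta> x \<bullet> wavevec k)) * wave k x))"
      by (subst Bochner_Integration.integral_sum[OF integrable_mult_right[OF iwk]])
        (simp only: Bochner_Integration.integral_mult_right_zero)
    finally show ?thesis by simp
  qed
  have iwV: "integrable tor (\<lambda>x. complex_of_real (w x) * V x)"
  proof -
    have "integrable tor (\<lambda>x. (\<Sum>k\<in>A. c k * (complex_of_real (w x * (\<beta> x \<bullet> wavevec k)) * wave k x)))"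
      by (intro Bochner_Integration.integrable_sum integrable_mult_right iwk)
    then show ?thesis unfolding V_def by (simp add: sum_distrib_left ac_simps)
  qed
  have iSV: "integrable tor (\<lambda>x. S x * V x)"
  proof (rule Bochner_Integration.integrable_bound)
    show "integrable tor (\<lambda>x. C * (\<Sum>k\<in>A. cmod (c k) * (norm (\<beta> x) * norm (wavevec k))))"
      using b1 by (intro integrable_mult_right Bochner_Integration.integrable_sum integrable_mult_left integrable_norm) auto
    show "AE x in tor. norm (S x * V x) \<le> norm (C * (\<Sum>k\<in>A. cmod (c k) * (norm (\<beta> x) * norm (wavevec k))))"
    proof (rule AE_I2)
      fix x
      have "cmod (V x) \<le> (\<Sum>k\<in>A. cmod (c k) * (norm (\<beta> x) * norm (wavevec k)))"
        unfolding V_def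
        by (rule order_trans[OF norm_sum], rule sum_mono)
          (simp add: norm_mult mult_left_mono Cauchy_Schwarz_ineq2)
      then have "cmod (S x) * cmod (V x) \<le> C * (\<Sum>k\<in>A. cmod (c k) * (norm (\<beta> x) * norm (wavevec k)))"
        by (intro mult_mono Sbd C0) auto
      also have "\<dots> \<le> \<bar>C * (\<Sum>k\<in>A. cmod (c k) * (norm (\<beta> x) * norm (wavevec k)))\<bar>" by simp
      finally show "norm (S x * V x) \<le> norm (C * (\<Sum>k\<in>A. cmod (c k) * (norm (\<beta> x) * norm (wavevec k))))"
        by (simp add: norm_mult)
    qed
  qed measurable
  have SV: "(LINT x|tor. S x * V x) = 0"
    unfolding S_def V_def by (rule transport_energy_vanishes[OF b1 A(1) divfree])
  have "(\<Sum>k\<in>A. a k * Re (cnj (f k) * g k)) = Re (\<Sum>k\<in>A. c k * g k)"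
    by (simp add: c_def mult.assoc Re_sum)
  also have "(\<Sum>k\<in>A. c k * g k) = \<i> * (LINT x|tor. complex_of_real (w x) * V x) - complex_of_real R0"
  proof -
    have "(\<Sum>k\<in>A. c k * g k) = \<i> * (\<Sum>k\<in>A. c k * (LINT x|tor. complex_of_real (w x * (\<beta> x \<bullet> wavevec k)) * wave k x))
        - (\<Sum>k\<in>A. complex_of_real (wavevec k \<bullet> wavevec k) * (c k * f k))"
      unfolding g_def by (simp add: right_diff_distrib sum_subtractf sum_distrib_left ac_simps)
    also have "(\<Sum>k\<in>A. complex_of_real (wavevec k \<bullet> wavevec k) * (c k * f k)) = complex_of_real R0"
      unfolding R0_def c_def of_real_sum
      by (intro sum.cong refl) (simp add: complex_norm_square ac_simps del: of_real_power flip: of_real_power)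
    finally show ?thesis unfolding wV .
  qed
  also have "(LINT x|tor. complex_of_real (w x) * V x) = (LINT x|tor. (complex_of_real (w x) - S x) * V x)"
    using Bochner_Integration.integral_diff[OF iwV iSV] SV by (simp add: left_diff_distrib)
  finally have E: "(\<Sum>k\<in>A. a k * Re (cnj (f k) * g k)) = Re (\<i> * (LINT x|tor. (complex_of_real (w x) - S x) * V x)) - R0"
    by simp
  have "Re (\<i> * (LINT x|tor. (complex_of_real (w x) - S x) * V x)) \<le> cmod (LINT x|tor. (complex_of_real (w x) - S x) * V x)"
    using complex_Re_le_cmod[of "\<i> * (LINT x|tor. (complex_of_real (w x) - S x) * V x)"] by (simp add: norm_mult)
  also have "\<dots> \<le> (LINT x|tor. cmod ((complex_of_real (w x) - S x) * V x))" by (rule integral_norm_bound)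
  also have "\<dots> \<le> (LINT x|tor. ((D x)\<^sup>2 + (\<Sum>j\<in>UNIV. (cmod (Q j x))\<^sup>2)) / 2)"
  proof (rule integral_mono)
    show "integrable tor (\<lambda>x. cmod ((complex_of_real (w x) - S x) * V x))"
      using Bochner_Integration.integrable_diff[OF iwV iSV] by (intro integrable_norm) (simp add: left_diff_distrib)
    show "integrable tor (\<lambda>x. ((D x)\<^sup>2 + (\<Sum>j\<in>UNIV. (cmod (Q j x))\<^sup>2)) / 2)"
      using D2 Q2 by simp
    fix x
    have "cmod ((complex_of_real (w x) - S x) * V x) \<le> \<bar>w x - smoothing N w x\<bar> * (norm (\<beta> x) * L2_set (\<lambda>j. cmod (Q j x)) UNIV)"
      unfolding S norm_mult of_real_diff[symmetric] norm_of_real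
      by (intro mult_left_mono Vbd) simp
    also have "\<dots> = D x * L2_set (\<lambda>j. cmod (Q j x)) UNIV" by (simp add: D_def ac_simps)
    also have "\<dots> \<le> ((D x)\<^sup>2 + (L2_set (\<lambda>j. cmod (Q j x)) UNIV)\<^sup>2) / 2"
      using zero_le_power2[of "D x - L2_set (\<lambda>j. cmod (Q j x)) UNIV"] by (simp add: power2_diff)
    finally show "cmod ((complex_of_real (w x) - S x) * V x) \<le> ((D x)\<^sup>2 + (\<Sum>j\<in>UNIV. (cmod (Q j x))\<^sup>2)) / 2"
      by (simp add: L2_set_def sum_nonneg)
  qed
  also have "\<dots> = ((LINT x|tor. (D x)\<^sup>2) + (LINT x|tor. (\<Sum>j\<in>UNIV. (cmod (Q j x))\<^sup>2))) / 2"
    using D2 Q2 by simp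
  finally have le: "Re (\<i> * (LINT x|tor. (complex_of_real (w x) - S x) * V x))
      \<le> ((LINT x|tor. (D x)\<^sup>2) + (LINT x|tor. (\<Sum>j\<in>UNIV. (cmod (Q j x))\<^sup>2))) / 2" .
  have arith: "2 * s \<le> d + R - 2 * R" if "r \<le> (d + q) / 2" "s = r - R" "q \<le> R" for r s d q R :: real
    using that by (simp add: field_simps)
  have "2 * (\<Sum>k\<in>A. a k * Re (cnj (f k) * g k)) \<le> (LINT x|tor. (D x)\<^sup>2) + R0 - 2 * R0"
    by (rule arith[OF le E Qint])
  moreover have "0 \<le> R0" unfolding R0_def using A(2) by (intro sum_nonneg mult_nonneg_nonneg) auto
  ultimately have "2 * (\<Sum>k\<in>A. a k * Re (cnj (f k) * g k)) \<le> (LINT x|tor. (D x)\<^sup>2)" by linarith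
  then have "ennreal (2 * (\<Sum>k\<in>A. a k * Re (cnj (f k) * g k))) \<le> ennreal (LINT x|tor. (D x)\<^sup>2)"
    by (rule ennreal_leI)
  also have "\<dots> = (\<integral>\<^sup>+ x. ennreal ((D x)\<^sup>2) \<partial>tor)"
    by (rule nn_integral_eq_integral[symmetric, OF D2]) simp
  also have "\<dots> = (\<integral>\<^sup>+ x. (ennreal (norm (\<beta> x)))\<^sup>2 * ennreal ((w x - smoothing N w x)\<^sup>2) \<partial>tor)"
    by (rule nn_integral_cong) (simp add: D_def power_mult_distrib ennreal_mult ennreal_power)
  finally show ?thesis .
qed

lemma integrable_spacetime_if_square:
  fixes F :: "real \<times> (real ^ 'n) \<Rightarrow> 'b::{banach, second_countable_topology}"
  assumes F: "F \<in> borel_measurable borel" and fin: "(\<integral>\<^sup>+ t. \<integral>\<^sup>+ x. ennreal ((norm (F (t, x)))\<^sup>2) \<partial>tor \<partial>tim T) < \<infinity>" and "0 \<le> T"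
  shows "integrable (tim T \<Otimes>\<^sub>M tor) F"
proof (rule integrableI_bounded)
  show "F \<in> borel_measurable (tim T \<Otimes>\<^sub>M tor)" by (rule measurable_spacetimeI[OF F])
  have m: "(\<lambda>z. ennreal ((norm (F z))\<^sup>2)) \<in> borel_measurable borel" using F by measurable
  have "(\<integral>\<^sup>+ z. ennreal (norm (F z)) \<partial>(tim T \<Otimes>\<^sub>M tor)) \<le> (\<integral>\<^sup>+ z. 1 + ennreal ((norm (F z))\<^sup>2) \<partial>(tim T \<Otimes>\<^sub>M tor))"
  proof (rule nn_integral_mono)
    fix z
    have "norm (F z) \<le> 1 + (norm (F z))\<^sup>2"
      using zero_le_power2[of "norm (F z) - 1 / 2"] by (simp add: power2_diff) (simp add: power2_eq_square)
    then have "ennreal (norm (F z)) \<le> ennreal (1 + (norm (F z))\<^sup>2)" by (rule ennreal_leI)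
    then show "ennreal (norm (F z)) \<le> 1 + ennreal ((norm (F z))\<^sup>2)" by simp
  qed
  also have "\<dots> = (\<integral>\<^sup>+ z. 1 \<partial>(tim T \<Otimes>\<^sub>M (tor :: (real ^ 'n) measure))) + (\<integral>\<^sup>+ z. ennreal ((norm (F z))\<^sup>2) \<partial>(tim T \<Otimes>\<^sub>M tor))"
    by (rule nn_integral_add) (simp, rule measurable_spacetimeI[OF m])
  also have "(\<integral>\<^sup>+ z. 1 \<partial>(tim T \<Otimes>\<^sub>M (tor :: (real ^ 'n) measure))) = ennreal T"
    using nn_integral_spacetime_eq_pair[of "\<lambda>_ :: real \<times> (real ^ 'n). 1" T] \<open>0 \<le> T\<close> by (simp add: emeasure_tim)
  also have "(\<integral>\<^sup>+ z. ennreal ((norm (F z))\<^sup>2) \<partial>(tim T \<Otimes>\<^sub>M tor)) = (\<integral>\<^sup>+ t. \<integral>\<^sup>+ x. ennreal ((norm (F (t, x)))\<^sup>2) \<partial>tor \<partial>tim T)"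
    by (rule nn_integral_spacetime_eq_pair[OF m, symmetric])
  also have "ennreal T + \<dots> < \<infinity>" using fin by simp
  finally show "(\<integral>\<^sup>+ z. ennreal (norm (F z)) \<partial>(tim T \<Otimes>\<^sub>M tor)) < \<infinity>" .
qed

lemma integrable_spacetime_section:
  fixes F :: "real \<times> (real ^ 'n) \<Rightarrow> 'b::{banach, second_countable_topology}"
  assumes "integrable (tim T \<Otimes>\<^sub>M tor) F"
  shows "AE t in tim T. integrable tor (\<lambda>x. F (t, x))" "integrable (tim T) (\<lambda>t. LINT x|tor. F (t, x))"
proof -
  interpret pair_sigma_finite "tim T" "tor :: (real ^ 'n) measure" ..
  show "AE t in tim T. integrable tor (\<lambda>x. F (t, x))" "integrable (tim T) (\<lambda>t. LINT x|tor. F (t, x))"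
    using AE_integrable_fst'[OF assms] integrable_fst'[OF assms] by auto
qed

context advected
begin

definition coef :: "int ^ 'n \<Rightarrow> real \<Rightarrow> complex" where
  "coef k t = (LINT x|tor. complex_of_real (W t x) * wave k x)"

definition rate :: "int ^ 'n \<Rightarrow> real \<Rightarrow> complex" where
  "rate k t = \<i> * (LINT x|tor. complex_of_real (W t x * (B t x \<bullet> wavevec k)) * wave k x)
     - complex_of_real (wavevec k \<bullet> wavevec k) * coef k t"

lemma momentum_square_integrable:
  "(\<integral>\<^sup>+ t. \<integral>\<^sup>+ x. (speed (t, x))\<^sup>2 * ennreal ((W t x)\<^sup>2) \<partial>tor \<partial>tim T) < \<infinity>"
proof -
  have sp: "(\<lambda>x. speed (t, x)) \<in> borel_measurable borel" for t
    by (rule borel_measurable_section[OF speed_borel])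
  have "AE t in tim T. (\<integral>\<^sup>+ x. (speed (t, x))\<^sup>2 * ennreal ((W t x)\<^sup>2) \<partial>tor) \<le> K * (Lp_norm tor p (\<lambda>x. speed (t, x)))\<^sup>2"
    using multiplier by eventually_elim (use sp speed_periodic in blast)
  then have "(\<integral>\<^sup>+ t. \<integral>\<^sup>+ x. (speed (t, x))\<^sup>2 * ennreal ((W t x)\<^sup>2) \<partial>tor \<partial>tim T)
      \<le> (\<integral>\<^sup>+ t. K * (Lp_norm tor p (\<lambda>x. speed (t, x)))\<^sup>2 \<partial>tim T)"
    by (rule nn_integral_mono_AE)
  also have "\<dots> = K * (\<integral>\<^sup>+ t. (Lp_norm tor p (\<lambda>x. speed (t, x)))\<^sup>2 \<partial>tim T)"
    using Lp_norm_tor_measurable[OF speed_borel p, of T] by (intro nn_integral_cmult) simp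
  also have "\<dots> < \<infinity>" using K B_norm by (simp add: speed_def ennreal_mult_less_top)
  finally show ?thesis .
qed

lemma AE_finite_section:
  assumes "F \<in> borel_measurable borel" "(\<integral>\<^sup>+ t. \<integral>\<^sup>+ x. F (t, x) \<partial>(tor :: (real ^ 'n) measure) \<partial>tim T) < \<infinity>"
  shows "AE t in tim T. (\<integral>\<^sup>+ x. F (t, x) \<partial>tor) < \<infinity>"
proof -
  have "AE t in tim T. (\<integral>\<^sup>+ x. F (t, x) \<partial>tor) \<noteq> \<infinity>"
    by (rule nn_integral_PInf_AE) (use nn_integral_tor_measurable[OF assms(1)] assms(2) in auto)
  then show ?thesis by eventually_elim (simp add: less_top)
qed

lemma coef_integrand_borel: "(\<lambda>z. complex_of_real (W (fst z) (snd z)) * wave k (snd z)) \<in> borel_measurable borel"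
proof -
  have "(\<lambda>z :: real \<times> (real ^ 'n). wave k (snd z)) \<in> borel_measurable borel"
    unfolding wave_def by (intro borel_measurable_continuous_onI continuous_intros)
  then show ?thesis using W_borel by measurable
qed

lemma flux_integrand_borel:
  "(\<lambda>z. complex_of_real (W (fst z) (snd z) * (B (fst z) (snd z) \<bullet> wavevec k)) * wave k (snd z)) \<in> borel_measurable borel"
proof -
  have "(\<lambda>z :: real \<times> (real ^ 'n). wave k (snd z)) \<in> borel_measurable borel"
    unfolding wave_def by (intro borel_measurable_continuous_onI continuous_intros)
  then show ?thesis using W_borel B_borel by measurable
qed

lemma integrable_coef: "integrable (tim T) (coef k)"
proof -
  have "integrable (tim T \<Otimes>\<^sub>M tor) (\<lambda>z. complex_of_real (W (fst z) (snd z)) * wave k (snd z))"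
    by (rule integrable_spacetime_if_square[OF coef_integrand_borel])
      (use W_square_integrable T in \<open>auto simp: norm_mult\<close>)
  from integrable_spacetime_section(2)[OF this] show ?thesis by (simp add: coef_def[abs_def])
qed

lemma integrable_flux_integrand:
  "integrable (tim T \<Otimes>\<^sub>M tor) (\<lambda>z. complex_of_real (W (fst z) (snd z) * (B (fst z) (snd z) \<bullet> wavevec k)) * wave k (snd z))"
proof (rule integrable_spacetime_if_square[OF flux_integrand_borel])
  let ?m = "\<lambda>z. (speed z)\<^sup>2 * ennreal ((W (fst z) (snd z))\<^sup>2)"
  have m: "?m \<in> borel_measurable borel" using W_borel by measurable
  have "(\<integral>\<^sup>+ t. \<integral>\<^sup>+ x. ennreal ((norm (complex_of_real (W (fst (t, x)) (snd (t, x)) * (B (fst (t, x)) (snd (t, x)) \<bullet> wavevec k)) * wave k (snd (t, x))))\<^sup>2) \<partial>tor \<partial>tim T)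
      \<le> (\<integral>\<^sup>+ t. \<integral>\<^sup>+ x. ennreal ((norm (wavevec k))\<^sup>2) * ?m (t, x) \<partial>tor \<partial>tim T)"
  proof (intro nn_integral_mono)
    fix t x
    have "(B t x \<bullet> wavevec k)\<^sup>2 \<le> (norm (B t x) * norm (wavevec k))\<^sup>2"
      using Cauchy_Schwarz_ineq2[of "B t x" "wavevec k"] by (simp add: abs_le_square_iff[symmetric] abs_mult)
    then have "(W t x)\<^sup>2 * (B t x \<bullet> wavevec k)\<^sup>2 \<le> (W t x)\<^sup>2 * (norm (B t x) * norm (wavevec k))\<^sup>2"
      by (rule mult_left_mono) simp
    then have "(norm (complex_of_real (W t x * (B t x \<bullet> wavevec k)) * wave k x))\<^sup>2
        \<le> (norm (wavevec k))\<^sup>2 * ((norm (B t x))\<^sup>2 * (W t x)\<^sup>2)"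
      by (simp add: norm_mult power_mult_distrib ac_simps)
    then have "ennreal ((norm (complex_of_real (W t x * (B t x \<bullet> wavevec k)) * wave k x))\<^sup>2)
        \<le> ennreal ((norm (wavevec k))\<^sup>2 * ((norm (B t x))\<^sup>2 * (W t x)\<^sup>2))" by (rule ennreal_leI)
    also have "\<dots> = ennreal ((norm (wavevec k))\<^sup>2) * ?m (t, x)"
      by (simp add: speed_def ennreal_mult ennreal_power)
    finally show "ennreal ((norm (complex_of_real (W (fst (t, x)) (snd (t, x)) * (B (fst (t, x)) (snd (t, x)) \<bullet> wavevec k)) * wave k (snd (t, x))))\<^sup>2)
      \<le> ennreal ((norm (wavevec k))\<^sup>2) * ?m (t, x)" by simp
  qed
  also have "\<dots> = (\<integral>\<^sup>+ t. ennreal ((norm (wavevec k))\<^sup>2) * (\<integral>\<^sup>+ x. ?m (t, x) \<partial>tor) \<partial>tim T)"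
    by (intro nn_integral_cong nn_integral_cmult measurable_torI borel_measurable_section[OF m])
  also have "\<dots> = ennreal ((norm (wavevec k))\<^sup>2) * (\<integral>\<^sup>+ t. \<integral>\<^sup>+ x. ?m (t, x) \<partial>tor \<partial>tim T)"
    by (intro nn_integral_cmult nn_integral_tor_measurable[OF m])
  also have "\<dots> < \<infinity>" using momentum_square_integrable by (simp add: ennreal_mult_less_top)
  finally show "(\<integral>\<^sup>+ t. \<integral>\<^sup>+ x. ennreal ((norm (complex_of_real (W (fst (t, x)) (snd (t, x)) * (B (fst (t, x)) (snd (t, x)) \<bullet> wavevec k)) * wave k (snd (t, x))))\<^sup>2) \<partial>tor \<partial>tim T) < \<infinity>" .
qed (use T in simp)

lemma integrable_rate: "integrable (tim T) (rate k)"
  unfolding rate_def[abs_def]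
  using integrable_spacetime_section(2)[OF integrable_flux_integrand[of k]] integrable_coef[of k]
  by (intro Bochner_Integration.integrable_diff integrable_mult_right) simp_all

lemma smoothing_borel: "(\<lambda>z. smoothing N (W (fst z)) (snd z)) \<in> borel_measurable borel"
proof -
  let ?M = "(borel :: (real \<times> (real ^ 'n)) measure) \<Otimes>\<^sub>M (tor :: (real ^ 'n) measure)"
  have f1: "(\<lambda>q. fst (fst q)) \<in> measurable ?M borel"
    by (rule measurable_compose[OF measurable_fst]) (intro borel_measurable_continuous_onI continuous_intros)
  have f2: "(\<lambda>q. snd (fst q)) \<in> measurable ?M borel"
    by (rule measurable_compose[OF measurable_fst]) (intro borel_measurable_continuous_onI continuous_intros)
  have f3: "(\<lambda>q. snd q) \<in> measurable ?M borel"
    by (rule measurable_compose[OF measurable_snd]) (rule measurable_torI, simp)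
  have "(\<lambda>q. (fst (fst q), snd q)) \<in> measurable ?M (borel \<Otimes>\<^sub>M borel)" by (rule measurable_Pair[OF f1 f3])
  from measurable_compose[OF this[unfolded borel_prod] W_borel]
  have "(\<lambda>q. W (fst (fst q)) (snd q)) \<in> borel_measurable ?M" by simp
  from borel_measurable_times[OF measurable_compose[OF borel_measurable_diff[OF f2 f3] kernel_measurable] this]
  have "(\<lambda>(z, y). peak_kernel N (snd z - y) * W (fst z) y) \<in> borel_measurable ?M"
    by (simp add: case_prod_beta')
  from tor.borel_measurable_lebesgue_integral[OF this] show ?thesis by (simp add: smoothing_def)
qed

end

text \<open>
  The equation with zero initial datum, in terms of Fourier coefficients: \<open>coef' = rate\<close> weakly, and the
  vector field is orthogonal to the gradients of all waves at almost every time.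
\<close>

locale parabolic = advected T W B p K
  for T :: real and W :: "real \<Rightarrow> real ^ 'n \<Rightarrow> real" and B :: "real \<Rightarrow> real ^ 'n \<Rightarrow> real ^ 'n"
    and p K :: ennreal +
  assumes B_square: "(\<integral>\<^sup>+ t. \<integral>\<^sup>+ x. ennreal ((norm (B t x))\<^sup>2) \<partial>tor \<partial>tim T) < \<infinity>"
    and weak: "\<And>a c n \<eta> k. c < T \<Longrightarrow> (\<And>t. (\<eta> has_real_derivative bump a c n t) (at t)) \<Longrightarrow>
      (\<And>t. t \<ge> c \<Longrightarrow> \<eta> t = 0) \<Longrightarrow> (\<And>j. Ck j \<eta>) \<Longrightarrow>
      (LINT t|tim T. bump a c n t *\<^sub>R coef k t + \<eta> t *\<^sub>R rate k t) = 0"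
    and divfree: "\<And>k. AE t in tim T. (LINT x|tor. complex_of_real (B t x \<bullet> wavevec k) * wave k x) = 0"
begin

lemma coef_primitive: "AE t in tim T. coef k t = (LINT s|tim T. indicat_real {..t} s *\<^sub>R rate k s)"
  by (rule weak_derivative_AE_primitive[OF integrable_coef integrable_rate weak])

lemma coef_square:
  "integrable (tim T) (\<lambda>s. Re (cnj (coef k s) * rate k s))"
  "AE t in tim T. (cmod (coef k t))\<^sup>2 = 2 * (LINT s|tim T. indicat_real {..t} s * Re (cnj (coef k s) * rate k s))"
proof -
  define G where "G t = (LINT s|tim T. indicat_real {..t} s *\<^sub>R rate k s)" for t
  have AE: "AE t in tim T. coef k t = G t" using coef_primitive[of k] by (simp add: G_def)
  have Gbd: "cmod (G t) \<le> (LINT s|tim T. cmod (rate k s))" for t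
  proof -
    have "integrable (tim T) (\<lambda>s. indicat_real {..t} s *\<^sub>R rate k s)"
      by (rule integrable_tim_times_bounded[OF integrable_rate, of _ 1]) (auto simp: indicator_def)
    from integrable_norm[OF this] show ?thesis
      unfolding G_def
      by (rule order_trans[OF integral_norm_bound integral_mono[OF _ integrable_norm[OF integrable_rate]]])
        (simp add: indicator_def)
  qed
  have "integrable (tim T) (\<lambda>s. cnj (coef k s) * rate k s)"
  proof (rule Bochner_Integration.integrable_bound)
    show "integrable (tim T) (\<lambda>s. (LINT s|tim T. cmod (rate k s)) *\<^sub>R rate k s)"
      using integrable_rate[of k] by simp
    show "(\<lambda>s. cnj (coef k s) * rate k s) \<in> borel_measurable (tim T)"
      using integrable_coef[of k] integrable_rate[of k]
      by (intro borel_measurable_times measurable_compose[OF _ borel_measurable_cnj]) auto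
    show "AE s in tim T. norm (cnj (coef k s) * rate k s) \<le> norm ((LINT s|tim T. cmod (rate k s)) *\<^sub>R rate k s)"
      using AE
    proof eventually_elim
      case (elim s)
      have "cmod (coef k s) * cmod (rate k s) \<le> \<bar>LINT s|tim T. cmod (rate k s)\<bar> * cmod (rate k s)"
        by (rule mult_right_mono) (use Gbd[of s] elim in auto)
      then show ?case by (simp add: norm_mult)
    qed
  qed
  then show "integrable (tim T) (\<lambda>s. Re (cnj (coef k s) * rate k s))" by (rule integrable_Re)
  show "AE t in tim T. (cmod (coef k t))\<^sup>2 = 2 * (LINT s|tim T. indicat_real {..t} s * Re (cnj (coef k s) * rate k s))"
    using AE
  proof eventually_elim
    case (elim t)
    have "(cmod (G t))\<^sup>2 = 2 * (LINT s|tim T. indicat_real {..t} s * Re (cnj (G s) * rate k s))"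
      unfolding G_def by (rule norm_square_primitive[OF integrable_rate])
    also have "(LINT s|tim T. indicat_real {..t} s * Re (cnj (G s) * rate k s))
        = (LINT s|tim T. indicat_real {..t} s * Re (cnj (coef k s) * rate k s))"
    proof (rule integral_cong_AE)
      have Gm: "G \<in> borel_measurable (tim T)"
        unfolding G_def by (rule primitive_measurable[OF integrable_rate])
      have ind: "indicat_real {..t} \<in> borel_measurable (tim T)" by (rule measurable_timI) simp
      have re: "(\<lambda>s. Re (cnj (F s) * rate k s)) \<in> borel_measurable (tim T)" if "F \<in> borel_measurable (tim T)" for F
        using that integrable_rate[of k]
        by (intro measurable_compose[OF _ borel_measurable_Re] borel_measurable_times
            measurable_compose[OF _ borel_measurable_cnj]) auto
      show "(\<lambda>s. indicat_real {..t} s * Re (cnj (G s) * rate k s)) \<in> borel_measurable (tim T)"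
        by (rule borel_measurable_times[OF ind re[OF Gm]])
      show "(\<lambda>s. indicat_real {..t} s * Re (cnj (coef k s) * rate k s)) \<in> borel_measurable (tim T)"
        by (rule borel_measurable_times[OF ind re]) (use integrable_coef[of k] in simp)
      show "AE s in tim T. indicat_real {..t} s * Re (cnj (G s) * rate k s) = indicat_real {..t} s * Re (cnj (coef k s) * rate k s)"
        using AE by eventually_elim simp
    qed
    finally show ?case using elim by simp
  qed
qed

lemma AE_spatial_estimate:
  assumes A: "finite A" "\<And>k. 0 \<le> a k" "\<And>k. k \<in> A \<Longrightarrow> a k \<le> 1"
    and kern: "\<And>x. complex_of_real (peak_kernel N x) = (\<Sum>k\<in>A. complex_of_real (a k) * wave k x)"
  shows "AE s in tim T. ennreal (2 * (\<Sum>k\<in>A. a k * Re (cnj (coef k s) * rate k s)))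
    \<le> (\<integral>\<^sup>+ x. (speed (s, x))\<^sup>2 * ennreal ((W s x - smoothing N (W s) x)\<^sup>2) \<partial>tor)"
proof -
  have "(\<lambda>z. ennreal ((W (fst z) (snd z))\<^sup>2)) \<in> borel_measurable borel" using W_borel by measurable
  from AE_finite_section[OF this] W_square_integrable
  have 1: "AE s in tim T. (\<integral>\<^sup>+ x. ennreal ((W s x)\<^sup>2) \<partial>tor) < \<infinity>" by simp
  have "(\<lambda>z. ennreal ((norm (B (fst z) (snd z)))\<^sup>2)) \<in> borel_measurable borel" using B_borel by measurable
  from AE_finite_section[OF this] B_square
  have 2: "AE s in tim T. (\<integral>\<^sup>+ x. ennreal ((norm (B s x))\<^sup>2) \<partial>tor) < \<infinity>" by simp
  have "(\<lambda>z. (speed z)\<^sup>2 * ennreal ((W (fst z) (snd z))\<^sup>2)) \<in> borel_measurable borel" using W_borel by measurable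
  from AE_finite_section[OF this] momentum_square_integrable
  have 3: "AE s in tim T. (\<integral>\<^sup>+ x. (speed (s, x))\<^sup>2 * ennreal ((W s x)\<^sup>2) \<partial>tor) < \<infinity>" by simp
  have 4: "AE s in tim T. \<forall>k. (LINT x|tor. complex_of_real (B s x \<bullet> wavevec k) * wave k x) = 0"
    unfolding AE_all_countable using divfree by blast
  show ?thesis
    using 1 2 3 4
  proof eventually_elim
    case (elim s)
    have i1: "integrable tor (\<lambda>x. (W s x)\<^sup>2)"
      using elim(1) by (intro integrableI_bounded) auto
    have i2: "integrable tor (\<lambda>x. (norm (B s x))\<^sup>2)"
      using elim(2) by (intro integrableI_bounded) auto
    have "(\<integral>\<^sup>+ x. ennreal (norm ((norm (B s x))\<^sup>2 * (W s x)\<^sup>2)) \<partial>tor) = (\<integral>\<^sup>+ x. (speed (s, x))\<^sup>2 * ennreal ((W s x)\<^sup>2) \<partial>tor)"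
      by (rule nn_integral_cong) (simp add: speed_def ennreal_mult ennreal_power)
    then have i3: "integrable tor (\<lambda>x. (norm (B s x))\<^sup>2 * (W s x)\<^sup>2)"
      using elim(3) by (intro integrableI_bounded) auto
    from spatial_energy_estimate[OF W_section B_section i1 i2 i3 _ A kern]
    show ?case
      using elim(4) by (simp add: speed_def coef_def rate_def)
  qed
qed

lemma ennreal_integral_le_nn_integral:
  assumes "integrable M (f :: 'z \<Rightarrow> real)"
  shows "ennreal (integral\<^sup>L M f) \<le> (\<integral>\<^sup>+ x. ennreal (f x) \<partial>M)"
proof -
  have "ennreal (integral\<^sup>L M f) \<le> ennreal (LINT x|M. max 0 (f x))"
    by (intro ennreal_leI integral_mono) (use assms in auto)
  also have "\<dots> = (\<integral>\<^sup>+ x. ennreal (max 0 (f x)) \<partial>M)"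
    by (rule nn_integral_eq_integral[symmetric]) (use assms in auto)
  finally show ?thesis by (simp add: ennreal_max_0)
qed

text \<open>
  Integrating the spatial estimate in time bounds the sum of \<open>a k * |coef k t|\<^sup>2\<close>, and the square integral
  of the smoothing is the same sum with \<open>a\<^sup>2\<close>.
\<close>

lemma energy_bound:
  "AE t in tim T. (\<integral>\<^sup>+ x. ennreal ((smoothing N (W t) x)\<^sup>2) \<partial>tor) \<le> smoothing_error speed N"
proof -
  obtain A a where A: "finite (A :: (int ^ 'n) set)" "\<And>k. 0 \<le> a k" "\<And>k. k \<in> A \<Longrightarrow> a k \<le> 1"
    and kern: "\<And>x. complex_of_real (peak_kernel N x) = (\<Sum>k\<in>A. complex_of_real (a k) * wave k x)"
    by (rule kernel_trig_poly[of N]) (rule that; assumption)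
  have "AE t in tim T. \<forall>k. (cmod (coef k t))\<^sup>2 = 2 * (LINT s|tim T. indicat_real {..t} s * Re (cnj (coef k s) * rate k s))"
    unfolding AE_all_countable using coef_square(2) by blast
  then show ?thesis
    using AE_W_integrable
  proof eventually_elim
    case (elim t)
    let ?r = "\<lambda>(k :: int ^ 'n) s. Re (cnj (coef k s) * rate k s)"
    have ir: "integrable (tim T) (\<lambda>s. indicat_real {..t} s * ?r k s)" for k
      using integrable_tim_times_bounded[OF coef_square(1)[of k], of "indicat_real {..t}" 1] by (simp add: indicator_def)
    have iR: "integrable (tim T) (\<lambda>s. indicat_real {..t} s * (2 * (\<Sum>k\<in>A. a k * ?r k s)))"
    proof -
      have "integrable (tim T) (\<lambda>s. \<Sum>k\<in>A. 2 * a k * (indicat_real {..t} s * ?r k s))"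
        by (intro Bochner_Integration.integrable_sum integrable_mult_right ir)
      then show ?thesis by (simp add: sum_distrib_left ac_simps)
    qed
    have trig: "complex_of_real (smoothing N (W t) x) = (\<Sum>k\<in>A. (complex_of_real (a k) * cnj (coef k t)) * wave k x)" for x
      unfolding coef_def by (rule smoothing_eq_trig_poly[OF elim(2) A(1) kern])
    have sq: "(smoothing N (W t) x)\<^sup>2 = (cmod (\<Sum>k\<in>A. (complex_of_real (a k) * cnj (coef k t)) * wave k x))\<^sup>2" for x
      unfolding trig[symmetric] by simp
    have "(LINT x|tor. (smoothing N (W t) x)\<^sup>2) = (\<Sum>k\<in>A. (cmod (complex_of_real (a k) * cnj (coef k t)))\<^sup>2)"
      unfolding sq by (rule integral_norm_square_trig_poly[OF A(1)])
    also have "\<dots> \<le> (\<Sum>k\<in>A. a k * (cmod (coef k t))\<^sup>2)"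
    proof (rule sum_mono)
      fix k assume k: "k \<in> A"
      have "(a k)\<^sup>2 \<le> a k" using A(2)[of k] A(3)[OF k] by (simp add: power2_eq_square mult_left_le)
      then have "(a k)\<^sup>2 * (cmod (coef k t))\<^sup>2 \<le> a k * (cmod (coef k t))\<^sup>2" by (rule mult_right_mono) simp
      then show "(cmod (complex_of_real (a k) * cnj (coef k t)))\<^sup>2 \<le> a k * (cmod (coef k t))\<^sup>2"
        by (simp add: norm_mult power_mult_distrib)
    qed
    also have "\<dots> = (\<Sum>k\<in>A. LINT s|tim T. 2 * a k * (indicat_real {..t} s * ?r k s))"
      by (intro sum.cong refl) (simp only: Bochner_Integration.integral_mult_right_zero elim(1)[rule_format]
          mult.assoc mult.left_commute[of "a _" 2])
    also have "\<dots> = (LINT s|tim T. (\<Sum>k\<in>A. 2 * a k * (indicat_real {..t} s * ?r k s)))"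
      by (rule Bochner_Integration.integral_sum[symmetric]) (rule integrable_mult_right[OF ir])
    also have "\<dots> = (LINT s|tim T. indicat_real {..t} s * (2 * (\<Sum>k\<in>A. a k * ?r k s)))"
      by (simp add: sum_distrib_left ac_simps)
    finally have "ennreal (LINT x|tor. (smoothing N (W t) x)\<^sup>2)
        \<le> ennreal (LINT s|tim T. indicat_real {..t} s * (2 * (\<Sum>k\<in>A. a k * ?r k s)))" by (rule ennreal_leI)
    also have "\<dots> \<le> (\<integral>\<^sup>+ s. ennreal (indicat_real {..t} s * (2 * (\<Sum>k\<in>A. a k * ?r k s))) \<partial>tim T)"
      by (rule ennreal_integral_le_nn_integral[OF iR])
    also have "\<dots> \<le> smoothing_error speed N"
      unfolding smoothing_error_def
    proof (rule nn_integral_mono_AE)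
      show "AE s in tim T. ennreal (indicat_real {..t} s * (2 * (\<Sum>k\<in>A. a k * ?r k s)))
        \<le> (\<integral>\<^sup>+ x. (speed (s, x))\<^sup>2 * ennreal ((W s x - smoothing N (W s) x)\<^sup>2) \<partial>tor)"
      proof -
        have "AE s in tim T. ennreal (2 * (\<Sum>k\<in>A. a k * ?r k s))
          \<le> (\<integral>\<^sup>+ x. (speed (s, x))\<^sup>2 * ennreal ((W s x - smoothing N (W s) x)\<^sup>2) \<partial>tor)"
          by (rule AE_spatial_estimate[OF A kern])
        then show ?thesis by eventually_elim (auto simp: indicator_def)
      qed
    qed
    finally have le: "ennreal (LINT x|tor. (smoothing N (W t) x)\<^sup>2) \<le> smoothing_error speed N" .
    have "(\<integral>\<^sup>+ x. ennreal ((smoothing N (W t) x)\<^sup>2) \<partial>tor) = ennreal (LINT x|tor. (smoothing N (W t) x)\<^sup>2)"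
    proof (rule nn_integral_eq_integral)
      have m: "smoothing N (W t) \<in> borel_measurable tor"
        using borel_measurable_section[OF smoothing_borel[of N], of t] by (intro measurable_torI) simp
      show "integrable tor (\<lambda>x. (smoothing N (W t) x)\<^sup>2)"
      proof (rule tor.integrable_const_bound[where B = "(\<Sum>k\<in>A. cmod (complex_of_real (a k) * cnj (coef k t)))\<^sup>2"])
        have "cmod (\<Sum>k\<in>A. (complex_of_real (a k) * cnj (coef k t)) * wave k x)
            \<le> (\<Sum>k\<in>A. cmod (complex_of_real (a k) * cnj (coef k t)))" for x
          by (rule order_trans[OF norm_sum]) (simp add: norm_mult)
        then show "AE x in tor. norm ((smoothing N (W t) x)\<^sup>2) \<le> (\<Sum>k\<in>A. cmod (complex_of_real (a k) * cnj (coef k t)))\<^sup>2"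
          unfolding sq by (auto intro!: power_mono)
      qed (use m in measurable)
    qed simp
    with le show ?case by simp
  qed
qed

text \<open>
  The smoothings of \<open>W\<close> converge to \<open>W\<close> in square mean, and by the energy bound to zero.
\<close>

lemma solution_vanishes: "AE t in tim T. AE x in tor. W t x = 0"
proof -
  have one: "(\<lambda>_. 1 :: ennreal) \<in> borel_measurable (borel :: (real \<times> (real ^ 'n)) measure)" by simp
  have "smoothing_error (\<lambda>_. 1) \<longlonglongrightarrow> 0"
  proof (rule smoothing_error_tendsto_0[OF one])
    show "translation_defect (\<lambda>_. 1) y \<le> 4 * K * (\<integral>\<^sup>+ t. (Lp_norm tor p (\<lambda>x :: real ^ 'n. 1))\<^sup>2 \<partial>tim T)" for y
      unfolding translation_defect_def
      by (rule weighted_translation_le[OF one]) (simp add: lattice_periodic_def)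
    show "4 * K * (\<integral>\<^sup>+ t. (Lp_norm tor p (\<lambda>x :: real ^ 'n. 1))\<^sup>2 \<partial>tim T) < \<infinity>"
      using K T by (simp add: Lp_norm_one[OF prob_space_tor p] emeasure_tim ennreal_mult_less_top)
  qed (rule translation_defect_1_small)
  moreover have "smoothing_error speed \<longlonglongrightarrow> 0"
  proof (rule smoothing_error_tendsto_0[OF speed_borel])
    show "translation_defect speed y \<le> 4 * K * (\<integral>\<^sup>+ t. (Lp_norm tor p (\<lambda>x. speed (t, x)))\<^sup>2 \<partial>tim T)" for y
      unfolding translation_defect_def by (rule weighted_translation_le[OF speed_borel speed_periodic])
    show "4 * K * (\<integral>\<^sup>+ t. (Lp_norm tor p (\<lambda>x. speed (t, x)))\<^sup>2 \<partial>tim T) < \<infinity>"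
      using K B_norm by (simp add: speed_def ennreal_mult_less_top)
  qed (rule translation_defect_speed_small)
  ultimately have lim: "(\<lambda>N. 2 * smoothing_error (\<lambda>_. 1) N + 2 * (smoothing_error speed N * ennreal T)) \<longlonglongrightarrow> 2 * 0 + 2 * (0 * ennreal T)"
    by (intro tendsto_add ennreal_tendsto_cmult tendsto_mult_ennreal tendsto_const) auto
  let ?E = "\<integral>\<^sup>+ t. \<integral>\<^sup>+ x. ennreal ((W t x)\<^sup>2) \<partial>tor \<partial>tim T"
  have "?E \<le> 2 * smoothing_error (\<lambda>_. 1) N + 2 * (smoothing_error speed N * ennreal T)" for N
  proof -
    let ?h = "\<lambda>z. ennreal ((W (fst z) (snd z) - smoothing N (W (fst z)) (snd z))\<^sup>2)"
    have hm: "?h \<in> borel_measurable borel" using W_borel smoothing_borel[of N] by measurable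
    have "?E \<le> (\<integral>\<^sup>+ t. 2 * (\<integral>\<^sup>+ x. ?h (t, x) \<partial>tor) + 2 * smoothing_error speed N \<partial>tim T)"
    proof (rule nn_integral_mono_AE)
      show "AE t in tim T. (\<integral>\<^sup>+ x. ennreal ((W t x)\<^sup>2) \<partial>tor) \<le> 2 * (\<integral>\<^sup>+ x. ?h (t, x) \<partial>tor) + 2 * smoothing_error speed N"
        using energy_bound[of N]
      proof eventually_elim
        case (elim t)
        have m1: "(\<lambda>x. ?h (t, x)) \<in> borel_measurable tor"
          by (rule measurable_torI[OF borel_measurable_section[OF hm]])
        have m2: "(\<lambda>x. ennreal ((smoothing N (W t) x)\<^sup>2)) \<in> borel_measurable tor"
        proof -
          have "smoothing N (W t) \<in> borel_measurable tor"
            using borel_measurable_section[OF smoothing_borel[of N], of t] by (intro measurable_torI) simp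
          then show ?thesis by measurable
        qed
        have "(\<integral>\<^sup>+ x. ennreal ((W t x)\<^sup>2) \<partial>tor) \<le> (\<integral>\<^sup>+ x. 2 * ?h (t, x) + 2 * ennreal ((smoothing N (W t) x)\<^sup>2) \<partial>tor)"
        proof (rule nn_integral_mono)
          fix x
          have "ennreal ((W t x)\<^sup>2) \<le> ennreal (2 * ((W t x - smoothing N (W t) x)\<^sup>2 + (smoothing N (W t) x)\<^sup>2))"
            using square_sum2_le[of "W t x - smoothing N (W t) x" "smoothing N (W t) x"] by (intro ennreal_leI) simp
          then show "ennreal ((W t x)\<^sup>2) \<le> 2 * ?h (t, x) + 2 * ennreal ((smoothing N (W t) x)\<^sup>2)"
            by (simp add: ennreal_mult distrib_left)
        qed
        also have "\<dots> = 2 * (\<integral>\<^sup>+ x. ?h (t, x) \<partial>tor) + 2 * (\<integral>\<^sup>+ x. ennreal ((smoothing N (W t) x)\<^sup>2) \<partial>tor)"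
          by (subst nn_integral_add[OF borel_measurable_times_ennreal[OF borel_measurable_const m1]
                borel_measurable_times_ennreal[OF borel_measurable_const m2]],
              subst nn_integral_cmult[OF m1], subst nn_integral_cmult[OF m2], rule refl)
        also have "\<dots> \<le> 2 * (\<integral>\<^sup>+ x. ?h (t, x) \<partial>tor) + 2 * smoothing_error speed N"
          by (intro add_left_mono mult_left_mono elim) simp
        finally show ?case .
      qed
    qed
    also have "\<dots> = 2 * (\<integral>\<^sup>+ t. \<integral>\<^sup>+ x. ?h (t, x) \<partial>tor \<partial>tim T) + 2 * smoothing_error speed N * ennreal T"
      by (subst nn_integral_add[OF borel_measurable_times_ennreal[OF borel_measurable_const nn_integral_tor_measurable[OF hm]]
            borel_measurable_const], subst nn_integral_cmult[OF nn_integral_tor_measurable[OF hm]])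
        (use T in \<open>simp add: emeasure_tim\<close>)
    finally show ?thesis by (simp add: smoothing_error_def mult.assoc)
  qed
  then have "?E \<le> 0"
    using LIMSEQ_le_const[OF lim, of ?E] by simp
  then have E0: "?E = 0" by simp
  have "(\<lambda>z. ennreal ((W (fst z) (snd z))\<^sup>2)) \<in> borel_measurable borel" using W_borel by measurable
  note m = nn_integral_tor_measurable[OF this, of T]
  have "AE t in tim T. (\<integral>\<^sup>+ x. ennreal ((W t x)\<^sup>2) \<partial>tor) = 0"
    using E0 m by (subst (asm) nn_integral_0_iff_AE) simp_all
  then show ?thesis
  proof eventually_elim
    case (elim t)
    then show ?case by (subst (asm) nn_integral_0_iff_AE) (auto simp: ennreal_eq_0_iff)
  qed
qed

end

section \<open>Borel representatives on the torus\<close>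

lemma AE_lebesgue_on_iff:
  fixes S :: "'a::euclidean_space set"
  assumes "S \<in> sets borel"
  shows "(AE x in lebesgue_on S. P x) \<longleftrightarrow> (AE x in lborel. x \<in> S \<longrightarrow> P x)"
  using assms by (subst AE_restrict_space_iff) (auto simp: AE_completion_iff)

lemma AE_lebesgue_on_time_iff: "(AE t in lebesgue_on {0..T}. P t) \<longleftrightarrow> (AE t in tim T. P t)"
  by (simp add: AE_lebesgue_on_iff AE_tim_iff)

lemma AE_torus_measure_iff: "(AE x in torus_measure. P x) \<longleftrightarrow> (AE x in tor. P x)"
proof -
  have "AE x in lborel. x \<in> cbox 0 1 \<longleftrightarrow> x \<in> halfopen_cube (0 :: real ^ 'n)"
    using AE_unit_cube_open halfopen_cube_bounds by (auto elim!: eventually_mono)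
  then show ?thesis
    unfolding torus_measure_def AE_tor_iff
    by (subst AE_lebesgue_on_iff, simp) (rule eventually_subst, auto elim!: eventually_mono)
qed

lemma borel_measurable_lebesgue_on_AE:
  fixes f g :: "'a::euclidean_space \<Rightarrow> 'b::euclidean_space"
  assumes [measurable]: "S \<in> sets borel" and g: "g \<in> borel_measurable (restrict_space lborel S)"
    and eq: "AE x in lebesgue_on S. f x = g x"
  shows "f \<in> borel_measurable (lebesgue_on S)"
proof -
  have S: "S \<in> sets lebesgue" by simp
  have "(\<lambda>x. indicat_real S x *\<^sub>R g x) \<in> borel_measurable lborel"
    using g by (subst (asm) borel_measurable_restrict_space_iff) auto
  then have "(\<lambda>x. indicat_real S x *\<^sub>R g x) \<in> borel_measurable lebesgue"
    by (rule measurable_completion)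
  moreover have "AE x in lebesgue. indicat_real S x *\<^sub>R g x = indicat_real S x *\<^sub>R f x"
    using eq S by (subst (asm) AE_restrict_space_iff) (auto elim!: eventually_mono simp: indicator_def)
  ultimately have "(\<lambda>x. indicat_real S x *\<^sub>R f x) \<in> borel_measurable lebesgue"
    by (rule borel_measurable_AE)
  then show ?thesis
    using S by (subst borel_measurable_restrict_space_iff) auto
qed

lemma integral_lebesgue_on_eq:
  fixes f g :: "'a::euclidean_space \<Rightarrow> 'b::euclidean_space"
  assumes S[measurable]: "S \<in> sets borel" and g: "g \<in> borel_measurable (restrict_space lborel S)"
    and eq: "AE x in lebesgue_on S. f x = g x"
  shows "(LINT x|lebesgue_on S. f x) = (LINT x|restrict_space lborel S. g x)"
proof -
  have gm: "(\<lambda>x. indicat_real S x *\<^sub>R g x) \<in> borel_measurable lborel"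
    using g by (subst (asm) borel_measurable_restrict_space_iff) auto
  have "(LINT x|lebesgue_on S. f x) = (LINT x|lebesgue_on S. g x)"
    using borel_measurable_lebesgue_on_AE[OF S g eq] borel_measurable_lebesgue_on_AE[OF S g, of g] eq
    by (intro integral_cong_AE) auto
  also have "\<dots> = (LINT x|lebesgue. indicat_real S x *\<^sub>R g x)"
    by (rule integral_restrict_space) simp
  also have "\<dots> = (LINT x|lborel. indicat_real S x *\<^sub>R g x)"
    by (rule integral_completion[OF gm])
  also have "\<dots> = (LINT x|restrict_space lborel S. g x)"
    by (rule integral_restrict_space[symmetric]) simp
  finally show ?thesis .
qed

lemma integral_time_eq:
  fixes f g :: "real \<Rightarrow> real"
  assumes "g \<in> borel_measurable (tim T)" "AE t in tim T. f t = g t"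
  shows "(LINT t|lebesgue_on {0..T}. f t) = (LINT t|tim T. g t)"
  unfolding tim_def by (rule integral_lebesgue_on_eq) (use assms in \<open>auto simp: AE_lebesgue_on_time_iff tim_def\<close>)

lemma integral_torus_eq:
  fixes f g :: "real ^ 'n \<Rightarrow> real"
  assumes g[measurable]: "g \<in> borel_measurable borel" and eq: "AE x in tor. f x = g x"
  shows "(LINT x|torus_measure. f x) = (LINT x|tor. g x)"
proof -
  have "(LINT x|torus_measure. f x) = (LINT x|restrict_space lborel (cbox 0 1). g x)"
    unfolding torus_measure_def
    by (rule integral_lebesgue_on_eq)
      (use eq in \<open>auto simp: AE_torus_measure_iff[unfolded torus_measure_def] intro!: measurable_restrict_space1\<close>)
  also have "\<dots> = (LINT x|lborel. indicat_real (cbox 0 1) x *\<^sub>R g x)"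
    by (rule integral_restrict_space) simp
  also have "\<dots> = (LINT x|lborel. indicat_real (halfopen_cube 0) x *\<^sub>R g x)"
  proof (rule integral_cong_AE)
    show "AE x in lborel. indicat_real (cbox 0 1) x *\<^sub>R g x = indicat_real (halfopen_cube 0) x *\<^sub>R g x"
      using AE_unit_cube_open halfopen_cube_bounds by (auto elim!: eventually_mono simp: indicator_def)
  qed measurable
  also have "\<dots> = (LINT x|tor. g x)"
    unfolding tor_def by (rule integral_restrict_space[symmetric]) simp
  finally show ?thesis .
qed

lemma nn_integral_lebesgue_on_eq:
  fixes f g :: "'a::euclidean_space \<Rightarrow> ennreal"
  assumes S[measurable]: "S \<in> sets borel" and g: "g \<in> borel_measurable (restrict_space lborel S)"
    and eq: "AE x in lebesgue_on S. f x = g x"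
  shows "(\<integral>\<^sup>+ x. f x \<partial>lebesgue_on S) = (\<integral>\<^sup>+ x. g x \<partial>restrict_space lborel S)"
proof -
  have gm: "(\<lambda>x. g x * indicator S x) \<in> borel_measurable lborel"
    using g by (subst (asm) borel_measurable_restrict_space_iff_ennreal) auto
  have "(\<integral>\<^sup>+ x. f x \<partial>lebesgue_on S) = (\<integral>\<^sup>+ x. g x \<partial>lebesgue_on S)"
    by (rule nn_integral_cong_AE[OF eq])
  also have "\<dots> = (\<integral>\<^sup>+ x. g x * indicator S x \<partial>lebesgue)"
    by (rule nn_integral_restrict_space) simp
  also have "\<dots> = (\<integral>\<^sup>+ x. g x * indicator S x \<partial>lborel)"
    by (rule nn_integral_completion)
  also have "\<dots> = (\<integral>\<^sup>+ x. g x \<partial>restrict_space lborel S)"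
    by (rule nn_integral_restrict_space[symmetric]) simp
  finally show ?thesis .
qed

lemma nn_integral_torus_eq:
  fixes f g :: "real ^ 'n \<Rightarrow> ennreal"
  assumes g[measurable]: "g \<in> borel_measurable borel" and eq: "AE x in tor. f x = g x"
  shows "(\<integral>\<^sup>+ x. f x \<partial>torus_measure) = (\<integral>\<^sup>+ x. g x \<partial>tor)"
proof -
  have "(\<integral>\<^sup>+ x. f x \<partial>torus_measure) = (\<integral>\<^sup>+ x. g x \<partial>restrict_space lborel (cbox 0 1))"
    unfolding torus_measure_def
    by (rule nn_integral_lebesgue_on_eq)
      (use eq in \<open>auto simp: AE_torus_measure_iff[unfolded torus_measure_def] intro!: measurable_restrict_space1\<close>)
  also have "\<dots> = (\<integral>\<^sup>+ x. g x * indicator (cbox 0 1) x \<partial>lborel)"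
    by (rule nn_integral_restrict_space) simp
  also have "\<dots> = (\<integral>\<^sup>+ x. indicator (halfopen_cube 0) x * g x \<partial>lborel)"
  proof (rule nn_integral_cong_AE)
    show "AE x in lborel. g x * indicator (cbox 0 1) x = indicator (halfopen_cube 0) x * g x"
      using AE_unit_cube_open halfopen_cube_bounds by (auto elim!: eventually_mono simp: indicator_def)
  qed
  finally show ?thesis by (simp add: nn_integral_tor)
qed

lemma Lp_norm_torus_eq:
  fixes f g :: "real ^ 'n \<Rightarrow> 'b::euclidean_space"
  assumes g[measurable]: "g \<in> borel_measurable borel" and eq: "AE x in tor. f x = g x"
  shows "Lp_norm torus_measure p (\<lambda>x. ennreal (norm (f x))) = Lp_norm tor p (\<lambda>x. ennreal (norm (g x)))"
proof (cases "p = \<infinity>")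
  case True
  have meas: "h \<in> borel_measurable torus_measure" if "AE x in tor. h x = g x" for h
    unfolding torus_measure_def
    by (rule borel_measurable_lebesgue_on_AE[OF _ measurable_restrict_space1])
      (use that in \<open>auto simp: AE_torus_measure_iff[unfolded torus_measure_def]\<close>)
  have [measurable]: "f \<in> borel_measurable torus_measure" "g \<in> borel_measurable torus_measure"
    using meas[OF eq] meas[of g] by auto
  have "esssup torus_measure (\<lambda>x. ennreal (norm (f x))) = esssup torus_measure (\<lambda>x. ennreal (norm (g x)))"
  proof (rule esssup_AE_cong)
    show "AE x in torus_measure. ennreal (norm (f x)) = ennreal (norm (g x))"
      using eq by (simp add: AE_torus_measure_iff) (auto elim!: eventually_mono)
  qed measurable
  also have "\<dots> = esssup tor (\<lambda>x. ennreal (norm (g x)))"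
    by (subst (1 2) esssup_eq_AE) (auto simp: AE_torus_measure_iff)
  finally show ?thesis using True by (simp add: Lp_norm_def)
next
  case False
  have "(\<integral>\<^sup>+ x. ennreal_powr (ennreal (norm (f x))) (enn2real p) \<partial>torus_measure)
      = (\<integral>\<^sup>+ x. ennreal_powr (ennreal (norm (g x))) (enn2real p) \<partial>tor)"
    by (rule nn_integral_torus_eq) (use eq in auto)
  then show ?thesis unfolding Lp_norm_finite_exponent[OF False] by simp
qed

text \<open>
  Composition with this map makes any function on the half-open unit cube lattice periodic.
\<close>

definition fractional :: "real ^ 'n \<Rightarrow> real ^ 'n" where
  "fractional x = (\<chi> i. x $ i - of_int \<lfloor>x $ i\<rfloor>)"

lemma fractional_shift: "fractional (x + lattice_point k) = fractional x"
  by (simp add: fractional_def lattice_point_def vec_eq_iff)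

lemma fractional_id: "x \<in> halfopen_cube 0 \<Longrightarrow> fractional x = x"
proof -
  assume "x \<in> halfopen_cube 0"
  then have "\<lfloor>x $ i\<rfloor> = 0" for i by (simp add: halfopen_cube_def floor_eq_iff)
  then show ?thesis by (simp add: fractional_def vec_eq_iff)
qed

lemma fractional_measurable [measurable]: "fractional \<in> borel_measurable borel"
proof (subst borel_measurable_euclidean_space, intro ballI)
  fix b :: "real ^ 'n" assume "b \<in> Basis"
  then obtain j where "b = axis j 1" by (auto simp: Basis_vec_def)
  then have "(\<lambda>x. fractional x \<bullet> b) = (\<lambda>x. x $ j - of_int \<lfloor>x $ j\<rfloor>)"
    by (simp add: fun_eq_iff fractional_def inner_axis)
  then show "(\<lambda>x. fractional x \<bullet> b) \<in> borel_measurable borel" by simp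
qed

text \<open>
  On the cube, a Lebesgue measurable function agrees almost everywhere with a Borel function; the latter is
  then extended periodically from the half-open cube.
\<close>

lemma borel_periodic_representative:
  fixes f :: "real \<Rightarrow> real ^ 'n \<Rightarrow> 'b::euclidean_space"
  assumes f: "(\<lambda>(t, x). f t x) \<in> borel_measurable (lebesgue_on ({0..T} \<times> unit_cube))"
  obtains U where "(\<lambda>z. U (fst z) (snd z)) \<in> borel_measurable borel" "\<And>t. lattice_periodic (U t)"
    "AE z in lborel. z \<in> {0..T} \<times> unit_cube \<longrightarrow> f (fst z) (snd z) = U (fst z) (snd z)"
    "AE t in tim T. AE x in tor. f t x = U t x"
proof -
  let ?S = "{0..T} \<times> (unit_cube :: (real ^ 'n) set)"
  let ?F = "\<lambda>z. indicat_real ?S z *\<^sub>R f (fst z) (snd z)"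
  have Sb: "?S \<in> sets borel" by (auto simp: borel_prod[symmetric])
  have "?F \<in> borel_measurable lebesgue"
    using f Sb by (subst (asm) borel_measurable_restrict_space_iff) (auto simp: case_prod_beta')
  then have "(\<lambda>z. ?F z \<bullet> i) \<in> borel_measurable lebesgue" for i by measurable
  then have "\<exists>g\<in>borel_measurable lborel. AE z in lborel. ?F z \<bullet> i = g z" for i
    by (rule completion_ex_borel_measurable_real)
  then have "\<forall>i. \<exists>g. g \<in> borel_measurable lborel \<and> (AE z in lborel. ?F z \<bullet> i = g z)" by blast
  from choice[OF this] obtain g
    where g: "\<And>i. g i \<in> borel_measurable lborel" "\<And>i. AE z in lborel. ?F z \<bullet> i = g i z" by blast
  define G where "G z = (\<Sum>i\<in>Basis. g i z *\<^sub>R i)" for z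
  have G[measurable]: "G \<in> borel_measurable borel"
    unfolding G_def using g(1) by measurable
  have "AE z in lborel. \<forall>i\<in>Basis. ?F z \<bullet> i = g i z"
    by (rule AE_finite_allI) (use g(2) in auto)
  then have FG: "AE z in lborel. ?F z = G z"
  proof eventually_elim
    case (elim z)
    then show ?case unfolding G_def by (subst euclidean_representation[symmetric]) auto
  qed
  define U where "U t x = G (t, fractional x)" for t x
  have cube: "AE z in (lborel :: (real \<times> (real ^ 'n)) measure). snd z \<in> cbox 0 1 \<longrightarrow> snd z \<in> halfopen_cube (0 :: real ^ 'n)"
  proof -
    have "AE z in (lborel :: real measure) \<Otimes>\<^sub>M (lborel :: (real ^ 'n) measure). snd z \<in> cbox 0 1 \<longrightarrow> snd z \<in> halfopen_cube (0 :: real ^ 'n)"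
    proof (rule pair_sigma_finite.AE_pair_measure[OF pair_sigma_finite.intro[OF sigma_finite_lborel sigma_finite_lborel]])
      show "{x \<in> space (lborel \<Otimes>\<^sub>M lborel). snd x \<in> cbox 0 1 \<longrightarrow> snd x \<in> halfopen_cube (0 :: real ^ 'n)} \<in> sets ((lborel :: real measure) \<Otimes>\<^sub>M lborel)"
        by measurable
      show "AE t in (lborel :: real measure). AE x in lborel. snd (t, x) \<in> cbox 0 1 \<longrightarrow> snd (t, x) \<in> halfopen_cube (0 :: real ^ 'n)"
      proof (rule AE_I2)
        show "AE x in lborel. snd (t, x) \<in> cbox 0 1 \<longrightarrow> snd (t, x) \<in> halfopen_cube (0 :: real ^ 'n)" for t :: real
          using AE_unit_cube_open by eventually_elim (use halfopen_cube_bounds(1) in auto)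
      qed
    qed
    then show ?thesis by (simp only: lborel_prod)
  qed
  from FG cube have fU: "AE z in lborel. z \<in> ?S \<longrightarrow> f (fst z) (snd z) = U (fst z) (snd z)"
    by eventually_elim (auto simp: U_def fractional_id indicator_def split: if_splits)
  have Ub: "(\<lambda>z. U (fst z) (snd z)) \<in> borel_measurable borel"
  proof -
    have "(\<lambda>z :: real \<times> (real ^ 'n). (fst z, fractional (snd z))) \<in> measurable (borel \<Otimes>\<^sub>M borel) (borel \<Otimes>\<^sub>M borel)"
      by measurable
    from measurable_compose[OF this[unfolded borel_prod] G] show ?thesis by (simp add: U_def)
  qed
  have "AE z in ((lborel :: real measure) \<Otimes>\<^sub>M (lborel :: (real ^ 'n) measure)). z \<in> ?S \<longrightarrow> f (fst z) (snd z) = U (fst z) (snd z)"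
    using fU by (simp only: lborel_prod)
  from pair_sigma_finite.AE_pair[OF pair_sigma_finite.intro[OF sigma_finite_lborel sigma_finite_lborel] this]
  have sec: "AE t in lborel. AE x in lborel. (t, x) \<in> ?S \<longrightarrow> f t x = U t x" by simp
  have "AE t in tim T. AE x in tor. f t x = U t x"
    unfolding AE_tim_iff AE_tor_iff using sec
  proof eventually_elim
    case (elim t)
    show ?case
      using elim halfopen_cube_bounds(2) by (auto elim!: eventually_mono)
  qed
  then show thesis
    using that[OF Ub _ fU] by (simp add: lattice_periodic_def U_def fractional_shift)
qed

section \<open>From distributional solutions to Fourier coefficients\<close>

lemma iterated_integral_eq:
  fixes \<Phi> :: "real \<times> (real ^ 'n) \<Rightarrow> real"
  assumes \<Phi>: "\<Phi> \<in> borel_measurable borel" and eq: "AE t in tim T. AE x in tor. h t x = \<Phi> (t, x)"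
  shows "(LINT t|lebesgue_on {0..T}. LINT x|torus_measure. h t x) = (LINT t|tim T. LINT x|tor. \<Phi> (t, x))"
proof (rule integral_time_eq)
  show "(\<lambda>t. LINT x|tor. \<Phi> (t, x)) \<in> borel_measurable (tim T)"
    by (rule tor.borel_measurable_lebesgue_integral) (use measurable_spacetimeI[OF \<Phi>] in simp)
  show "AE t in tim T. (LINT x|torus_measure. h t x) = (LINT x|tor. \<Phi> (t, x))"
    using eq by eventually_elim (rule integral_torus_eq[OF borel_measurable_section[OF \<Phi>]])
qed

text \<open>
  Real test functions with all phases \<open>\<alpha>\<close> carry the same information as complex exponentials.
\<close>

lemma complex_eq_0_if_Re_cis_mult:
  assumes "\<And>\<alpha>. Re (cis \<alpha> * z) = 0"
  shows "z = 0"
  using assms[of 0] assms[of "pi / 2"] by (simp add: complex_eq_iff)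

lemma integrable_tim_times_bounded_on:
  fixes h :: "real \<Rightarrow> complex"
  assumes h: "integrable (tim T) h" and w: "w \<in> borel_measurable borel" and C: "\<And>t. t \<in> {0..T} \<Longrightarrow> \<bar>w t\<bar> \<le> C"
  shows "integrable (tim T) (\<lambda>t. w t *\<^sub>R h t)"
proof (rule Bochner_Integration.integrable_bound)
  show "integrable (tim T) (\<lambda>t. C *\<^sub>R h t)" using h by simp
  show "(\<lambda>t. w t *\<^sub>R h t) \<in> borel_measurable (tim T)"
    by (rule borel_measurable_scaleR[OF measurable_timI[OF w]]) (use h in simp)
  show "AE t in tim T. norm (w t *\<^sub>R h t) \<le> norm (C *\<^sub>R h t)"
  proof (rule AE_I2)
    fix t assume "t \<in> space (tim T)"
    with C[of t] have "\<bar>w t\<bar> \<le> \<bar>C\<bar>" by simp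
    then show "norm (w t *\<^sub>R h t) \<le> norm (C *\<^sub>R h t)" by (simp add: mult_right_mono)
  qed
qed

lemma wave_test_borel:
  fixes w \<eta> :: "real \<Rightarrow> real" and U :: "real \<Rightarrow> real ^ 'n \<Rightarrow> real" and B :: "real \<Rightarrow> real ^ 'n \<Rightarrow> real ^ 'n"
  assumes w: "w \<in> borel_measurable borel" and \<eta>: "\<eta> \<in> borel_measurable borel"
    and [measurable]: "(\<lambda>z. U (fst z) (snd z)) \<in> borel_measurable borel"
      "(\<lambda>z. B (fst z) (snd z)) \<in> borel_measurable borel"
  shows "(\<lambda>z. U (fst z) (snd z) * (w (fst z) * cos (\<theta> \<bullet> snd z + \<alpha>)
        + B (fst z) (snd z) \<bullet> ((- \<eta> (fst z) * sin (\<theta> \<bullet> snd z + \<alpha>)) *\<^sub>R \<theta>)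
        + - \<eta> (fst z) * (\<theta> \<bullet> \<theta>) * cos (\<theta> \<bullet> snd z + \<alpha>))) \<in> borel_measurable borel"
proof -
  have fst: "(fst :: real \<times> (real ^ 'n) \<Rightarrow> real) \<in> borel_measurable borel"
    by (intro borel_measurable_continuous_onI continuous_intros)
  have [measurable]: "(\<lambda>z :: real \<times> (real ^ 'n). cos (\<theta> \<bullet> snd z + \<alpha>)) \<in> borel_measurable borel"
    "(\<lambda>z :: real \<times> (real ^ 'n). sin (\<theta> \<bullet> snd z + \<alpha>)) \<in> borel_measurable borel"
    by (intro borel_measurable_continuous_onI continuous_intros)+
  note [measurable] = measurable_compose[OF fst w] measurable_compose[OF fst \<eta>]
  show ?thesis by measurable
qed

context advected
begin

lemma AE_integrable_coef_integrand: "AE t in tim T. integrable tor (\<lambda>x. complex_of_real (W t x) * wave k x)"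
proof -
  have "integrable (tim T \<Otimes>\<^sub>M tor) (\<lambda>z. complex_of_real (W (fst z) (snd z)) * wave k (snd z))"
    by (rule integrable_spacetime_if_square[OF coef_integrand_borel])
      (use W_square_integrable T in \<open>auto simp: norm_mult\<close>)
  from integrable_spacetime_section(1)[OF this] show ?thesis by simp
qed

lemma AE_integrable_flux_integrand:
  "AE t in tim T. integrable tor (\<lambda>x. complex_of_real (W t x * (B t x \<bullet> wavevec k)) * wave k x)"
  using integrable_spacetime_section(1)[OF integrable_flux_integrand[of k]] by simp

text \<open>
  The real expression is what the weak formulation gives for the test function
  \<open>\<eta> t * cos (wavevec k \<bullet> x + \<alpha>)\<close> if \<open>w\<close> is the derivative of \<open>\<eta>\<close>.
\<close>

lemma weak_form_of_wave:
  assumes w: "w \<in> borel_measurable borel" and \<eta>: "\<eta> \<in> borel_measurable borel"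
    and C: "\<And>t. t \<in> {0..T} \<Longrightarrow> \<bar>w t\<bar> \<le> C" "\<And>t. t \<in> {0..T} \<Longrightarrow> \<bar>\<eta> t\<bar> \<le> C"
  shows "(LINT t|tim T. LINT x|tor. W t x * (w t * cos (wavevec k \<bullet> x + \<alpha>)
        + B t x \<bullet> ((- \<eta> t * sin (wavevec k \<bullet> x + \<alpha>)) *\<^sub>R wavevec k)
        + - \<eta> t * (wavevec k \<bullet> wavevec k) * cos (wavevec k \<bullet> x + \<alpha>)))
    = Re (cis \<alpha> * (LINT t|tim T. w t *\<^sub>R coef k t + \<eta> t *\<^sub>R rate k t))"
proof -
  let ?e = "\<lambda>t x. complex_of_real (W t x) * wave k x"
  let ?f = "\<lambda>t x. complex_of_real (W t x * (B t x \<bullet> wavevec k)) * wave k x"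
  let ?l = "complex_of_real (wavevec k \<bullet> wavevec k)"
  note i1 = AE_integrable_coef_integrand[of k] and i2 = AE_integrable_flux_integrand[of k]
  have inner: "AE t in tim T. (LINT x|tor. W t x * (w t * cos (wavevec k \<bullet> x + \<alpha>)
        + B t x \<bullet> ((- \<eta> t * sin (wavevec k \<bullet> x + \<alpha>)) *\<^sub>R wavevec k)
        + - \<eta> t * (wavevec k \<bullet> wavevec k) * cos (wavevec k \<bullet> x + \<alpha>)))
      = Re (cis \<alpha> * (w t *\<^sub>R coef k t + \<eta> t *\<^sub>R rate k t))"
    using i1 i2
  proof eventually_elim
    case (elim t)
    let ?\<Phi> = "\<lambda>x. cis \<alpha> * (w t *\<^sub>R ?e t x + \<eta> t *\<^sub>R (\<i> * ?f t x - ?l * ?e t x))"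
    have i\<Phi>: "integrable tor ?\<Phi>"
      using elim by (intro integrable_mult_right Bochner_Integration.integrable_add integrable_scaleR_right
          Bochner_Integration.integrable_diff) auto
    have "(LINT x|tor. W t x * (w t * cos (wavevec k \<bullet> x + \<alpha>)
        + B t x \<bullet> ((- \<eta> t * sin (wavevec k \<bullet> x + \<alpha>)) *\<^sub>R wavevec k)
        + - \<eta> t * (wavevec k \<bullet> wavevec k) * cos (wavevec k \<bullet> x + \<alpha>))) = (LINT x|tor. Re (?\<Phi> x))"
    proof (rule Bochner_Integration.integral_cong[OF refl])
      fix x
      have "?\<Phi> x = (w t * W t x) *\<^sub>R cis (wavevec k \<bullet> x + \<alpha>)
        + \<eta> t *\<^sub>R (\<i> * ((W t x * (B t x \<bullet> wavevec k)) *\<^sub>R cis (wavevec k \<bullet> x + \<alpha>))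
          - (wavevec k \<bullet> wavevec k * W t x) *\<^sub>R cis (wavevec k \<bullet> x + \<alpha>))"
        by (simp add: wave_def scaleR_conv_of_real algebra_simps flip: cis_mult)
      then have "Re (?\<Phi> x) = w t * W t x * cos (wavevec k \<bullet> x + \<alpha>)
        + \<eta> t * (- (W t x * (B t x \<bullet> wavevec k)) * sin (wavevec k \<bullet> x + \<alpha>)
          - (wavevec k \<bullet> wavevec k) * W t x * cos (wavevec k \<bullet> x + \<alpha>))"
        by simp
      then show "W t x * (w t * cos (wavevec k \<bullet> x + \<alpha>)
        + B t x \<bullet> ((- \<eta> t * sin (wavevec k \<bullet> x + \<alpha>)) *\<^sub>R wavevec k)
        + - \<eta> t * (wavevec k \<bullet> wavevec k) * cos (wavevec k \<bullet> x + \<alpha>)) = Re (?\<Phi> x)"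
        by (simp add: algebra_simps)
    qed
    also have "\<dots> = Re (LINT x|tor. ?\<Phi> x)" by (rule integral_Re[OF i\<Phi>])
    also have "(LINT x|tor. ?\<Phi> x) = cis \<alpha> * (LINT x|tor. w t *\<^sub>R ?e t x + \<eta> t *\<^sub>R (\<i> * ?f t x - ?l * ?e t x))"
      by (rule Bochner_Integration.integral_mult_right_zero)
    also have "(LINT x|tor. w t *\<^sub>R ?e t x + \<eta> t *\<^sub>R (\<i> * ?f t x - ?l * ?e t x))
        = w t *\<^sub>R (LINT x|tor. ?e t x) + \<eta> t *\<^sub>R (\<i> * (LINT x|tor. ?f t x) - ?l * (LINT x|tor. ?e t x))"
      using elim by (subst Bochner_Integration.integral_add, simp, simp, subst (2) Bochner_Integration.integral_scaleR_right,
          subst Bochner_Integration.integral_diff) simp_all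
    also have "\<dots> = w t *\<^sub>R coef k t + \<eta> t *\<^sub>R rate k t" by (simp add: coef_def rate_def)
    finally show ?case .
  qed
  have iw: "integrable (tim T) (\<lambda>t. w t *\<^sub>R coef k t)" "integrable (tim T) (\<lambda>t. \<eta> t *\<^sub>R rate k t)"
    by (rule integrable_tim_times_bounded_on[OF integrable_coef w C(1)], assumption)
      (rule integrable_tim_times_bounded_on[OF integrable_rate \<eta> C(2)], assumption)
  have iX: "integrable (tim T) (\<lambda>t. cis \<alpha> * (w t *\<^sub>R coef k t + \<eta> t *\<^sub>R rate k t))"
    by (intro integrable_mult_right Bochner_Integration.integrable_add iw)
  have "(LINT t|tim T. LINT x|tor. W t x * (w t * cos (wavevec k \<bullet> x + \<alpha>)
        + B t x \<bullet> ((- \<eta> t * sin (wavevec k \<bullet> x + \<alpha>)) *\<^sub>R wavevec k)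
        + - \<eta> t * (wavevec k \<bullet> wavevec k) * cos (wavevec k \<bullet> x + \<alpha>)))
      = (LINT t|tim T. Re (cis \<alpha> * (w t *\<^sub>R coef k t + \<eta> t *\<^sub>R rate k t)))"
  proof (rule integral_cong_AE)
    let ?\<Psi> = "\<lambda>z. W (fst z) (snd z) * (w (fst z) * cos (wavevec k \<bullet> snd z + \<alpha>)
        + B (fst z) (snd z) \<bullet> ((- \<eta> (fst z) * sin (wavevec k \<bullet> snd z + \<alpha>)) *\<^sub>R wavevec k)
        + - \<eta> (fst z) * (wavevec k \<bullet> wavevec k) * cos (wavevec k \<bullet> snd z + \<alpha>))"
    have "?\<Psi> \<in> borel_measurable borel" by (rule wave_test_borel[OF w \<eta> W_borel B_borel])
    from tor.borel_measurable_lebesgue_integral[of "\<lambda>t x. ?\<Psi> (t, x)" "tim T"] measurable_spacetimeI[OF this, of T]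
    show "(\<lambda>t. LINT x|tor. W t x * (w t * cos (wavevec k \<bullet> x + \<alpha>)
        + B t x \<bullet> ((- \<eta> t * sin (wavevec k \<bullet> x + \<alpha>)) *\<^sub>R wavevec k)
        + - \<eta> t * (wavevec k \<bullet> wavevec k) * cos (wavevec k \<bullet> x + \<alpha>))) \<in> borel_measurable (tim T)"
      by (simp add: case_prod_beta')
    show "(\<lambda>t. Re (cis \<alpha> * (w t *\<^sub>R coef k t + \<eta> t *\<^sub>R rate k t))) \<in> borel_measurable (tim T)"
      using iX by (intro measurable_compose[OF borel_measurable_integrable borel_measurable_Re])
  qed (rule inner)
  also have "\<dots> = Re (cis \<alpha> * (LINT t|tim T. w t *\<^sub>R coef k t + \<eta> t *\<^sub>R rate k t))"
    by (subst integral_Re[OF iX]) (simp only: Bochner_Integration.integral_mult_right_zero)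
  finally show ?thesis .
qed


end

lemma ennreal_powr_2: "ennreal_powr x 2 = x\<^sup>2"
  by (cases x) (auto simp: ennreal_powr_def ennreal_mult ennreal_top_mult power2_eq_square)

lemma Lr_Lp_square_representative:
  fixes b :: "real \<Rightarrow> real ^ 'n \<Rightarrow> real ^ 'n"
  assumes "b \<in> Lr_Lp T 2 p" "1 \<le> p"
    and B: "(\<lambda>z. B (fst z) (snd z)) \<in> borel_measurable borel" and eq: "AE t in tim T. AE x in tor. b t x = B t x"
  shows "(\<integral>\<^sup>+ t. (Lp_norm tor p (\<lambda>x. ennreal (norm (B t x))))\<^sup>2 \<partial>tim T) < \<infinity>"
proof -
  let ?N = "\<lambda>t. Lp_norm torus_measure p (\<lambda>x. ennreal (norm (b t x)))"
  have Bs: "B t \<in> borel_measurable borel" for t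
    using borel_measurable_section[OF B, of t] by simp
  have "AE t in tim T. (?N t)\<^sup>2 = (Lp_norm tor p (\<lambda>x. ennreal (norm (B t x))))\<^sup>2"
    using eq by eventually_elim (simp add: Lp_norm_torus_eq[OF Bs])
  moreover have "(\<lambda>t. (Lp_norm tor p (\<lambda>x. ennreal (norm (B t x))))\<^sup>2) \<in> borel_measurable (tim T)"
  proof -
    have "(\<lambda>z. ennreal (norm (B (fst z) (snd z)))) \<in> borel_measurable borel" using B by measurable
    from Lp_norm_tor_measurable[OF this assms(2), of T] show ?thesis
      by (intro borel_measurable_power_ennreal) simp
  qed
  ultimately have "(\<integral>\<^sup>+ t. (?N t)\<^sup>2 \<partial>lebesgue_on {0..T}) = (\<integral>\<^sup>+ t. (Lp_norm tor p (\<lambda>x. ennreal (norm (B t x))))\<^sup>2 \<partial>tim T)"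
    unfolding tim_def by (intro nn_integral_lebesgue_on_eq) (simp_all add: AE_lebesgue_on_time_iff[unfolded tim_def])
  moreover have "(\<integral>\<^sup>+ t. (?N t)\<^sup>2 \<partial>lebesgue_on {0..T}) < \<infinity>"
  proof -
    have "Lp_norm (lebesgue_on {0..T}) 2 ?N < \<infinity>" using assms(1) by (simp add: Lr_Lp_def)
    moreover have "(2 :: ennreal) \<noteq> \<infinity>" by simp
    moreover have "enn2real 2 = 2" by (metis enn2real_ennreal ennreal_numeral zero_le_numeral)
    ultimately have "ennreal_powr (\<integral>\<^sup>+ t. (?N t)\<^sup>2 \<partial>lebesgue_on {0..T}) (1 / 2) < \<infinity>"
      by (simp add: Lp_norm_finite_exponent ennreal_powr_2)
    then show ?thesis by (auto simp: less_top[symmetric])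
  qed
  ultimately show ?thesis by simp
qed

lemma Lr_Lp_infinity_representative:
  fixes u :: "real \<Rightarrow> real ^ 'n \<Rightarrow> real"
  assumes "u \<in> Lr_Lp T \<infinity> q"
    and U: "(\<lambda>z. U (fst z) (snd z)) \<in> borel_measurable borel" and eq: "AE t in tim T. AE x in tor. u t x = U t x"
  obtains C where "C < \<infinity>" "AE t in tim T. Lp_norm tor q (\<lambda>x. ennreal (norm (U t x))) \<le> C"
proof -
  let ?N = "\<lambda>t. Lp_norm torus_measure q (\<lambda>x. ennreal (norm (u t x)))"
  have Us: "U t \<in> borel_measurable borel" for t
    using borel_measurable_section[OF U, of t] by simp
  have "esssup (lebesgue_on {0..T}) ?N < \<infinity>" using assms(1) by (simp add: Lr_Lp_def Lp_norm_def)
  moreover have "AE t in tim T. Lp_norm tor q (\<lambda>x. ennreal (norm (U t x))) \<le> esssup (lebesgue_on {0..T}) ?N"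
    using esssup_AE[of ?N "lebesgue_on {0..T}"] eq unfolding AE_lebesgue_on_time_iff
  proof eventually_elim
    case (elim t)
    then show ?case using Lp_norm_torus_eq[OF Us elim(2), of q] by simp
  qed
  ultimately show thesis by (rule that)
qed

lemma Ck_bounded_on_interval:
  fixes \<eta> :: "real \<Rightarrow> real"
  assumes "Ck k \<eta>"
  obtains C where "\<And>t. t \<in> {a..b} \<Longrightarrow> \<bar>\<eta> t\<bar> \<le> C"
proof -
  have "bounded (\<eta> ` {a..b})"
    using Ck_continuous[OF assms]
    by (intro compact_imp_bounded compact_continuous_image) (auto intro: continuous_on_subset)
  then obtain C where "\<forall>y\<in>\<eta> ` {a..b}. norm y \<le> C" unfolding bounded_iff by blast
  then show thesis by (intro that[of C]) auto
qed

context advected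
begin

lemma solution_tested_with_wave:
  assumes sol: "distributional_solution T q b u0 u"
    and uW: "AE t in tim T. AE x in tor. u t x = W t x" and bB: "AE t in tim T. AE x in tor. b t x = B t x"
    and "c < T" and \<eta>: "\<And>t. (\<eta> has_real_derivative bump a c n t) (at t)" "\<And>t. t \<ge> c \<Longrightarrow> \<eta> t = 0" "\<And>j. Ck j \<eta>"
  shows "Re (cis \<alpha> * (LINT t|tim T. bump a c n t *\<^sub>R coef k t + \<eta> t *\<^sub>R rate k t))
    + (LINT x|torus_measure. u0 x * (\<eta> 0 * cos (wavevec k \<bullet> x + \<alpha>))) = 0"
proof -
  obtain C where C: "\<And>t. t \<in> {0..T} \<Longrightarrow> \<bar>\<eta> t\<bar> \<le> C"
    using Ck_bounded_on_interval[OF \<eta>(3)[of 0], where a = 0 and b = T] by blast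
  have \<eta>b: "\<eta> \<in> borel_measurable borel" using \<eta>(3)[of 0] by (simp add: borel_measurable_continuous_onI)
  let ?\<phi> = "\<lambda>t x. \<eta> t * cos (wavevec k \<bullet> x + \<alpha>)"
  let ?h = "\<lambda>t x. u t x * (deriv (\<lambda>s. ?\<phi> s x) t + b t x \<bullet> grad (?\<phi> t) x + laplacian (?\<phi> t) x)"
  let ?\<Phi> = "\<lambda>z. W (fst z) (snd z) * (bump a c n (fst z) * cos (wavevec k \<bullet> snd z + \<alpha>)
        + B (fst z) (snd z) \<bullet> ((- \<eta> (fst z) * sin (wavevec k \<bullet> snd z + \<alpha>)) *\<^sub>R wavevec k)
        + - \<eta> (fst z) * (wavevec k \<bullet> wavevec k) * cos (wavevec k \<bullet> snd z + \<alpha>))"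
  have deriv: "deriv (\<lambda>s. ?\<phi> s x) t = bump a c n t * cos (wavevec k \<bullet> x + \<alpha>)" for t x
    by (rule DERIV_imp_deriv) (auto intro!: derivative_eq_intros \<eta>(1))
  have "(LINT t|lebesgue_on {0..T}. LINT x|torus_measure. ?h t x) = (LINT t|tim T. LINT x|tor. ?\<Phi> (t, x))"
  proof (rule iterated_integral_eq)
    show "?\<Phi> \<in> borel_measurable borel" by (rule wave_test_borel[OF bump_measurable \<eta>b W_borel B_borel])
    show "AE t in tim T. AE x in tor. ?h t x = ?\<Phi> (t, x)"
      using uW bB
    proof eventually_elim
      case (elim t)
      show ?case
        using elim by eventually_elim (simp only: deriv grad_cos_wave laplacian_cos_wave fst_conv snd_conv)
    qed
  qed
  also have "\<dots> = Re (cis \<alpha> * (LINT t|tim T. bump a c n t *\<^sub>R coef k t + \<eta> t *\<^sub>R rate k t))"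
    unfolding fst_conv snd_conv
    by (rule weak_form_of_wave[where C = "max 1 C"])
      (use \<eta>b C in \<open>auto simp: bump_range abs_of_nonneg le_max_iff_disj\<close>)
  finally have "(LINT t|lebesgue_on {0..T}. LINT x|torus_measure. ?h t x)
      = Re (cis \<alpha> * (LINT t|tim T. bump a c n t *\<^sub>R coef k t + \<eta> t *\<^sub>R rate k t))" .
  moreover have "test_function T ?\<phi>"
    by (rule test_function_wave[OF \<eta>(3) \<eta>(2) \<open>c < T\<close>])
  with sol have "(LINT t|lebesgue_on {0..T}. LINT x|torus_measure. ?h t x) + (LINT x|torus_measure. u0 x * ?\<phi> 0 x) = 0"
    unfolding distributional_solution_def by blast
  ultimately show ?thesis by (simp only:)
qed

end

text \<open>
  Testing with a bump in time and a plane wave in space shows that the bumps are orthogonal to the Fourier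
  coefficient as a function of time.
\<close>

lemma divergence_free_fourier:
  fixes b :: "real \<Rightarrow> real ^ 'n \<Rightarrow> real ^ 'n"
  assumes div: "divergence_free T b" and "0 < T"
    and B: "(\<lambda>z. B (fst z) (snd z)) \<in> borel_measurable borel" and bB: "AE t in tim T. AE x in tor. b t x = B t x"
    and B2: "(\<integral>\<^sup>+ t. \<integral>\<^sup>+ x. ennreal ((norm (B t x))\<^sup>2) \<partial>tor \<partial>tim T) < \<infinity>"
  shows "AE t in tim T. (LINT x|tor. complex_of_real (B t x \<bullet> wavevec k) * wave k x) = 0"
proof -
  let ?f = "\<lambda>t x. complex_of_real (B t x \<bullet> wavevec k) * wave k x"
  let ?F = "\<lambda>z. ?f (fst z) (snd z)"
  define h where "h t = (LINT x|tor. ?f t x)" for t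
  have wb: "(\<lambda>z :: real \<times> (real ^ 'n). wave k (snd z)) \<in> borel_measurable borel"
    unfolding wave_def by (intro borel_measurable_continuous_onI continuous_intros)
  have Fb: "?F \<in> borel_measurable borel" using B wb by measurable
  have Bm: "(\<lambda>z. ennreal ((norm (B (fst z) (snd z)))\<^sup>2)) \<in> borel_measurable borel" using B by measurable
  have "integrable (tim T \<Otimes>\<^sub>M tor) ?F"
  proof (rule integrable_spacetime_if_square[OF Fb])
    have "(\<integral>\<^sup>+ t. \<integral>\<^sup>+ x. ennreal ((norm (?F (t, x)))\<^sup>2) \<partial>tor \<partial>tim T)
        \<le> (\<integral>\<^sup>+ t. \<integral>\<^sup>+ x. ennreal ((norm (wavevec k))\<^sup>2) * ennreal ((norm (B t x))\<^sup>2) \<partial>tor \<partial>tim T)"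
    proof (intro nn_integral_mono)
      fix t x
      have "\<bar>B t x \<bullet> wavevec k\<bar> \<le> \<bar>norm (wavevec k) * norm (B t x)\<bar>"
        using Cauchy_Schwarz_ineq2[of "B t x" "wavevec k"] by (simp add: mult.commute)
      then have "(B t x \<bullet> wavevec k)\<^sup>2 \<le> (norm (wavevec k) * norm (B t x))\<^sup>2" by (simp only: abs_le_square_iff)
      then show "ennreal ((norm (?F (t, x)))\<^sup>2) \<le> ennreal ((norm (wavevec k))\<^sup>2) * ennreal ((norm (B t x))\<^sup>2)"
        by (simp add: norm_mult power_mult_distrib ennreal_leI flip: ennreal_mult)
    qed
    also have "\<dots> = (\<integral>\<^sup>+ t. ennreal ((norm (wavevec k))\<^sup>2) * (\<integral>\<^sup>+ x. ennreal ((norm (B t x))\<^sup>2) \<partial>tor) \<partial>tim T)"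
      using borel_measurable_section[OF Bm] by (intro nn_integral_cong nn_integral_cmult measurable_torI) simp
    also have "\<dots> = ennreal ((norm (wavevec k))\<^sup>2) * (\<integral>\<^sup>+ t. \<integral>\<^sup>+ x. ennreal ((norm (B t x))\<^sup>2) \<partial>tor \<partial>tim T)"
      using nn_integral_tor_measurable[OF Bm, of T] by (intro nn_integral_cmult) simp
    also have "\<dots> < \<infinity>" using B2 by (simp add: ennreal_mult_less_top)
    finally show "(\<integral>\<^sup>+ t. \<integral>\<^sup>+ x. ennreal ((norm (?F (t, x)))\<^sup>2) \<partial>tor \<partial>tim T) < \<infinity>" .
  qed (use \<open>0 < T\<close> in simp)
  note sec = integrable_spacetime_section[OF this]
  have hint: "integrable (tim T) h" using sec(2) by (simp add: h_def[abs_def])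
  have isec: "AE t in tim T. integrable tor (?f t)" using sec(1) by simp
  have "AE t in tim T. h t = 0"
  proof (rule AE_zero_if_orthogonal_to_bumps[OF hint])
    fix a c :: real and n :: nat assume ac: "0 < a" "c < T"
    have "\<i> * (LINT t|tim T. bump a c n t *\<^sub>R h t) = 0"
    proof (rule complex_eq_0_if_Re_cis_mult)
      fix \<alpha>
      let ?\<Phi> = "\<lambda>z. B (fst z) (snd z) \<bullet> ((- bump a c n (fst z) * sin (wavevec k \<bullet> snd z + \<alpha>)) *\<^sub>R wavevec k)"
      have \<Phi>b: "?\<Phi> \<in> borel_measurable borel"
      proof -
        have fst: "(fst :: real \<times> (real ^ 'n) \<Rightarrow> real) \<in> borel_measurable borel"
          by (intro borel_measurable_continuous_onI continuous_intros)
        have [measurable]: "(\<lambda>z :: real \<times> (real ^ 'n). sin (wavevec k \<bullet> snd z + \<alpha>)) \<in> borel_measurable borel"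
          by (intro borel_measurable_continuous_onI continuous_intros)
        note [measurable] = measurable_compose[OF fst bump_measurable] B
        show ?thesis by measurable
      qed
      have ib: "integrable (tim T) (\<lambda>t. bump a c n t *\<^sub>R h t)"
        by (rule integrable_tim_times_bounded[OF hint, of _ 1]) (auto simp: bump_range abs_of_nonneg)
      have iX: "integrable (tim T) (\<lambda>t. cis \<alpha> * (\<i> * (bump a c n t *\<^sub>R h t)))"
        by (intro integrable_mult_right ib)
      have "0 = (LINT t|lebesgue_on {0..T}. LINT x|torus_measure. b t x \<bullet> grad (\<lambda>x. bump a c n t * cos (wavevec k \<bullet> x + \<alpha>)) x)"
        using div interior_test_function_wave[OF ac, of n k \<alpha>] unfolding divergence_free_def by simp
      also have "\<dots> = (LINT t|tim T. LINT x|tor. ?\<Phi> (t, x))"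
      proof (rule iterated_integral_eq[OF \<Phi>b])
        show "AE t in tim T. AE x in tor. b t x \<bullet> grad (\<lambda>x. bump a c n t * cos (wavevec k \<bullet> x + \<alpha>)) x = ?\<Phi> (t, x)"
          using bB
        proof eventually_elim
          case (elim t)
          then show ?case by eventually_elim (simp only: grad_cos_wave fst_conv snd_conv)
        qed
      qed
      also have "\<dots> = (LINT t|tim T. Re (cis \<alpha> * (\<i> * (bump a c n t *\<^sub>R h t))))"
      proof (rule integral_cong_AE)
        show "(\<lambda>t. LINT x|tor. ?\<Phi> (t, x)) \<in> borel_measurable (tim T)"
          by (rule tor.borel_measurable_lebesgue_integral) (use measurable_spacetimeI[OF \<Phi>b] in simp)
        show "(\<lambda>t. Re (cis \<alpha> * (\<i> * (bump a c n t *\<^sub>R h t)))) \<in> borel_measurable (tim T)"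
          using iX by (intro measurable_compose[OF borel_measurable_integrable borel_measurable_Re])
        show "AE t in tim T. (LINT x|tor. ?\<Phi> (t, x)) = Re (cis \<alpha> * (\<i> * (bump a c n t *\<^sub>R h t)))"
          using isec
        proof eventually_elim
          case (elim t)
          have i\<Phi>: "integrable tor (\<lambda>x. cis \<alpha> * (\<i> * (bump a c n t *\<^sub>R ?f t x)))"
            using elim by (intro integrable_mult_right integrable_scaleR_right)
          have "(LINT x|tor. ?\<Phi> (t, x)) = (LINT x|tor. Re (cis \<alpha> * (\<i> * (bump a c n t *\<^sub>R ?f t x))))"
          proof (rule Bochner_Integration.integral_cong[OF refl])
            fix x
            have "cis \<alpha> * (\<i> * (bump a c n t *\<^sub>R ?f t x)) = \<i> * ((bump a c n t * (B t x \<bullet> wavevec k)) *\<^sub>R cis (wavevec k \<bullet> x + \<alpha>))"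
              by (simp add: wave_def scaleR_conv_of_real algebra_simps flip: cis_mult)
            then show "?\<Phi> (t, x) = Re (cis \<alpha> * (\<i> * (bump a c n t *\<^sub>R ?f t x)))"
              by simp
          qed
          also have "\<dots> = Re (LINT x|tor. cis \<alpha> * (\<i> * (bump a c n t *\<^sub>R ?f t x)))" by (rule integral_Re[OF i\<Phi>])
          also have "(LINT x|tor. cis \<alpha> * (\<i> * (bump a c n t *\<^sub>R ?f t x))) = cis \<alpha> * (\<i> * (bump a c n t *\<^sub>R h t))"
            unfolding h_def by (simp only: Bochner_Integration.integral_mult_right_zero Bochner_Integration.integral_scaleR_right)
          finally show ?case .
        qed
      qed
      also have "\<dots> = Re (cis \<alpha> * (\<i> * (LINT t|tim T. bump a c n t *\<^sub>R h t)))"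
        by (subst integral_Re[OF iX]) (simp only: Bochner_Integration.integral_mult_right_zero)
      finally show "Re (cis \<alpha> * (\<i> * (LINT t|tim T. bump a c n t *\<^sub>R h t))) = 0" by simp
    qed
    then show "(LINT t|tim T. bump a c n t *\<^sub>R h t) = 0" by simp
  qed
  then show ?thesis by (simp add: h_def)
qed

lemma advected_if_Lp_bound:
  fixes U :: "real \<Rightarrow> real ^ 'n \<Rightarrow> real"
  assumes "0 < T" "1 \<le> p" "1 \<le> q" "1 / p + 1 / q \<le> 1 / 2"
    and U: "(\<lambda>z. U (fst z) (snd z)) \<in> borel_measurable borel" "\<And>t. lattice_periodic (U t)"
    and B: "(\<lambda>z. B (fst z) (snd z)) \<in> borel_measurable borel" "\<And>t. lattice_periodic (B t)"
    and BN: "(\<integral>\<^sup>+ t. (Lp_norm tor p (\<lambda>x. ennreal (norm (B t x))))\<^sup>2 \<partial>tim T) < \<infinity>"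
    and C: "C < \<infinity>" "AE t in tim T. Lp_norm tor q (\<lambda>x. ennreal (norm (U t x))) \<le> C"
  shows "advected T U B p (3 * C\<^sup>2)"
proof
  have Us: "U t \<in> borel_measurable borel" for t
    using borel_measurable_section[OF U(1), of t] by simp
  show "3 * C\<^sup>2 < \<infinity>" using C(1) by (simp add: ennreal_mult_less_top power_less_top_ennreal)
  show "AE t in tim T. \<forall>g\<in>borel_measurable borel. lattice_periodic g \<longrightarrow>
      (\<integral>\<^sup>+ x. (g x)\<^sup>2 * ennreal ((U t x)\<^sup>2) \<partial>tor) \<le> 3 * C\<^sup>2 * (Lp_norm tor p g)\<^sup>2"
    using C(2)
  proof (eventually_elim, intro ballI impI)
    fix t and g :: "real ^ 'n \<Rightarrow> ennreal"
    assume le: "Lp_norm tor q (\<lambda>x. ennreal (norm (U t x))) \<le> C" and g: "g \<in> borel_measurable borel"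
    have "(\<integral>\<^sup>+ x. (g x)\<^sup>2 * ennreal ((U t x)\<^sup>2) \<partial>tor) = (\<integral>\<^sup>+ x. (g x)\<^sup>2 * (ennreal (norm (U t x)))\<^sup>2 \<partial>tor)"
      by (simp add: ennreal_power)
    also have "\<dots> \<le> 3 * (Lp_norm tor p g)\<^sup>2 * (Lp_norm tor q (\<lambda>x. ennreal (norm (U t x))))\<^sup>2"
      by (rule Hoelder_square[OF prob_space_tor assms(2-4)]) (use g Us[of t] in \<open>auto intro!: measurable_torI\<close>)
    also have "\<dots> \<le> 3 * (Lp_norm tor p g)\<^sup>2 * C\<^sup>2"
      by (intro mult_left_mono power_mono le) auto
    finally show "(\<integral>\<^sup>+ x. (g x)\<^sup>2 * ennreal ((U t x)\<^sup>2) \<partial>tor) \<le> 3 * C\<^sup>2 * (Lp_norm tor p g)\<^sup>2"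
      by (simp add: ac_simps)
  qed
qed (use assms in auto)

lemma advected_diff:
  assumes "advected T U B p K" "advected T V B p L"
  shows "advected T (\<lambda>t x. U t x - V t x) B p (2 * K + 2 * L)"
proof -
  interpret U: advected T U B p K by fact
  interpret V: advected T V B p L by fact
  show ?thesis
  proof
    show "2 * K + 2 * L < \<infinity>" using U.K V.K by (simp add: ennreal_mult_less_top)
    show "(\<lambda>z. U (fst z) (snd z) - V (fst z) (snd z)) \<in> borel_measurable borel"
      using U.W_borel V.W_borel by measurable
    show "lattice_periodic (\<lambda>x. U t x - V t x)" for t
      using U.W_periodic[of t] V.W_periodic[of t] by (simp add: lattice_periodic_def)
    show "AE t in tim T. \<forall>g\<in>borel_measurable borel. lattice_periodic g \<longrightarrow>
      (\<integral>\<^sup>+ x. (g x)\<^sup>2 * ennreal ((U t x - V t x)\<^sup>2) \<partial>tor) \<le> (2 * K + 2 * L) * (Lp_norm tor p g)\<^sup>2"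
      using U.multiplier V.multiplier
    proof (eventually_elim, intro ballI impI)
      fix t and g :: "real ^ 'a \<Rightarrow> ennreal"
      assume 1: "\<forall>g\<in>borel_measurable borel. lattice_periodic g \<longrightarrow>
          (\<integral>\<^sup>+ x. (g x)\<^sup>2 * ennreal ((U t x)\<^sup>2) \<partial>tor) \<le> K * (Lp_norm tor p g)\<^sup>2"
        and 2: "\<forall>g\<in>borel_measurable borel. lattice_periodic g \<longrightarrow>
          (\<integral>\<^sup>+ x. (g x)\<^sup>2 * ennreal ((V t x)\<^sup>2) \<partial>tor) \<le> L * (Lp_norm tor p g)\<^sup>2"
        and g: "g \<in> borel_measurable borel" "lattice_periodic g"
      have m1: "(\<lambda>x. (g x)\<^sup>2 * ennreal ((U t x)\<^sup>2)) \<in> borel_measurable tor"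
        and m2: "(\<lambda>x. (g x)\<^sup>2 * ennreal ((V t x)\<^sup>2)) \<in> borel_measurable tor"
        using g(1) by (auto intro!: measurable_torI)
      have "(\<integral>\<^sup>+ x. (g x)\<^sup>2 * ennreal ((U t x - V t x)\<^sup>2) \<partial>tor)
          \<le> (\<integral>\<^sup>+ x. 2 * ((g x)\<^sup>2 * ennreal ((U t x)\<^sup>2)) + 2 * ((g x)\<^sup>2 * ennreal ((V t x)\<^sup>2)) \<partial>tor)"
      proof (rule nn_integral_mono)
        fix x
        have "ennreal ((U t x - V t x)\<^sup>2) \<le> ennreal (2 * ((U t x)\<^sup>2 + (V t x)\<^sup>2))"
          using square_sum2_le[of "U t x" "- V t x"] by (intro ennreal_leI) simp
        also have "\<dots> = 2 * (ennreal ((U t x)\<^sup>2) + ennreal ((V t x)\<^sup>2))"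
          by (simp add: ennreal_mult)
        finally have "(g x)\<^sup>2 * ennreal ((U t x - V t x)\<^sup>2) \<le> (g x)\<^sup>2 * (2 * (ennreal ((U t x)\<^sup>2) + ennreal ((V t x)\<^sup>2)))"
          by (rule mult_left_mono) simp
        then show "(g x)\<^sup>2 * ennreal ((U t x - V t x)\<^sup>2)
          \<le> 2 * ((g x)\<^sup>2 * ennreal ((U t x)\<^sup>2)) + 2 * ((g x)\<^sup>2 * ennreal ((V t x)\<^sup>2))"
          by (simp add: distrib_left mult.left_commute)
      qed
      also have "\<dots> = 2 * (\<integral>\<^sup>+ x. (g x)\<^sup>2 * ennreal ((U t x)\<^sup>2) \<partial>tor) + 2 * (\<integral>\<^sup>+ x. (g x)\<^sup>2 * ennreal ((V t x)\<^sup>2) \<partial>tor)"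
        by (subst nn_integral_add[OF borel_measurable_times_ennreal[OF borel_measurable_const m1]
              borel_measurable_times_ennreal[OF borel_measurable_const m2]],
            subst nn_integral_cmult[OF m1], subst nn_integral_cmult[OF m2], rule refl)
      also have "\<dots> \<le> 2 * (K * (Lp_norm tor p g)\<^sup>2) + 2 * (L * (Lp_norm tor p g)\<^sup>2)"
        using 1 2 g by (intro add_mono mult_left_mono) auto
      finally show "(\<integral>\<^sup>+ x. (g x)\<^sup>2 * ennreal ((U t x - V t x)\<^sup>2) \<partial>tor) \<le> (2 * K + 2 * L) * (Lp_norm tor p g)\<^sup>2"
        by (simp add: distrib_right mult.assoc)
    qed
  qed (use U.T U.p U.B_borel U.B_periodic U.B_norm in auto)
qed

text \<open>
  In space, the integrals of the differences split where the functions are integrable, which is the case at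
  almost every time.
\<close>

lemma weak_equation_diff:
  fixes U V :: "real \<Rightarrow> real ^ 'n \<Rightarrow> real"
  assumes "advected T U B p K" "advected T V B p L"
    and w: "w \<in> borel_measurable borel" "\<eta> \<in> borel_measurable borel"
    and C: "\<And>t. t \<in> {0..T} \<Longrightarrow> \<bar>w t\<bar> \<le> C" "\<And>t. t \<in> {0..T} \<Longrightarrow> \<bar>\<eta> t\<bar> \<le> C"
  shows "(LINT t|tim T. w t *\<^sub>R advected.coef (\<lambda>t x. U t x - V t x) k t + \<eta> t *\<^sub>R advected.rate (\<lambda>t x. U t x - V t x) B k t)
    = (LINT t|tim T. w t *\<^sub>R advected.coef U k t + \<eta> t *\<^sub>R advected.rate U B k t)
      - (LINT t|tim T. w t *\<^sub>R advected.coef V k t + \<eta> t *\<^sub>R advected.rate V B k t)"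
proof -
  interpret U: advected T U B p K by fact
  interpret V: advected T V B p L by fact
  interpret D: advected T "\<lambda>t x. U t x - V t x" B p "2 * K + 2 * L"
    by (rule advected_diff[OF assms(1,2)])
  have coef: "AE t in tim T. D.coef k t = U.coef k t - V.coef k t"
    using U.AE_integrable_coef_integrand[of k] V.AE_integrable_coef_integrand[of k]
  proof eventually_elim
    case (elim t)
    from Bochner_Integration.integral_diff[OF this] show ?case
      by (simp add: U.coef_def V.coef_def D.coef_def left_diff_distrib)
  qed
  have rate: "AE t in tim T. D.rate k t = U.rate k t - V.rate k t"
    using U.AE_integrable_flux_integrand[of k] V.AE_integrable_flux_integrand[of k] coef
  proof eventually_elim
    case (elim t)
    from Bochner_Integration.integral_diff[OF elim(1,2)] show ?case
      by (simp add: U.rate_def V.rate_def D.rate_def elim(3) left_diff_distrib right_diff_distrib)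
  qed
  have iU: "integrable (tim T) (\<lambda>t. w t *\<^sub>R U.coef k t + \<eta> t *\<^sub>R U.rate k t)"
    by (intro Bochner_Integration.integrable_add integrable_tim_times_bounded_on[OF U.integrable_coef w(1) C(1)]
        integrable_tim_times_bounded_on[OF U.integrable_rate w(2) C(2)])
  have iV: "integrable (tim T) (\<lambda>t. w t *\<^sub>R V.coef k t + \<eta> t *\<^sub>R V.rate k t)"
    by (intro Bochner_Integration.integrable_add integrable_tim_times_bounded_on[OF V.integrable_coef w(1) C(1)]
        integrable_tim_times_bounded_on[OF V.integrable_rate w(2) C(2)])
  have iD: "integrable (tim T) (\<lambda>t. w t *\<^sub>R D.coef k t + \<eta> t *\<^sub>R D.rate k t)"
    by (intro Bochner_Integration.integrable_add integrable_tim_times_bounded_on[OF D.integrable_coef w(1) C(1)]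
        integrable_tim_times_bounded_on[OF D.integrable_rate w(2) C(2)])
  have "(LINT t|tim T. w t *\<^sub>R D.coef k t + \<eta> t *\<^sub>R D.rate k t)
      = (LINT t|tim T. (w t *\<^sub>R U.coef k t + \<eta> t *\<^sub>R U.rate k t) - (w t *\<^sub>R V.coef k t + \<eta> t *\<^sub>R V.rate k t))"
  proof (rule integral_cong_AE)
    show "AE t in tim T. w t *\<^sub>R D.coef k t + \<eta> t *\<^sub>R D.rate k t
        = (w t *\<^sub>R U.coef k t + \<eta> t *\<^sub>R U.rate k t) - (w t *\<^sub>R V.coef k t + \<eta> t *\<^sub>R V.rate k t)"
      using coef rate by eventually_elim (simp add: scaleR_diff_right)
  qed (use iU iV iD in auto)
  then show ?thesis using Bochner_Integration.integral_diff[OF iU iV] by simp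
qed

theorem corollary3p5:
  fixes T :: real and p q :: ennreal
    and b :: "real \<Rightarrow> real ^ 'n \<Rightarrow> real ^ 'n" and u0 :: "real ^ 'n \<Rightarrow> real"
  assumes "T > 0" and "1 \<le> p" and "1 \<le> q" and "1 / p + 1 / q \<le> 1 / 2"
    and "b \<in> Lr_Lp T 2 p" and "divergence_free T b"
    and "u0 \<in> Lp_torus q"
  shows "\<forall>u v. distributional_solution T q b u0 u \<and> distributional_solution T q b u0 v \<longrightarrow>
    (AE z in lebesgue_on ({0..T} \<times> unit_cube). u (fst z) (snd z) = v (fst z) (snd z))"
proof (intro allI impI)
  fix u v :: "real \<Rightarrow> real ^ 'n \<Rightarrow> real"
  assume "distributional_solution T q b u0 u \<and> distributional_solution T q b u0 v"
  then have solu: "distributional_solution T q b u0 u" and solv: "distributional_solution T q b u0 v" by auto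
  then have uL: "u \<in> Lr_Lp T \<infinity> q" and vL: "v \<in> Lr_Lp T \<infinity> q"
    by (auto simp: distributional_solution_def)
  have bm: "(\<lambda>(t, x). b t x) \<in> borel_measurable (lebesgue_on ({0..T} \<times> unit_cube))"
    and um: "(\<lambda>(t, x). u t x) \<in> borel_measurable (lebesgue_on ({0..T} \<times> unit_cube))"
    and vm: "(\<lambda>(t, x). v t x) \<in> borel_measurable (lebesgue_on ({0..T} \<times> unit_cube))"
    using assms(5) uL vL by (auto simp: Lr_Lp_def)
  obtain B where B: "(\<lambda>z. B (fst z) (snd z)) \<in> borel_measurable borel" "\<And>t. lattice_periodic (B t)"
    and bB: "AE t in tim T. AE x in tor. b t x = B t x"
    by (rule borel_periodic_representative[OF bm]) (rule that; assumption)
  obtain U where U: "(\<lambda>z. U (fst z) (snd z)) \<in> borel_measurable borel" "\<And>t. lattice_periodic (U t)"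
    and uUz: "AE z in lborel. z \<in> {0..T} \<times> unit_cube \<longrightarrow> u (fst z) (snd z) = U (fst z) (snd z)"
    and uU: "AE t in tim T. AE x in tor. u t x = U t x"
    by (rule borel_periodic_representative[OF um]) (rule that; assumption)
  obtain V where V: "(\<lambda>z. V (fst z) (snd z)) \<in> borel_measurable borel" "\<And>t. lattice_periodic (V t)"
    and vVz: "AE z in lborel. z \<in> {0..T} \<times> unit_cube \<longrightarrow> v (fst z) (snd z) = V (fst z) (snd z)"
    and vV: "AE t in tim T. AE x in tor. v t x = V t x"
    by (rule borel_periodic_representative[OF vm]) (rule that; assumption)
  have BN: "(\<integral>\<^sup>+ t. (Lp_norm tor p (\<lambda>x. ennreal (norm (B t x))))\<^sup>2 \<partial>tim T) < \<infinity>"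
    by (rule Lr_Lp_square_representative[OF assms(5,2) B(1) bB])
  obtain C where C: "C < \<infinity>" "AE t in tim T. Lp_norm tor q (\<lambda>x. ennreal (norm (U t x))) \<le> C"
    by (rule Lr_Lp_infinity_representative[OF uL U(1) uU])
  obtain C' where C': "C' < \<infinity>" "AE t in tim T. Lp_norm tor q (\<lambda>x. ennreal (norm (V t x))) \<le> C'"
    by (rule Lr_Lp_infinity_representative[OF vL V(1) vV])
  note aU = advected_if_Lp_bound[OF assms(1-4) U B BN C]
  note aV = advected_if_Lp_bound[OF assms(1-4) V B BN C']
  let ?W = "\<lambda>t x. U t x - V t x"
  let ?K = "2 * (3 * C\<^sup>2) + 2 * (3 * C'\<^sup>2)"
  interpret U: advected T U B p "3 * C\<^sup>2" by (rule aU)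
  interpret V: advected T V B p "3 * C'\<^sup>2" by (rule aV)
  have Bs: "B t \<in> borel_measurable borel" for t by (rule U.B_section)
  have B2: "(\<integral>\<^sup>+ t. \<integral>\<^sup>+ x. ennreal ((norm (B t x))\<^sup>2) \<partial>tor \<partial>tim T) < \<infinity>"
  proof -
    have "(\<integral>\<^sup>+ x. ennreal ((norm (B t x))\<^sup>2) \<partial>tor) \<le> 3 * (Lp_norm tor p (\<lambda>x. ennreal (norm (B t x))))\<^sup>2" for t
    proof -
      have "(\<integral>\<^sup>+ x. ennreal ((norm (B t x))\<^sup>2) \<partial>tor) = (\<integral>\<^sup>+ x. (ennreal (norm (B t x)))\<^sup>2 * 1\<^sup>2 \<partial>tor)"
        by (simp add: ennreal_power)
      also have "\<dots> \<le> 3 * (Lp_norm tor p (\<lambda>x. ennreal (norm (B t x))))\<^sup>2 * (Lp_norm (tor :: (real ^ 'n) measure) q (\<lambda>_. 1))\<^sup>2"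
        by (rule Hoelder_square[OF prob_space_tor assms(2-4)]) (use Bs[of t] in \<open>auto intro!: measurable_torI\<close>)
      finally show ?thesis by (simp add: Lp_norm_one[OF prob_space_tor assms(3)])
    qed
    then have "(\<integral>\<^sup>+ t. \<integral>\<^sup>+ x. ennreal ((norm (B t x))\<^sup>2) \<partial>tor \<partial>tim T)
        \<le> (\<integral>\<^sup>+ t. 3 * (Lp_norm tor p (\<lambda>x. ennreal (norm (B t x))))\<^sup>2 \<partial>tim T)"
      by (rule nn_integral_mono)
    also have "\<dots> = 3 * (\<integral>\<^sup>+ t. (Lp_norm tor p (\<lambda>x. ennreal (norm (B t x))))\<^sup>2 \<partial>tim T)"
    proof (rule nn_integral_cmult)
      have "(\<lambda>t. Lp_norm tor p (\<lambda>x. ennreal (norm (B t x)))) \<in> borel_measurable (tim T)"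
        using Lp_norm_tor_measurable[OF U.speed_borel assms(2), of T] by (simp add: U.speed_def)
      then show "(\<lambda>t. (Lp_norm tor p (\<lambda>x. ennreal (norm (B t x))))\<^sup>2) \<in> borel_measurable (tim T)"
        by (intro borel_measurable_power_ennreal)
    qed
    also have "\<dots> < \<infinity>" using BN by (simp add: ennreal_mult_less_top)
    finally show ?thesis .
  qed
  interpret W: advected T ?W B p ?K by (rule advected_diff[OF aU aV])
  interpret W: parabolic T ?W B p ?K
  proof
    show "(\<integral>\<^sup>+ t. \<integral>\<^sup>+ x. ennreal ((norm (B t x))\<^sup>2) \<partial>tor \<partial>tim T) < \<infinity>" by (rule B2)
    show "AE t in tim T. (LINT x|tor. complex_of_real (B t x \<bullet> wavevec k) * wave k x) = 0" for k
      by (rule divergence_free_fourier[OF assms(6,1) B(1) bB B2])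
    fix a c :: real and n :: nat and \<eta> :: "real \<Rightarrow> real" and k :: "int ^ 'n"
    assume c: "c < T" and \<eta>: "\<And>t. (\<eta> has_real_derivative bump a c n t) (at t)" "\<And>t. t \<ge> c \<Longrightarrow> \<eta> t = 0" "\<And>j. Ck j \<eta>"
    obtain M where M: "\<And>t. t \<in> {0..T} \<Longrightarrow> \<bar>\<eta> t\<bar> \<le> M"
      using Ck_bounded_on_interval[OF \<eta>(3)[of 0], where a = 0 and b = T] by blast
    have \<eta>b: "\<eta> \<in> borel_measurable borel" using \<eta>(3)[of 0] by (simp add: borel_measurable_continuous_onI)
    \<comment> \<open>The terms with the common initial datum cancel.\<close>
    have "(LINT t|tim T. bump a c n t *\<^sub>R U.coef k t + \<eta> t *\<^sub>R U.rate k t)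
        - (LINT t|tim T. bump a c n t *\<^sub>R V.coef k t + \<eta> t *\<^sub>R V.rate k t) = 0"
    proof (rule complex_eq_0_if_Re_cis_mult)
      fix \<alpha>
      show "Re (cis \<alpha> * ((LINT t|tim T. bump a c n t *\<^sub>R U.coef k t + \<eta> t *\<^sub>R U.rate k t)
        - (LINT t|tim T. bump a c n t *\<^sub>R V.coef k t + \<eta> t *\<^sub>R V.rate k t))) = 0"
      proof -
        have cancel: "x - y = 0" if "x + z = 0" "y + z = 0" for x y z :: real
          using that by simp
        show ?thesis
          unfolding right_diff_distrib minus_complex.sel
          by (rule cancel[OF U.solution_tested_with_wave[OF solu uU bB c \<eta>] V.solution_tested_with_wave[OF solv vV bB c \<eta>]])
      qed
    qed
    also have "(LINT t|tim T. bump a c n t *\<^sub>R U.coef k t + \<eta> t *\<^sub>R U.rate k t)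
        - (LINT t|tim T. bump a c n t *\<^sub>R V.coef k t + \<eta> t *\<^sub>R V.rate k t)
      = (LINT t|tim T. bump a c n t *\<^sub>R W.coef k t + \<eta> t *\<^sub>R W.rate k t)"
      by (rule weak_equation_diff[OF aU aV bump_measurable \<eta>b, where C = "max 1 M", symmetric])
        (use M in \<open>auto simp: bump_range abs_of_nonneg le_max_iff_disj\<close>)
    finally show "(LINT t|tim T. bump a c n t *\<^sub>R W.coef k t + \<eta> t *\<^sub>R W.rate k t) = 0" .
  qed
  have "AE t in tim T. AE x in tor. U t x - V t x = 0" by (rule W.solution_vanishes)
  then have "AE t in lborel. AE x in lborel. t \<in> {0..T} \<longrightarrow> x \<in> halfopen_cube 0 \<longrightarrow> U t x = V t x"
    unfolding AE_tim_iff AE_tor_iff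
  proof eventually_elim
    case (elim t)
    then show ?case by (cases "t \<in> {0..T}") simp_all
  qed
  then have "AE t in lborel. AE x in lborel. t \<in> {0..T} \<longrightarrow> x \<in> cbox 0 1 \<longrightarrow> U t x = V t x"
  proof eventually_elim
    case (elim t)
    then show ?case
      using AE_unit_cube_open by eventually_elim (use halfopen_cube_bounds(1) in auto)
  qed
  moreover have "{z \<in> space ((lborel :: real measure) \<Otimes>\<^sub>M (lborel :: (real ^ 'n) measure)).
      fst z \<in> {0..T} \<longrightarrow> snd z \<in> cbox 0 1 \<longrightarrow> U (fst z) (snd z) = V (fst z) (snd z)}
    \<in> sets ((lborel :: real measure) \<Otimes>\<^sub>M (lborel :: (real ^ 'n) measure))"
  proof -
    have [measurable]: "(\<lambda>z. U (fst z) (snd z)) \<in> borel_measurable ((lborel :: real measure) \<Otimes>\<^sub>M (lborel :: (real ^ 'n) measure))"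
      "(\<lambda>z. V (fst z) (snd z)) \<in> borel_measurable ((lborel :: real measure) \<Otimes>\<^sub>M (lborel :: (real ^ 'n) measure))"
      using U(1) V(1) unfolding lborel_prod by simp_all
    show ?thesis by measurable
  qed
  ultimately have "AE z in (lborel :: real measure) \<Otimes>\<^sub>M (lborel :: (real ^ 'n) measure).
      fst z \<in> {0..T} \<longrightarrow> snd z \<in> cbox 0 1 \<longrightarrow> U (fst z) (snd z) = V (fst z) (snd z)"
    by (intro pair_sigma_finite.AE_pair_measure[OF pair_sigma_finite.intro[OF sigma_finite_lborel sigma_finite_lborel]]) simp_all
  then have "AE z in (lborel :: (real \<times> (real ^ 'n)) measure).
      fst z \<in> {0..T} \<longrightarrow> snd z \<in> cbox 0 1 \<longrightarrow> U (fst z) (snd z) = V (fst z) (snd z)"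
    by (simp only: lborel_prod)
  then have "AE z in lborel. z \<in> {0..T} \<times> unit_cube \<longrightarrow> u (fst z) (snd z) = v (fst z) (snd z)"
    using uUz vVz by eventually_elim auto
  moreover have "{0..T} \<times> (unit_cube :: (real ^ 'n) set) \<in> sets borel" by (auto simp: borel_prod[symmetric])
  ultimately show "AE z in lebesgue_on ({0..T} \<times> unit_cube). u (fst z) (snd z) = v (fst z) (snd z)"
    by (simp add: AE_lebesgue_on_iff)
qed

end
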